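(* Let $P=P(x)$ be a solution of the generalised Chazy equation with parameter $k=\tfrac32$, and let $Q,R,\rho,\xi,\chi,J,c_1,c_2,c_3$ and the vector field $X^3$ be the functions and vector field built from $P$ as specified in the context. Consider the maximally symmetric $(2,3,5)$-distribution spanned, in local coordinates $(x,y,z,p,q)$, by $$X^1=\partial_q,\qquad X^2=\partial_x+p\,\partial_y+q\,\partial_p+q^2e^{-\frac23\int P\,dx}\,\partial_z ,$$ which is annihilated by the 1-forms $dy-p\,dx$, $dp-q\,dx$, $dz-\frac{q^2}{H''(x)}dx$ with $H''(x)=e^{\frac23\int P\,dx}$. Define $$\begin{aligned} S^1&=-\rho^2\Big(48y\xi^3+48\big(\tfrac{P}{3}y-p\big)\xi^2-16\big(\tfrac{Q-5P^2}{60}y+pP-\tfrac32 q\big)\xi-\tfrac43\big(\tfrac{2}{45}(PQ+R)y+(P^2+\tfrac{Q}{15})p-6Pq\big)\Big)X^1-8\rho^2X^2,\\ S^2&=\frac{e^{\frac13\int P\,dx}}{4\rho}X^1,\\ S^3&=\ell_3X^1+\frac{2e^{-\frac13\int P\,dx}}{3\rho}\Big(\rho^4\chi^2\big(9y\xi^2+2(Py-3p)\xi-(\tfrac{Q}{60}-\tfrac{P^2}{12})y-Pp+\tfrac32q\big)+\tfrac32\rho^2\chi\big(3y\xi+\tfrac P3y-p\big)-\tfrac92y\Big)X^2\\ &\quad-\frac{e^{-\frac23\int P\,dx}}{9\rho^2}\Big(\rho^2\chi\big(9y\xi^2+2(Py-3p)\xi-(\tfrac{Q}{60}-\tfrac{P^2}{12})y-Pp+\tfrac32q\big)+9y\xi+Py-3p\Big)^2X^3,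 \end{aligned}$$ where $$\begin{aligned} \ell_3&=\frac{\rho e^{\frac13\int P\,dx}}{6}\Big(\big(36\xi^2+12P\xi+P^2+\tfrac{Q}{15}\big)\rho^2\chi-4P-24\xi\Big)c_3^2+\frac{e^{\frac13\int P\,dx}}{4\rho}c_2\\ &\quad+\rho^2\Big(48\xi^3y+48\big(\tfrac P3y-p\big)\xi^2-16\big(\tfrac{Q-5P^2}{60}y+pP-\tfrac32q\big)\xi-\tfrac43\big(\tfrac2{45}(PQ+R)y+(P^2+\tfrac Q{15})p-6Pq\big)\Big)c_1 . \end{aligned}$$ Then $\{S^1,S^2,S^3\}$ pairwise bracket-generates the Lie algebra of split $\mathfrak g_2$.
   Context: A $(2,3,5)$-distribution is a rank 2 distribution $D$ on a 5-manifold such that $[D,D]$ has rank 3 and $[D,[D,D]]$ is the full tangent bundle. It is maximally symmetric if its associated Nurowski conformal structure of signature $(2,3)$ has vanishing Weyl tensor; its local symmetry algebra is then split $\mathfrak g_2$. Everything is local, on domains where the functions used are defined and denominators do not vanish; all antiderivatives are fixed once and for all (the same choice of $\int P\,dx$ is used throughout). The generalised Chazy equation with parameter $k$ is $$P'''-2PP''+3P'^2-\frac{4}{36-k^2}(6P'-P^2)^2=0,\qquad {}'=\frac{d}{dx}.$$ With $Q=P^2-6P'$ and $R=PQ-\tfrac32Q'$, for $k=\tfrac32$ it is equivalent to the system $P'=\frac16(P^2-Q)$, $Q'=\frac23(PQ-R)$, $R'=PR+\frac1{15}Q^2$. Let $\rho=\rho(x)$ be a not identically zero solution of $\rho''-\frac1{45}Q\rho=0$,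 and set $\xi=\rho'/\rho$, $\chi=\int\rho^{-2}dx$, $$J=\tfrac23\rho e^{-\frac13\int P\,dx}\Big(9y\xi^2+2(Py-3p)\xi-(\tfrac Q{60}-\tfrac{P^2}{12})y-Pp+\tfrac32q\Big),$$ $$c_1=\frac{\chi^2}{8}J+\frac{\chi}{8\rho}e^{-\frac13\int P\,dx}\Big(3y\xi+\tfrac P3y-p\Big)-\frac{3}{8\rho^3}e^{-\frac13\int P\,dx}y,$$ $$\begin{aligned}c_2&=6z+6\chi J^2+\frac{16}{\rho}Je^{-\frac13\int P\,dx}\Big(3y\xi+\tfrac P3y-p\Big)+e^{-\frac23\int P\,dx}\Big(-4(6\xi+P)p^2\\&\quad+2\big(36\xi^2+8P\xi-\tfrac1{15}Q+\tfrac13P^2\big)yp-\big(72\xi^3+24P\xi^2+\tfrac83P^2\xi+\tfrac19(P^3+\tfrac15PQ+\tfrac25R)\big)y^2\Big),\end{aligned}$$ $$c_3=-\frac\chi2J-\frac1\rho e^{-\frac13\int P\,dx}\Big(3y\xi+\tfrac P3y-p\Big),$$ $$\begin{aligned}X^3&=4\rho^3\chi e^{-\frac13\int P\,dx}\Big(3y\xi^3+3(\tfrac P3y-p)\xi^2-\big((\tfrac Q{60}-\tfrac{P^2}{12})y+Pp\big)\xi-\tfrac1{270}(PQ+R)y-\tfrac1{12}(P^2+\tfrac Q{15})p\Big)\partial_z\\ &\quad-\rho^3\chi e^{\frac13\int P\,dx}\Big(\partial_y+\tfrac13(P+9\xi)\partial_p\Big)\\ &\quad+4\rho e^{-\frac13\int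 P\,dx}\Big(3y\xi^2+2(\tfrac P3y-p)\xi-\tfrac13\big((\tfrac Q{60}-\tfrac{P^2}{12})y+pP-3q\big)\Big)\partial_z+\rho e^{\frac13\int P\,dx}\partial_p.\end{aligned}$$ Definition (pairwise bracket-generating split $\mathfrak g_2$). Given vector fields $S^1,S^2,S^3$, put $S^4=[S^1,S^2]$, $S^5=[S^2,S^3]$, $S^6=[S^3,S^1]$, $L^1=[S^1,S^4]$, $L^2=[S^2,S^4]$, $L^3=[S^2,S^5]$, $L^4=[S^3,S^5]$, $L^5=[S^3,S^6]$, $L^6=[S^1,S^6]$, $H=[S^2,S^6]$, $h=[S^4,S^3]$ (this vector field $H$ is unrelated to the function $H(x)$). One says $\{S^1,S^2,S^3\}$ pairwise bracket-generates the Lie algebra of split $\mathfrak g_2$ if the 14 vector fields $S^1,\dots,S^6$, $h^1=\frac14(h-H)$, $h^2=\frac{\sqrt3}{12}(h+H)$, $L^1,\dots,L^6$ form a basis of a 14-dimensional Lie algebra isomorphic to split $\mathfrak g_2$, with Cartan subalgebra spanned by $h^1,h^2$ and root vectors with the following roots (simultaneous eigenvalues of $(\mathrm{ad}\,h^1,\mathrm{ad}\,h^2)$): $S^1:(1,0)$, $S^5:(-1,0)$, $S^4:(\frac12,\frac{\sqrt3}2)$, $S^3:(-\frac12,-\frac{\sqrt3}2)$, $S^2:(-\frac12,\frac{\sqrt3}2)$, $S^6:(\frac12,-\frac{\sqrt3}2)$, $L^2:(0,\sqrt3)$, $L^5:(0,-\sqrt3)$, $L^1:(\frac32,\frac{\sqrt3}2)$,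 $L^4:(-\frac32,-\frac{\sqrt3}2)$, $L^3:(-\frac32,\frac{\sqrt3}2)$, $L^6:(\frac32,-\frac{\sqrt3}2)$. (For complex-valued data the algebra is taken over $\mathbb C$.) *)

theory Defs
  imports "HOL-Analysis.Analysis" "HOL-Library.Function_Algebras"
begin

section \<open>Differentiation over a scalar embedding\<close>

text \<open>
  Coordinates range over a field \<open>'k\<close> and all coefficients lie in a field \<open>'f\<close>, connected by a
  continuous field embedding \<open>\<iota>\<close>.  As normed fields over the reals are real or complex, this
  covers real data (\<open>\<iota> = id\<close> on the reals), complex-valued data on a real manifold
  (\<open>\<iota> = of_real\<close>), and holomorphic data (\<open>\<iota> = id\<close> on the complex numbers).
\<close>

definition scalar_embedding :: "('k::real_normed_field \<Rightarrow> 'f::real_normed_field) \<Rightarrow> bool" where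
  "scalar_embedding \<iota> \<longleftrightarrow> bounded_linear \<iota> \<and> \<iota> 1 = 1 \<and> (\<forall>a b. \<iota> (a * b) = \<iota> a * \<iota> b)"

text \<open>For \<open>\<iota> = of_real\<close> this is \<^const>\<open>has_vector_derivative\<close>, for \<open>\<iota> = id\<close> it is
  \<^const>\<open>has_field_derivative\<close>.\<close>

definition has_sderiv ::
  "('k::real_normed_field \<Rightarrow> 'f::real_normed_field) \<Rightarrow> ('k \<Rightarrow> 'f) \<Rightarrow> 'f \<Rightarrow> 'k \<Rightarrow> bool" where
  "has_sderiv \<iota> g D x \<longleftrightarrow> (g has_derivative (\<lambda>h. \<iota> h * D)) (at x)"

definition sdiff :: "('k::real_normed_field \<Rightarrow> 'f::real_normed_field) \<Rightarrow> ('k \<Rightarrow> 'f) \<Rightarrow> 'k \<Rightarrow> bool" where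
  "sdiff \<iota> g x \<longleftrightarrow> (\<exists>D. has_sderiv \<iota> g D x)"

definition sderiv :: "('k::real_normed_field \<Rightarrow> 'f::real_normed_field) \<Rightarrow> ('k \<Rightarrow> 'f) \<Rightarrow> 'k \<Rightarrow> 'f" where
  "sderiv \<iota> g x = (THE D. has_sderiv \<iota> g D x)"

section \<open>Vector fields on open sets of the coordinate 5-space\<close>

datatype coord = Xc | Yc | Zc | Pc | Qc

lemma UNIV_coord: "UNIV = {Xc, Yc, Zc, Pc, Qc}"
  by (auto intro: coord.exhaust)

instance coord :: finite
  by standard (simp add: UNIV_coord)

type_synonym 'k point = "'k ^ coord"

type_synonym ('k, 'f) vfield = "'k point \<Rightarrow> 'f ^ coord"

abbreviation coord_vec :: "coord \<Rightarrow> 'f::{zero,one} ^ coord" ("\<partial>") where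
  "\<partial> i \<equiv> axis i 1"

definition pdiff ::
  "('k::real_normed_field \<Rightarrow> 'f::real_normed_field) \<Rightarrow> coord \<Rightarrow> ('k point \<Rightarrow> 'f) \<Rightarrow> 'k point \<Rightarrow> bool" where
  "pdiff \<iota> i g v \<longleftrightarrow> sdiff \<iota> (\<lambda>t. g (v + axis i t)) 0"

definition partial ::
  "('k::real_normed_field \<Rightarrow> 'f::real_normed_field) \<Rightarrow> coord \<Rightarrow> ('k point \<Rightarrow> 'f) \<Rightarrow> 'k point \<Rightarrow> 'f" where
  "partial \<iota> i g v = sderiv \<iota> (\<lambda>t. g (v + axis i t)) 0"

primrec Ck ::
  "('k::real_normed_field \<Rightarrow> 'f::real_normed_field) \<Rightarrow> nat \<Rightarrow> 'k point set \<Rightarrow> ('k point \<Rightarrow> 'f) \<Rightarrow> bool" where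
  "Ck \<iota> 0 U g \<longleftrightarrow> continuous_on U g"
| "Ck \<iota> (Suc n) U g \<longleftrightarrow> (\<forall>i. (\<forall>v\<in>U. pdiff \<iota> i g v) \<and> Ck \<iota> n U (partial \<iota> i g))"

definition smooth_field ::
  "('k::real_normed_field \<Rightarrow> 'f::real_normed_field) \<Rightarrow> 'k point set \<Rightarrow> ('k, 'f) vfield \<Rightarrow> bool" where
  "smooth_field \<iota> U V \<longleftrightarrow> (\<forall>i n. Ck \<iota> n U (\<lambda>v. V v $ i))"

text \<open>Vector fields on \<open>U\<close> are represented by functions that vanish outside \<open>U\<close>, so that
  equality of functions is equality on \<open>U\<close>.\<close>

definition on_dom :: "'k point set \<Rightarrow> ('k, 'f::zero) vfield \<Rightarrow> ('k, 'f) vfield" where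
  "on_dom U V = (\<lambda>v. if v \<in> U then V v else 0)"

definition lie_bracket ::
  "('k::real_normed_field \<Rightarrow> 'f::real_normed_field) \<Rightarrow> 'k point set
     \<Rightarrow> ('k, 'f) vfield \<Rightarrow> ('k, 'f) vfield \<Rightarrow> ('k, 'f) vfield" where
  "lie_bracket \<iota> U V W = on_dom U (\<lambda>v. \<chi> i. \<Sum>j\<in>UNIV.
     V v $ j * partial \<iota> j (\<lambda>w. W w $ i) v - W v $ j * partial \<iota> j (\<lambda>w. V w $ i) v)"

definition vf_scale :: "'f::times \<Rightarrow> ('k, 'f) vfield \<Rightarrow> ('k, 'f) vfield" where
  "vf_scale c V = (\<lambda>v. c *s V v)"

section \<open>Distributions\<close>

type_synonym ('k, 'f) distribution = "'k point \<Rightarrow> ('f ^ coord) set"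

definition spanned_by :: "('k, 'f::field) vfield \<Rightarrow> ('k, 'f) vfield \<Rightarrow> ('k, 'f) distribution" where
  "spanned_by V W = (\<lambda>v. vec.span {V v, W v})"

definition sections ::
  "('k::real_normed_field \<Rightarrow> 'f::real_normed_field) \<Rightarrow> 'k point set
     \<Rightarrow> ('k, 'f) distribution \<Rightarrow> ('k, 'f) vfield set" where
  "sections \<iota> U D = {V. smooth_field \<iota> U V \<and> (\<forall>v\<in>U. V v \<in> D v)}"

definition bracket_dist ::
  "('k::real_normed_field \<Rightarrow> 'f::real_normed_field) \<Rightarrow> 'k point set
     \<Rightarrow> ('k, 'f) distribution \<Rightarrow> ('k, 'f) distribution \<Rightarrow> ('k, 'f) distribution" where
  "bracket_dist \<iota> U D D' = (\<lambda>v. vec.span (D v \<union> D' v \<union>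
     {lie_bracket \<iota> U V W v | V W. V \<in> sections \<iota> U D \<and> W \<in> sections \<iota> U D'}))"

definition distribution_235 ::
  "('k::real_normed_field \<Rightarrow> 'f::real_normed_field) \<Rightarrow> 'k point set
     \<Rightarrow> ('k, 'f) distribution \<Rightarrow> bool" where
  "distribution_235 \<iota> U D \<longleftrightarrow> (\<forall>v\<in>U.
     vec.dim (D v) = 2 \<and>
     vec.dim (bracket_dist \<iota> U D D v) = 3 \<and>
     bracket_dist \<iota> U D (bracket_dist \<iota> U D D) v = UNIV)"

section \<open>Lie algebras with explicit carrier\<close>

definition lie_algebra_on ::
  "('f::field \<Rightarrow> 'v::ab_group_add \<Rightarrow> 'v) \<Rightarrow> ('v \<Rightarrow> 'v \<Rightarrow> 'v) \<Rightarrow> 'v set \<Rightarrow> bool" where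
  "lie_algebra_on sc br L \<longleftrightarrow>
     vector_space sc \<and> module.subspace sc L \<and>
     (\<forall>x\<in>L. \<forall>y\<in>L. br x y \<in> L) \<and>
     (\<forall>x\<in>L. \<forall>y\<in>L. \<forall>z\<in>L. br (x + y) z = br x z + br y z \<and> br z (x + y) = br z x + br z y) \<and>
     (\<forall>c. \<forall>x\<in>L. \<forall>y\<in>L. br (sc c x) y = sc c (br x y) \<and> br x (sc c y) = sc c (br x y)) \<and>
     (\<forall>x\<in>L. br x x = 0) \<and>
     (\<forall>x\<in>L. \<forall>y\<in>L. \<forall>z\<in>L. br x (br y z) + br y (br z x) + br z (br x y) = 0)"

definition lie_isomorphic ::
  "('f::field \<Rightarrow> 'v::ab_group_add \<Rightarrow> 'v) \<Rightarrow> ('v \<Rightarrow> 'v \<Rightarrow> 'v) \<Rightarrow> 'v set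
     \<Rightarrow> ('f \<Rightarrow> 'w::ab_group_add \<Rightarrow> 'w) \<Rightarrow> ('w \<Rightarrow> 'w \<Rightarrow> 'w) \<Rightarrow> 'w set \<Rightarrow> bool" where
  "lie_isomorphic sc br L sc' br' L' \<longleftrightarrow> (\<exists>\<phi>. bij_betw \<phi> L L' \<and>
     (\<forall>x\<in>L. \<forall>y\<in>L. \<phi> (x + y) = \<phi> x + \<phi> y) \<and>
     (\<forall>c. \<forall>x\<in>L. \<phi> (sc c x) = sc' c (\<phi> x)) \<and>
     (\<forall>x\<in>L. \<forall>y\<in>L. \<phi> (br x y) = br' (\<phi> x) (\<phi> y)))"

primrec lower_central ::
  "('f::field \<Rightarrow> 'v::ab_group_add \<Rightarrow> 'v) \<Rightarrow> ('v \<Rightarrow> 'v \<Rightarrow> 'v) \<Rightarrow> 'v set \<Rightarrow> nat \<Rightarrow> 'v set" where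
  "lower_central sc br K 0 = K"
| "lower_central sc br K (Suc n) =
     module.span sc {br x y | x y. x \<in> K \<and> y \<in> lower_central sc br K n}"

definition cartan_subalgebra ::
  "('f::field \<Rightarrow> 'v::ab_group_add \<Rightarrow> 'v) \<Rightarrow> ('v \<Rightarrow> 'v \<Rightarrow> 'v) \<Rightarrow> 'v set \<Rightarrow> 'v set \<Rightarrow> bool" where
  "cartan_subalgebra sc br L K \<longleftrightarrow>
     module.subspace sc K \<and> K \<subseteq> L \<and> (\<forall>x\<in>K. \<forall>y\<in>K. br x y \<in> K) \<and>
     (\<exists>n. lower_central sc br K n = {0}) \<and>
     {x \<in> L. \<forall>y\<in>K. br x y \<in> K} = K"

section \<open>The split Lie algebra of type G2\<close>

text \<open>The split octonions over \<open>'f\<close> as Zorn vector matrices with rows \<open>(a, u)\<close> and \<open>(v, b)\<close>; the split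
  Lie algebra of type G2 is formed by their derivations.\<close>

type_synonym 'f zorn = "'f \<times> ('f ^ 3) \<times> ('f ^ 3) \<times> 'f"

definition dot3 :: "'f::comm_ring_1 ^ 3 \<Rightarrow> 'f ^ 3 \<Rightarrow> 'f" where
  "dot3 u v = (\<Sum>i\<in>UNIV. u $ i * v $ i)"

definition crossp3 :: "'f::comm_ring_1 ^ 3 \<Rightarrow> 'f ^ 3 \<Rightarrow> 'f ^ 3" where
  "crossp3 u v = vector [u $ 2 * v $ 3 - u $ 3 * v $ 2,
                        u $ 3 * v $ 1 - u $ 1 * v $ 3,
                        u $ 1 * v $ 2 - u $ 2 * v $ 1]"

fun zorn_mult :: "'f::comm_ring_1 zorn \<Rightarrow> 'f zorn \<Rightarrow> 'f zorn" where
  "zorn_mult (a, u, v, b) (a', u', v', b') =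
     (a * a' + dot3 u v',
      a *s u' + b' *s u - crossp3 v v',
      a' *s v + b *s v' + crossp3 u u',
      b * b' + dot3 v u')"

fun zorn_scale :: "'f::comm_ring_1 \<Rightarrow> 'f zorn \<Rightarrow> 'f zorn" where
  "zorn_scale c (a, u, v, b) = (c * a, c *s u, c *s v, c * b)"

definition split_g2 :: "('f::comm_ring_1 zorn \<Rightarrow> 'f zorn) set" where
  "split_g2 = {D. (\<forall>x y. D (x + y) = D x + D y) \<and>
                  (\<forall>c x. D (zorn_scale c x) = zorn_scale c (D x)) \<and>
                  (\<forall>x y. D (zorn_mult x y) = zorn_mult (D x) y + zorn_mult x (D y))}"

definition g2_scale :: "'f::comm_ring_1 \<Rightarrow> ('f zorn \<Rightarrow> 'f zorn) \<Rightarrow> 'f zorn \<Rightarrow> 'f zorn" where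
  "g2_scale c D = (\<lambda>x. zorn_scale c (D x))"

definition g2_bracket ::
  "('f::comm_ring_1 zorn \<Rightarrow> 'f zorn) \<Rightarrow> ('f zorn \<Rightarrow> 'f zorn) \<Rightarrow> 'f zorn \<Rightarrow> 'f zorn" where
  "g2_bracket D E = (\<lambda>x. D (E x) - E (D x))"

definition pairwise_bracket_generates_split_g2 ::
  "('k::real_normed_field \<Rightarrow> 'f::real_normed_field) \<Rightarrow> 'k point set
     \<Rightarrow> ('k, 'f) vfield \<Rightarrow> ('k, 'f) vfield \<Rightarrow> ('k, 'f) vfield \<Rightarrow> bool" where
  "pairwise_bracket_generates_split_g2 \<iota> U V1 V2 V3 \<longleftrightarrow>
     smooth_field \<iota> U V1 \<and> smooth_field \<iota> U V2 \<and> smooth_field \<iota> U V3 \<and>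
     (let br = lie_bracket \<iota> U;
          S1 = on_dom U V1; S2 = on_dom U V2; S3 = on_dom U V3;
          S4 = br S1 S2; S5 = br S2 S3; S6 = br S3 S1;
          L1 = br S1 S4; L2 = br S2 S4; L3 = br S2 S5;
          L4 = br S3 S5; L5 = br S3 S6; L6 = br S1 S6;
          H = br S2 S6; h = br S4 S3;
          h1 = vf_scale (1/4) (h - H);
          h2 = vf_scale (of_real (sqrt 3 / 12)) (h + H);
          B = [S1, S2, S3, S4, S5, S6, h1, h2, L1, L2, L3, L4, L5, L6];
          L = module.span vf_scale (set B)
      in distinct B \<and> \<not> module.dependent vf_scale (set B) \<and>
         lie_algebra_on vf_scale br L \<and>
         lie_isomorphic vf_scale br L g2_scale g2_bracket split_g2 \<and>
         cartan_subalgebra vf_scale br L (module.span vf_scale {h1, h2}) \<and>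
         (\<forall>(V, \<alpha>, \<beta>) \<in> set
            [(S1, 1, 0), (S5, -1, 0),
             (S4, 1/2, sqrt 3 / 2), (S3, -1/2, - sqrt 3 / 2),
             (S2, -1/2, sqrt 3 / 2), (S6, 1/2, - sqrt 3 / 2),
             (L2, 0, sqrt 3), (L5, 0, - sqrt 3),
             (L1, 3/2, sqrt 3 / 2), (L4, -3/2, - sqrt 3 / 2),
             (L3, -3/2, sqrt 3 / 2), (L6, 3/2, - sqrt 3 / 2)].
            V \<noteq> 0 \<and> br h1 V = vf_scale (of_real \<alpha>) V \<and> br h2 V = vf_scale (of_real \<beta>) V))"

section \<open>The generalised Chazy equation and the associated vector fields\<close>

definition chazy_solution ::
  "('k::real_normed_field \<Rightarrow> 'f::real_normed_field) \<Rightarrow> 'f \<Rightarrow> 'k set \<Rightarrow> ('k \<Rightarrow> 'f) \<Rightarrow> bool" where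
  "chazy_solution \<iota> k I P \<longleftrightarrow> (\<forall>x\<in>I.
     let P' = sderiv \<iota> P; P'' = sderiv \<iota> P'; P''' = sderiv \<iota> P''
     in sdiff \<iota> P x \<and> sdiff \<iota> P' x \<and> sdiff \<iota> P'' x \<and>
        P''' x - 2 * P x * P'' x + 3 * (P' x)^2 - 4 / (36 - k^2) * (6 * P' x - (P x)^2)^2 = 0)"

text \<open>A coordinate expression in \<open>(x, y, z, p, q)\<close> as a vector field; only the coefficient
  functions of \<open>x\<close> need their argument in \<open>'k\<close>.\<close>

definition vf :: "('k \<Rightarrow> 'f) \<Rightarrow> ('k \<Rightarrow> 'f \<Rightarrow> 'f \<Rightarrow> 'f \<Rightarrow> 'f \<Rightarrow> 'f ^ coord) \<Rightarrow> ('k, 'f) vfield" where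
  "vf \<iota> F = (\<lambda>v. F (v $ Xc) (\<iota> (v $ Yc)) (\<iota> (v $ Zc)) (\<iota> (v $ Pc)) (\<iota> (v $ Qc)))"

text \<open>\<open>A\<close> is the chosen antiderivative of \<open>P\<close>, and \<open>chi\<close> that of \<open>\<rho>\<^sup>-\<^sup>2\<close>.\<close>

context
  fixes \<iota> :: "'k::real_normed_field \<Rightarrow> 'f::{real_normed_field,banach}"
    and P A \<rho> chi :: "'k \<Rightarrow> 'f"
begin

definition Qf :: "'k \<Rightarrow> 'f" where
  "Qf x = (P x)^2 - 6 * sderiv \<iota> P x"

definition Rf :: "'k \<Rightarrow> 'f" where
  "Rf x = P x * Qf x - 3/2 * sderiv \<iota> Qf x"

definition \<xi> :: "'k \<Rightarrow> 'f" where
  "\<xi> x = sderiv \<iota> \<rho> x / \<rho> x"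

definition Jf :: "'k \<Rightarrow> 'f \<Rightarrow> 'f \<Rightarrow> 'f \<Rightarrow> 'f" where
  "Jf x y p q = 2/3 * \<rho> x * exp (- (1/3) * A x) *
     (9 * y * (\<xi> x)^2 + 2 * (P x * y - 3 * p) * \<xi> x
      - (Qf x / 60 - (P x)^2 / 12) * y - P x * p + 3/2 * q)"

definition c1 :: "'k \<Rightarrow> 'f \<Rightarrow> 'f \<Rightarrow> 'f \<Rightarrow> 'f" where
  "c1 x y p q = (chi x)^2 / 8 * Jf x y p q
     + chi x / (8 * \<rho> x) * exp (- (1/3) * A x) * (3 * y * \<xi> x + P x / 3 * y - p)
     - 3 / (8 * (\<rho> x)^3) * exp (- (1/3) * A x) * y"

definition c2 :: "'k \<Rightarrow> 'f \<Rightarrow> 'f \<Rightarrow> 'f \<Rightarrow> 'f \<Rightarrow> 'f" where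
  "c2 x y z p q = 6 * z + 6 * chi x * (Jf x y p q)^2
     + 16 / \<rho> x * Jf x y p q * exp (- (1/3) * A x) * (3 * y * \<xi> x + P x / 3 * y - p)
     + exp (- (2/3) * A x) *
       (- 4 * (6 * \<xi> x + P x) * p^2
        + 2 * (36 * (\<xi> x)^2 + 8 * P x * \<xi> x - 1/15 * Qf x + 1/3 * (P x)^2) * y * p
        - (72 * (\<xi> x)^3 + 24 * P x * (\<xi> x)^2 + 8/3 * (P x)^2 * \<xi> x
           + 1/9 * ((P x)^3 + 1/5 * P x * Qf x + 2/5 * Rf x)) * y^2)"

definition c3 :: "'k \<Rightarrow> 'f \<Rightarrow> 'f \<Rightarrow> 'f \<Rightarrow> 'f" where
  "c3 x y p q = - (chi x / 2) * Jf x y p q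
     - 1 / \<rho> x * exp (- (1/3) * A x) * (3 * y * \<xi> x + P x / 3 * y - p)"

definition X1 :: "'k \<Rightarrow> 'f \<Rightarrow> 'f \<Rightarrow> 'f \<Rightarrow> 'f \<Rightarrow> 'f ^ coord" where
  "X1 x y z p q = \<partial> Qc"

definition X2 :: "'k \<Rightarrow> 'f \<Rightarrow> 'f \<Rightarrow> 'f \<Rightarrow> 'f \<Rightarrow> 'f ^ coord" where
  "X2 x y z p q = \<partial> Xc + p *s \<partial> Yc + q *s \<partial> Pc + (q^2 * exp (- (2/3) * A x)) *s \<partial> Zc"

definition X3 :: "'k \<Rightarrow> 'f \<Rightarrow> 'f \<Rightarrow> 'f \<Rightarrow> 'f \<Rightarrow> 'f ^ coord" where
  "X3 x y z p q =
     (4 * (\<rho> x)^3 * chi x * exp (- (1/3) * A x) *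
       (3 * y * (\<xi> x)^3 + 3 * (P x / 3 * y - p) * (\<xi> x)^2
        - ((Qf x / 60 - (P x)^2 / 12) * y + P x * p) * \<xi> x
        - 1/270 * (P x * Qf x + Rf x) * y - 1/12 * ((P x)^2 + Qf x / 15) * p)) *s \<partial> Zc
     - ((\<rho> x)^3 * chi x * exp (1/3 * A x)) *s (\<partial> Yc + (1/3 * (P x + 9 * \<xi> x)) *s \<partial> Pc)
     + (4 * \<rho> x * exp (- (1/3) * A x) *
       (3 * y * (\<xi> x)^2 + 2 * (P x / 3 * y - p) * \<xi> x
        - 1/3 * ((Qf x / 60 - (P x)^2 / 12) * y + p * P x - 3 * q))) *s \<partial> Zc
     + (\<rho> x * exp (1/3 * A x)) *s \<partial> Pc"

definition S1 :: "'k \<Rightarrow> 'f \<Rightarrow> 'f \<Rightarrow> 'f \<Rightarrow> 'f \<Rightarrow> 'f ^ coord" where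
  "S1 x y z p q =
     (- ((\<rho> x)^2) *
       (48 * y * (\<xi> x)^3 + 48 * (P x / 3 * y - p) * (\<xi> x)^2
        - 16 * ((Qf x - 5 * (P x)^2) / 60 * y + p * P x - 3/2 * q) * \<xi> x
        - 4/3 * (2/45 * (P x * Qf x + Rf x) * y + ((P x)^2 + Qf x / 15) * p - 6 * P x * q)))
       *s X1 x y z p q
     - (8 * (\<rho> x)^2) *s X2 x y z p q"

definition S2 :: "'k \<Rightarrow> 'f \<Rightarrow> 'f \<Rightarrow> 'f \<Rightarrow> 'f \<Rightarrow> 'f ^ coord" where
  "S2 x y z p q = (exp (1/3 * A x) / (4 * \<rho> x)) *s X1 x y z p q"

definition l3 :: "'k \<Rightarrow> 'f \<Rightarrow> 'f \<Rightarrow> 'f \<Rightarrow> 'f \<Rightarrow> 'f" where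
  "l3 x y z p q =
     \<rho> x * exp (1/3 * A x) / 6 *
       ((36 * (\<xi> x)^2 + 12 * P x * \<xi> x + (P x)^2 + Qf x / 15) * (\<rho> x)^2 * chi x
        - 4 * P x - 24 * \<xi> x) * (c3 x y p q)^2
     + exp (1/3 * A x) / (4 * \<rho> x) * c2 x y z p q
     + (\<rho> x)^2 *
       (48 * (\<xi> x)^3 * y + 48 * (P x / 3 * y - p) * (\<xi> x)^2
        - 16 * ((Qf x - 5 * (P x)^2) / 60 * y + p * P x - 3/2 * q) * \<xi> x
        - 4/3 * (2/45 * (P x * Qf x + Rf x) * y + ((P x)^2 + Qf x / 15) * p - 6 * P x * q))
       * c1 x y p q"

definition S3 :: "'k \<Rightarrow> 'f \<Rightarrow> 'f \<Rightarrow> 'f \<Rightarrow> 'f \<Rightarrow> 'f ^ coord" where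
  "S3 x y z p q =
     l3 x y z p q *s X1 x y z p q
     + (2 * exp (- (1/3) * A x) / (3 * \<rho> x) *
       ((\<rho> x)^4 * (chi x)^2 *
          (9 * y * (\<xi> x)^2 + 2 * (P x * y - 3 * p) * \<xi> x
           - (Qf x / 60 - (P x)^2 / 12) * y - P x * p + 3/2 * q)
        + 3/2 * (\<rho> x)^2 * chi x * (3 * y * \<xi> x + P x / 3 * y - p)
        - 9/2 * y)) *s X2 x y z p q
     - (exp (- (2/3) * A x) / (9 * (\<rho> x)^2) *
       ((\<rho> x)^2 * chi x *
          (9 * y * (\<xi> x)^2 + 2 * (P x * y - 3 * p) * \<xi> x
           - (Qf x / 60 - (P x)^2 / 12) * y - P x * p + 3/2 * q)
        + 9 * y * \<xi> x + P x * y - 3 * p)^2) *s X3 x y z p q"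

text \<open>The common kernel of \<open>dy - p dx\<close>, \<open>dp - q dx\<close> and \<open>dz - (q\<^sup>2 / H'') dx\<close>, where
  \<open>H'' = exp (2/3 * A)\<close>; the components of a tangent vector \<open>u\<close> are its values under \<open>dx, \<dots>, dq\<close>.\<close>

definition annihilator :: "('k, 'f) distribution" where
  "annihilator = (\<lambda>v. {u.
     u $ Yc - \<iota> (v $ Pc) * u $ Xc = 0 \<and>
     u $ Pc - \<iota> (v $ Qc) * u $ Xc = 0 \<and>
     u $ Zc - (\<iota> (v $ Qc))^2 / exp (2/3 * A (v $ Xc)) * u $ Xc = 0})"

end

end

theory Submission
  imports Defs
begin

text \<open>
  The functions \<open>a = \<chi>\<close>, \<open>b = J\<close>, \<open>c\<close>, \<open>d\<close>, \<open>f\<close> (\<open>fa\<close>, \<dots>, \<open>ff\<close> below) flatten the distribution: \<open>S\<^sup>1\<close> and \<open>S\<^sup>2\<close>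
  become polynomial vector fields in them, and \<open>S\<^sup>3 = - c\<^sub>1 S\<^sup>1 + c\<^sub>2 S\<^sup>2 - c\<^sub>3\<^sup>2 Y\<close> with \<open>Y\<close> polynomial as well.
  In these coordinates \<open>U\<close> is locally the quadric of null lines in the imaginary split
  octonions.  A suitable trace-free null octonion \<open>W = (c\<^sub>3, (1, w\<^sub>4, - w\<^sub>5), (- w\<^sub>6, 4b, a/8), - c\<^sub>3)\<close> is a
  chart in which the \<open>S\<^sup>i\<close> act as the projective action of three explicit derivations of the
  octonions.  The projective action respects brackets, so every derivation is realized by a unique
  vector field on \<open>U\<close>, and the kernel of this representation is an ideal that does not contain
  the derivation of \<open>S\<^sup>1\<close>, hence is zero.  All claims about the vector fields thus become
  computations with derivations.
\<close>

section \<open>Derivations of the split octonions\<close>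

text \<open>The obstacle is size: the coefficients of \<open>S3\<close> nest \<open>c1\<close>,
  \<open>c2\<close> and \<open>c3\<close>, and the claims concern all brackets of fourteen fields
  built from it, so expanding brackets of vector fields is out of reach. Derivatives are computed
  for the three generators only; brackets, independence and eigenvalues are then taken among
  derivations. Which derivations to expect is dictated by the roots. Those of \<open>S1\<close>,
  \<open>S2\<close>, \<open>S3\<close> are three short roots at mutual angle 120 degrees, that is,
  the weights of the standard module V in the decomposition sl3 + V + V* of split G2. Hence the
  generators must correspond to the coordinate vectors of V, their pairwise brackets to V*, and the
  six long roots to matrix units. The null quadric is the homogeneous model of a flat
  (2,3,5)-distribution, which is why the symmetries can be sought as projective actions on it.
  Injectivity costs one nonvanishing component of \<open>S1\<close> instead of a rank computation
  with fourteen fields.\<close>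

definition g2_der ::
  "'f::comm_ring_1 ^ 3 ^ 3 \<Rightarrow> 'f ^ 3 \<Rightarrow> 'f ^ 3 \<Rightarrow> 'f zorn \<Rightarrow> 'f zorn" where
  "g2_der A k m = (\<lambda>(a, u, v, b).
     (- dot3 k v - dot3 m u,
      A *v u + (a - b) *s k + crossp3 m v,
      - (transpose A *v v) + (a - b) *s m + crossp3 k u,
      dot3 k v + dot3 m u))"

text \<open>In \<open>g2_der A k m\<close> a trace-free \<open>A\<close> lies in sl3, and
  \<open>k\<close>, \<open>m\<close> lie in V and V*: the idempotent \<open>(1, 0, 0, 0)\<close> is
  sent to \<open>(0, k, m, 0)\<close>. \<open>\<Lambda>\<close> is the invariant pairing of V and V*
  into sl3, namely -3 times the trace-free part of the rank one matrix with entries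
  \<open>k $ i * m $ j\<close>.\<close>

definition \<Lambda> :: "'f::comm_ring_1 ^ 3 \<Rightarrow> 'f ^ 3 \<Rightarrow> 'f ^ 3 ^ 3" where
  "\<Lambda> k m = (\<chi> i j. - 3 * k $ i * m $ j + (if i = j then dot3 k m else 0))"

abbreviation trace0 :: "'f::comm_ring_1 ^ 3 ^ 3 \<Rightarrow> bool" where
  "trace0 A \<equiv> A $ 1 $ 1 + A $ 2 $ 2 + A $ 3 $ 3 = 0"

lemmas vec3_simps = vec_eq_iff forall_3 dot3_def crossp3_def sum_3 matrix_vector_mult_def
  matrix_matrix_mult_def transpose_def \<Lambda>_def

lemma three_neq [simp]: "(1::3) \<noteq> 2" "(1::3) \<noteq> 3" "(2::3) \<noteq> 1" "(2::3) \<noteq> 3" "(3::3) \<noteq> 1" "(3::3) \<noteq> 2"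
  by simp_all

lemma dot3_0 [simp]: "dot3 0 v = 0" "dot3 u 0 = 0"
  by (simp_all add: dot3_def)

lemma dot3_commute: "dot3 u v = dot3 v u"
  by (simp add: dot3_def mult.commute)

lemma crossp3_skew: "crossp3 u v = - crossp3 v u"
  by (simp add: crossp3_def vec_eq_iff forall_3)

lemma crossp3_0 [simp]: "crossp3 0 v = 0" "crossp3 u 0 = 0"
  by (simp_all add: crossp3_def vec_eq_iff forall_3)

text \<open>Trace zero makes \<open>A\<close> on one block and minus its transpose on the other
  compatible with cross products: \<open>crossp3 (A *v u) u' + crossp3 u (A *v u')\<close> is the
  trace of \<open>A\<close> times \<open>crossp3 u u'\<close> minus
  \<open>transpose A *v crossp3 u u'\<close>.\<close>

lemma g2_der_in_split_g2:
  fixes A :: "'f::comm_ring_1 ^ 3 ^ 3"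
  assumes "trace0 A"
  shows "g2_der A k m \<in> split_g2"
proof -
  have A33: "A $ 3 $ 3 = - A $ 1 $ 1 - A $ 2 $ 2"
    using assms by (simp add: eq_neg_iff_add_eq_0 algebra_simps)
  show ?thesis
    unfolding split_g2_def mem_Collect_eq
  proof (intro conjI allI)
    fix x y :: "'f zorn" and c :: 'f
    show "g2_der A k m (x + y) = g2_der A k m x + g2_der A k m y"
      by (cases x; cases y) (simp add: g2_der_def vec3_simps algebra_simps)
    show "g2_der A k m (zorn_scale c x) = zorn_scale c (g2_der A k m x)"
      by (cases x) (simp add: g2_der_def vec3_simps algebra_simps)
    show "g2_der A k m (zorn_mult x y) = zorn_mult (g2_der A k m x) y + zorn_mult x (g2_der A k m y)"
      by (cases x; cases y) (simp add: g2_der_def vec3_simps A33 algebra_simps)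
  qed
qed

lemma g2_bracket_der:
  fixes A :: "'f::comm_ring_1 ^ 3 ^ 3"
  assumes "trace0 A" "trace0 A'"
  shows "g2_bracket (g2_der A k m) (g2_der A' k' m') =
    g2_der (A ** A' - A' ** A + \<Lambda> k m' - \<Lambda> k' m)
      (A *v k' - A' *v k + 2 *s crossp3 m m')
      (transpose A' *v m - transpose A *v m' + 2 *s crossp3 k k')"
proof
  fix x :: "'f zorn"
  have A33: "A $ 3 $ 3 = - A $ 1 $ 1 - A $ 2 $ 2" "A' $ 3 $ 3 = - A' $ 1 $ 1 - A' $ 2 $ 2"
    using assms by (simp_all add: eq_neg_iff_add_eq_0 algebra_simps)
  show "g2_bracket (g2_der A k m) (g2_der A' k' m') x =
    g2_der (A ** A' - A' ** A + \<Lambda> k m' - \<Lambda> k' m)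
      (A *v k' - A' *v k + 2 *s crossp3 m m')
      (transpose A' *v m - transpose A *v m' + 2 *s crossp3 k k') x"
    by (cases x) (simp add: g2_bracket_def g2_der_def vec3_simps A33 algebra_simps)
qed

lemma g2_der_add: "g2_der A k m + g2_der A' k' m' = g2_der (A + A') (k + k') (m + m')"
  by (rule ext) (simp add: plus_fun_def g2_der_def vec3_simps algebra_simps split: prod.splits)

lemma g2_scale_der: "g2_scale c (g2_der A k m) = g2_der (\<chi> i j. c * A $ i $ j) (c *s k) (c *s m)"
  by (rule ext) (simp add: g2_scale_def g2_der_def vec3_simps algebra_simps split: prod.splits)

lemma g2_der_zero: "g2_der 0 0 0 = 0"
  by (rule ext) (simp add: g2_der_def vec3_simps zero_fun_def zero_prod_def split: prod.splits)

lemma g2_der_eq_iff: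
  fixes A :: "'f::field_char_0 ^ 3 ^ 3"
  shows "g2_der A k m = g2_der A' k' m' \<longleftrightarrow> A = A' \<and> k = k' \<and> m = m'"
proof
  assume eq: "g2_der A k m = g2_der A' k' m'"
  have 1: "k = k'" "m = m'"
    using fun_cong[OF eq, of "(1, 0, 0, 0)"] by (simp_all add: g2_der_def vec3_simps)
  have "A *v u = A' *v u" for u
    using fun_cong[OF eq, of "(0, u, 0, 0)"] by (simp add: g2_der_def)
  then have "A = A'"
    by (simp add: matrix_eq)
  then show "A = A' \<and> k = k' \<and> m = m'" using 1 by simp
qed simp

text \<open>Peirce argument with the idempotents \<open>e\<close> and \<open>e'\<close>:
  \<open>D e\<close> determines \<open>k\<close> and \<open>m\<close>; multiplication by
  \<open>e\<close> then fixes the images of both off-diagonal blocks up to one linear map on each;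
  products between and within the blocks make these two maps dual up to sign and trace-free.\<close>

lemma split_g2_eq:
  "split_g2 = {g2_der A k m | (A :: 'f::field_char_0 ^ 3 ^ 3) k m. trace0 A}"
proof (intro equalityI subsetI)
  fix D :: "'f zorn \<Rightarrow> 'f zorn"
  assume "D \<in> split_g2"
  then have add: "\<And>x y. D (x + y) = D x + D y"
    and scale: "\<And>c x. D (zorn_scale c x) = zorn_scale c (D x)"
    and leib: "\<And>x y. D (zorn_mult x y) = zorn_mult (D x) y + zorn_mult x (D y)"
    by (auto simp: split_g2_def)
  have D0: "D 0 = 0" using add[of 0 0] by simp
  define e :: "'f zorn" where "e = (1, 0, 0, 0)"
  define e' :: "'f zorn" where "e' = (0, 0, 0, 1)"
  obtain a0 k m b0 where De: "D e = (a0, k, m, b0)" by (metis prod_cases4)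
  have "zorn_mult e e = e" by (simp add: e_def)
  with leib[of e e] De have ab: "a0 = 0" "b0 = 0"
    by (auto simp: e_def)
  obtain a1 k1 m1 b1 where De': "D e' = (a1, k1, m1, b1)" by (metis prod_cases4)
  have "zorn_mult e' e' = e'" by (simp add: e'_def)
  with leib[of e' e'] De' have ab1: "a1 = 0" "b1 = 0"
    by (auto simp: e'_def)
  have "zorn_mult e e' = 0" by (simp add: e_def e'_def zero_prod_def)
  with leib[of e e'] De De' D0 ab ab1 have "k1 = - k"
    by (auto simp: e_def e'_def zero_prod_def eq_neg_iff_add_eq_0 add.commute)
  moreover have "zorn_mult e' e = 0" by (simp add: e_def e'_def zero_prod_def)
  with leib[of e' e] De De' D0 ab ab1 have "m1 = - m"
    by (auto simp: e_def e'_def zero_prod_def eq_neg_iff_add_eq_0 add.commute)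
  ultimately have De': "D e' = (0, - k, - m, 0)" using De' ab1 by simp
  note De' = this and De = De[unfolded ab]
  define f where "f u = fst (snd (D (0, u, 0, 0)))" for u
  define g where "g v = fst (snd (snd (D (0, 0, v, 0))))" for v
  have Du: "D (0, u, 0, 0) = (- dot3 m u, f u, crossp3 k u, dot3 m u)" for u
  proof -
    obtain a u' v' b where Du: "D (0, u, 0, 0) = (a, u', v', b)" by (metis prod_cases4)
    have "zorn_mult e (0, u, 0, 0) = (0, u, 0, 0)" by (simp add: e_def)
    with leib[of e "(0, u, 0, 0)"] De Du have 1: "b = dot3 m u" "v' = crossp3 k u"
      by (auto simp: e_def)
    have "zorn_mult (0, u, 0, 0) e = 0" by (simp add: e_def zero_prod_def)
    with leib[of "(0, u, 0, 0)" e] De Du D0 have "a = - dot3 m u"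
      by (auto simp: e_def zero_prod_def eq_neg_iff_add_eq_0 algebra_simps dot3_commute)
    with 1 Du show ?thesis by (simp add: f_def)
  qed
  have Dv: "D (0, 0, v, 0) = (- dot3 k v, crossp3 m v, g v, dot3 k v)" for v
  proof -
    obtain a u' v' b where Dv: "D (0, 0, v, 0) = (a, u', v', b)" by (metis prod_cases4)
    have "zorn_mult (0, 0, v, 0) e = (0, 0, v, 0)" by (simp add: e_def)
    with leib[of "(0, 0, v, 0)" e] De Dv have 1: "b = dot3 k v" "u' = crossp3 m v"
      using crossp3_skew[of m v] by (auto simp: e_def dot3_commute)
    have "zorn_mult e (0, 0, v, 0) = 0" by (simp add: e_def zero_prod_def)
    with leib[of e "(0, 0, v, 0)"] De Dv D0 have "a = - dot3 k v"
      by (auto simp: e_def zero_prod_def eq_neg_iff_add_eq_0 algebra_simps dot3_commute)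
    with 1 Dv show ?thesis by (simp add: g_def)
  qed
  define A where "A = (\<chi> i j. f (axis j 1) $ i)"
  have f_add: "f (u + u') = f u + f u'" for u u'
    using add[of "(0, u, 0, 0)" "(0, u', 0, 0)"] by (simp add: Du)
  have f_scale: "f (c *s u) = c *s f u" for c u
    using scale[of c "(0, u, 0, 0)"] by (simp add: Du)
  have fA: "f u = A *v u" for u
  proof -
    have "u = u $ 1 *s axis 1 1 + u $ 2 *s axis 2 1 + u $ 3 *s axis 3 1"
      by (simp add: vec_eq_iff forall_3 axis_def)
    then have "f u = f (u $ 1 *s axis 1 1 + u $ 2 *s axis 2 1 + u $ 3 *s axis 3 1)" by simp
    also have "\<dots> = A *v u"
      by (simp add: f_add f_scale A_def vec3_simps algebra_simps)
    finally show ?thesis .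
  qed
  have fg: "dot3 (f u) v + dot3 u (g v) = 0" for u v
  proof -
    have "zorn_mult (0, u, 0, 0) (0, 0, v, 0) = zorn_scale (dot3 u v) e"
      by (simp add: e_def vec3_simps)
    with leib[of "(0, u, 0, 0)" "(0, 0, v, 0)"] scale[of "dot3 u v" e]
    have "zorn_scale (dot3 u v) (D e) =
        zorn_mult (D (0, u, 0, 0)) (0, 0, v, 0) + zorn_mult (0, u, 0, 0) (D (0, 0, v, 0))"
      by simp
    then show ?thesis by (simp add: De Du Dv vec3_simps)
  qed
  have gA: "g v = - (transpose A *v v)" for v
    using fg[of "axis 1 1" v] fg[of "axis 2 1" v] fg[of "axis 3 1" v]
    by (simp add: fA vec3_simps axis_def eq_neg_iff_add_eq_0 algebra_simps)
  have tr: "trace0 A"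
  proof -
    \<comment> \<open>Two axes of the first block multiply to the third axis of the second block, on
      which \<open>D\<close> acts by minus the transpose; the last entry of the Leibniz rule is the
      trace condition.\<close>
    have "zorn_mult (0, axis 1 1, 0, 0) (0, axis 2 1, 0, 0) = (0 :: 'f, 0, axis 3 1, 0)"
      by (simp add: vec3_simps axis_def)
    with leib[of "(0, axis 1 1, 0, 0)" "(0, axis 2 1, 0, 0)"]
    have "D (0, 0, axis 3 1, 0) =
      zorn_mult (D (0, axis 1 1, 0, 0)) (0, axis 2 1, 0, 0) +
      zorn_mult (0, axis 1 1, 0, 0) (D (0, axis 2 1, 0, 0))" by simp
    then show ?thesis
      by (simp add: Du Dv fA gA vec3_simps axis_def algebra_simps neg_eq_iff_add_eq_0)
  qed
  have "D (a, u, v, b) = g2_der A k m (a, u, v, b)" for a u v b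
  proof -
    have "(a, u, v, b) = zorn_scale a e + (0, u, 0, 0) + (0, 0, v, 0) + zorn_scale b e'"
      by (simp add: e_def e'_def vec_eq_iff)
    then have "D (a, u, v, b) = zorn_scale a (D e) + D (0, u, 0, 0) + D (0, 0, v, 0) + zorn_scale b (D e')"
      by (simp add: add scale)
    then show ?thesis
      by (simp add: De De' Du Dv fA gA g2_der_def vec3_simps algebra_simps)
  qed
  then have "D = g2_der A k m" by (auto intro!: ext)
  with tr show "D \<in> {g2_der A k m | A k m. trace0 A}" by blast
qed (use g2_der_in_split_g2 in blast)

definition munit3 :: "3 \<Rightarrow> 3 \<Rightarrow> 'f::comm_ring_1 ^ 3 ^ 3" where
  "munit3 i j = (\<chi> r c. if r = i \<and> c = j then 1 else 0)"

lemma trace0_0: "trace0 0"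
  by simp

lemma trace0_munit3: "i \<noteq> j \<Longrightarrow> trace0 (munit3 i j)"
  by (auto simp: munit3_def)

lemma split_g2_cases:
  fixes D :: "'f::field_char_0 zorn \<Rightarrow> 'f zorn"
  assumes "D \<in> split_g2"
  obtains A k m where "D = g2_der A k m" "trace0 A"
  using assms unfolding split_g2_eq by blast

lemma split_g2_zero: "0 \<in> (split_g2 :: ('f::field_char_0 zorn \<Rightarrow> 'f zorn) set)"
  using g2_der_in_split_g2[of 0 0 0] by (simp add: g2_der_zero)

lemma split_g2_add:
  fixes D E :: "'f::field_char_0 zorn \<Rightarrow> 'f zorn"
  assumes "D \<in> split_g2" "E \<in> split_g2"
  shows "D + E \<in> split_g2"
proof -
  obtain A k m A' k' m' where D: "D = g2_der A k m" "trace0 A" and E: "E = g2_der A' k' m'" "trace0 A'"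
    using assms by (elim split_g2_cases)
  have "trace0 (A + A')"
    using arg_cong2[OF D(2) E(2), of "(+)"] by (simp add: algebra_simps)
  then show ?thesis
    unfolding D(1) E(1) g2_der_add by (rule g2_der_in_split_g2)
qed

lemma split_g2_scale:
  fixes D :: "'f::field_char_0 zorn \<Rightarrow> 'f zorn"
  assumes "D \<in> split_g2"
  shows "g2_scale c D \<in> split_g2"
proof -
  obtain A k m where D: "D = g2_der A k m" "trace0 A"
    using assms by (elim split_g2_cases)
  have "trace0 (\<chi> i j. c * A $ i $ j)"
    using D(2) by (simp flip: distrib_left)
  then show ?thesis
    unfolding D(1) g2_scale_der by (rule g2_der_in_split_g2)
qed

lemma split_g2_bracket:
  fixes D E :: "'f::field_char_0 zorn \<Rightarrow> 'f zorn"
  assumes "D \<in> split_g2" "E \<in> split_g2"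
  shows "g2_bracket D E \<in> split_g2"
proof -
  obtain A k m A' k' m' where D: "D = g2_der A k m" "trace0 A" and E: "E = g2_der A' k' m'" "trace0 A'"
    using assms by (elim split_g2_cases)
  show ?thesis
    unfolding D(1) E(1) g2_bracket_der[OF D(2) E(2)]
    by (rule g2_der_in_split_g2) (simp add: vec3_simps algebra_simps)
qed

section \<open>Simplicity of split G2, as triviality of ideals\<close>

locale g2_ideal =
  fixes K :: "('f::field_char_0 zorn \<Rightarrow> 'f zorn) set"
  assumes sub: "K \<subseteq> split_g2"
    and scale: "D \<in> K \<Longrightarrow> g2_scale c D \<in> K"
    and ideal: "D \<in> split_g2 \<Longrightarrow> E \<in> K \<Longrightarrow> g2_bracket D E \<in> K"
begin

lemma munit_bracket:
  fixes A :: "'f ^ 3 ^ 3"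
  assumes "trace0 A" "i \<noteq> j"
  shows "g2_bracket (g2_der (munit3 i j) 0 0) (g2_der A k m) =
    g2_der (munit3 i j ** A - A ** munit3 i j) (k $ j *s axis i 1) (- (m $ i *s axis j 1))"
  unfolding g2_bracket_der[OF trace0_munit3[OF assms(2)] assms(1)] g2_der_eq_iff
  using exhaust_3[of i] exhaust_3[of j] assms(2)
  by (elim disjE) (simp_all add: munit3_def vec3_simps axis_def)

text \<open>Off-diagonal matrix units are long root vectors, so the square of their adjoint action kills
  everything but the opposite root space.\<close>

lemma munit_bracket_twice:
  fixes A :: "'f ^ 3 ^ 3"
  assumes "trace0 A" "i \<noteq> j"
  shows "g2_bracket (g2_der (munit3 i j) 0 0) (g2_bracket (g2_der (munit3 i j) 0 0) (g2_der A k m)) =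
    g2_scale (- 2 * A $ j $ i) (g2_der (munit3 i j) 0 0)"
proof -
  have "trace0 (munit3 i j ** A - A ** munit3 i j)"
    using exhaust_3[of i] exhaust_3[of j] assms(2)
    by (elim disjE) (simp_all add: munit3_def vec3_simps)
  from munit_bracket[OF this assms(2)] show ?thesis
    unfolding munit_bracket[OF assms] g2_scale_der g2_der_eq_iff
    using exhaust_3[of i] exhaust_3[of j] assms(2)
    by (elim disjE) (simp_all add: munit3_def vec3_simps axis_def g2_der_eq_iff)
qed

lemma scale_cancel: "g2_scale c D \<in> K \<Longrightarrow> c \<noteq> 0 \<Longrightarrow> D \<in> K"
proof -
  assume "g2_scale c D \<in> K" "c \<noteq> 0"
  moreover have "g2_scale (1 / c) (g2_scale c D) x = D x" if "c \<noteq> 0" for x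
    using that by (cases "D x") (simp add: g2_scale_def vec_eq_iff)
  ultimately show "D \<in> K"
    using scale[of "g2_scale c D" "1 / c"] by (metis ext)
qed

lemma g2_der_in_munit:
  assumes "g2_der A k m \<in> K" "i \<noteq> j"
  shows "g2_bracket (g2_der (munit3 i j) 0 0) (g2_der A k m) \<in> K"
  using assms ideal g2_der_in_split_g2 trace0_munit3 by blast

text \<open>The bracket with matrix units moves any nonzero \<open>k\<close> to any coordinate axis.\<close>

lemma k_zero:
  assumes i0: "g2_der 0 (axis i0 1) 0 \<notin> K" and k: "g2_der 0 k 0 \<in> K"
  shows "k = 0"
proof (rule ccontr)
  assume "k \<noteq> 0"
  then obtain j where j: "k $ j \<noteq> 0" by (auto simp: vec_eq_iff)
  have move: "g2_der 0 (axis i 1) 0 \<in> K" if "g2_der 0 k 0 \<in> K" "k $ j \<noteq> 0" "i \<noteq> j" for k i j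
  proof (rule scale_cancel)
    have "g2_bracket (g2_der (munit3 i j) 0 0) (g2_der 0 k 0) =
        g2_scale (k $ j) (g2_der 0 (axis i 1) 0)"
      unfolding munit_bracket[OF trace0_0 that(3)] g2_scale_der g2_der_eq_iff
      by (simp add: vec3_simps)
    then show "g2_scale (k $ j) (g2_der 0 (axis i 1) 0) \<in> K"
      using g2_der_in_munit[OF that(1,3)] by simp
  qed (rule that(2))
  show False
  proof (cases "i0 = j")
    case False
    then show False using move k j i0 by blast
  next
    case True
    \<comment> \<open>A matrix unit moves a vector only to a different axis, so the axis
      \<open>j\<close> itself is reached by a detour over another index \<open>i\<close>.\<close>
    obtain i where "i \<noteq> j" using three_neq by metis
    with move[OF k j] move[of "axis i 1" i i0] True i0 show False by auto
  qed
qed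

text \<open>Every part of \<open>D\<close> is bracketed into a position already excluded. An
  off-diagonal entry would put a long root vector into \<open>K\<close>, and from there a vector of
  V, against \<open>k_zero\<close>. Differences of diagonal entries turn up off the diagonal after a
  bracket with a matrix unit, and \<open>k\<close>, \<open>m\<close> do so after a bracket with a
  short root vector.\<close>

lemma trivial:
  assumes i0: "g2_der 0 (axis i0 1) 0 \<notin> K" and D: "D \<in> K"
  shows "D = 0"
proof -
  have off: "A $ j $ i = 0" if AK: "g2_der A k m \<in> K" and tr: "trace0 A" and ij: "i \<noteq> j" for A k m i j
  proof (rule ccontr)
    assume nz: "A $ j $ i \<noteq> 0"
    have "g2_scale (- 2 * A $ j $ i) (g2_der (munit3 i j) 0 0) \<in> K"
      unfolding munit_bracket_twice[OF tr ij, of k m, symmetric]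
      using AK g2_der_in_munit[OF _ ij] ideal g2_der_in_split_g2 trace0_munit3[OF ij] by blast
    then have "g2_der (munit3 i j) 0 0 \<in> K" using nz scale_cancel by simp
    then have "g2_bracket (g2_der 0 (axis j 1) 0) (g2_der (munit3 i j) 0 0) \<in> K"
      by (intro ideal g2_der_in_split_g2) simp_all
    moreover have "g2_bracket (g2_der 0 (axis j (1 :: 'f)) 0) (g2_der (munit3 i j) 0 0) =
        g2_der 0 (- axis i 1) 0"
      unfolding g2_bracket_der[OF trace0_0 trace0_munit3[OF ij]] g2_der_eq_iff
      using exhaust_3[of i] exhaust_3[of j] ij
      by (elim disjE) (simp_all add: munit3_def vec3_simps axis_def)
    ultimately show False using k_zero[OF i0] by (metis axis_eq_0_iff neg_equal_0_iff_equal one_neq_zero)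
  qed
  have A0: "A = 0" if AK: "g2_der A k m \<in> K" and tr: "trace0 A" for A k m
  proof -
    have diag: "A $ j $ j = A $ i $ i" if ij: "i \<noteq> j" for i j
    proof -
      \<comment> \<open>The entry \<open>(i, j)\<close> of this commutator is
        \<open>A $ j $ j - A $ i $ i\<close>.\<close>
      have "trace0 (munit3 i j ** A - A ** munit3 i j)"
        using exhaust_3[of i] exhaust_3[of j] ij
        by (elim disjE) (simp_all add: munit3_def vec3_simps)
      from off[OF g2_der_in_munit[OF AK ij, unfolded munit_bracket[OF tr ij]] this, of j i] ij
      show ?thesis
        using exhaust_3[of i] exhaust_3[of j]
        by (elim disjE) (simp_all add: munit3_def vec3_simps)
    qed
    have "3 * A $ 1 $ 1 = 0" using tr diag[of 1 2] diag[of 1 3] by simp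
    then have "A $ i $ i = 0" for i
      using diag[of i 1] by (cases "i = 1") auto
    then show ?thesis using off[OF AK tr] by (metis vec_eq_iff zero_index)
  qed
  obtain A k m where Dd: "D = g2_der A k m" and tr: "trace0 A"
    using D sub split_g2_cases by blast
  have A: "A = 0" using A0 D Dd tr by simp
  have km: "k = 0 \<and> m = 0"
  proof -
    have "k $ i = 0" for i
    proof -
      obtain j where j: "j \<noteq> i" using three_neq by metis
      \<comment> \<open>The matrix part of this bracket has \<open>3 * k $ i\<close> at position
        \<open>(i, j)\<close>.\<close>
      have "g2_bracket (g2_der 0 0 (axis j 1)) (g2_der 0 k m) \<in> K"
        using D Dd A ideal g2_der_in_split_g2[OF trace0_0] by blast
      from A0[OF this[unfolded g2_bracket_der[OF trace0_0 trace0_0]]] show ?thesis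
        using exhaust_3[of i] exhaust_3[of j] j
        by (elim disjE) (simp_all add: vec3_simps axis_def)
    qed
    moreover have "m $ i = 0" for i
    proof -
      obtain j where j: "j \<noteq> i" using three_neq by metis
      have "g2_bracket (g2_der 0 (axis j 1) 0) (g2_der 0 k m) \<in> K"
        using D Dd A ideal g2_der_in_split_g2[OF trace0_0] by blast
      from A0[OF this[unfolded g2_bracket_der[OF trace0_0 trace0_0]]] show ?thesis
        using exhaust_3[of i] exhaust_3[of j] j
        by (elim disjE) (simp_all add: vec3_simps axis_def)
    qed
    ultimately show ?thesis by (simp add: vec_eq_iff)
  qed
  show ?thesis using Dd A km g2_der_zero by simp
qed

end

section \<open>Root vectors: short ones \<open>g2_k\<close> and \<open>g2_m\<close>, long ones
  \<open>g2_unit\<close>, and the Cartan part \<open>g2_diag\<close>\<close>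

definition g2_diag :: "'f \<Rightarrow> 'f \<Rightarrow> 'f \<Rightarrow> 'f::comm_ring_1 zorn \<Rightarrow> 'f zorn" where
  "g2_diag x y z = g2_der (vector [vector [x, 0, 0], vector [0, y, 0], vector [0, 0, z]]) 0 0"

definition g2_unit :: "3 \<Rightarrow> 3 \<Rightarrow> 'f \<Rightarrow> 'f::comm_ring_1 zorn \<Rightarrow> 'f zorn" where
  "g2_unit i j c = g2_der (\<chi> r s. if r = i \<and> s = j then c else 0) 0 0"

definition g2_k :: "3 \<Rightarrow> 'f \<Rightarrow> 'f::comm_ring_1 zorn \<Rightarrow> 'f zorn" where
  "g2_k i c = g2_der 0 (axis i c) 0"

definition g2_m :: "3 \<Rightarrow> 'f \<Rightarrow> 'f::comm_ring_1 zorn \<Rightarrow> 'f zorn" where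
  "g2_m i c = g2_der 0 0 (axis i c)"

lemmas g2_basis_defs = g2_diag_def g2_unit_def g2_k_def g2_m_def

lemma g2_basis_in [simp]:
  "g2_k i c \<in> split_g2" "g2_m i c \<in> split_g2"
  "i \<noteq> j \<Longrightarrow> g2_unit i j c \<in> split_g2"
  "x + y + z = 0 \<Longrightarrow> g2_diag x y z \<in> split_g2"
  unfolding g2_basis_defs by (rule g2_der_in_split_g2; auto)+

lemma g2_scale_basis [simp]:
  fixes c :: "'f::field_char_0"
  shows "g2_scale c (g2_k i d) = g2_k i (c * d)" "g2_scale c (g2_m i d) = g2_m i (c * d)"
    "g2_scale c (g2_unit i j d) = g2_unit i j (c * d)"
    "g2_scale c (g2_diag x y z) = g2_diag (c * x) (c * y) (c * z)"
  unfolding g2_basis_defs g2_scale_der g2_der_eq_iff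
  by (auto simp: vec_eq_iff forall_3 axis_def)

lemma g2_basis_sub:
  "g2_diag x y z - g2_diag x' y' z' = g2_diag (x - x') (y - y') (z - z' :: 'f::field_char_0)"
  "g2_diag x y z + g2_diag x' y' z' = g2_diag (x + x') (y + y') (z + z' :: 'f)"
proof -
  show *: "g2_diag x y z + g2_diag x' y' z' = g2_diag (x + x') (y + y') (z + z' :: 'f)" for x y z x' y' z'
    unfolding g2_basis_defs g2_der_add g2_der_eq_iff by (auto simp: vec_eq_iff forall_3)
  show "g2_diag x y z - g2_diag x' y' z' = g2_diag (x - x') (y - y') (z - z' :: 'f::field_char_0)"
    using *[of "x - x'" "y - y'" "z - z'" x' y' z'] by (simp add: eq_diff_eq[symmetric])
qed

lemma g2_bracket_diag:
  fixes x y z :: "'f::field_char_0"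
  assumes "x + y + z = 0" "trace0 A"
  defines "d \<equiv> vector [x, y, z] :: 'f ^ 3"
  shows "g2_bracket (g2_diag x y z) (g2_der A k m) =
    g2_der (\<chi> i j. (d $ i - d $ j) * A $ i $ j) (\<chi> i. d $ i * k $ i) (\<chi> i. - d $ i * m $ i)"
proof -
  have "trace0 (vector [vector [x, 0, 0], vector [0, y, 0], vector [0, 0, z]] :: 'f ^ 3 ^ 3)"
    using assms(1) by simp
  then show ?thesis
    unfolding g2_diag_def g2_bracket_der[OF _ assms(2)] d_def
    by (subst g2_bracket_der[OF _ assms(2)]) (simp_all add: g2_der_eq_iff vec3_simps algebra_simps)
qed

lemma g2_root_bracket:
  fixes x y z :: "'f::field_char_0"
  assumes "x + y + z = 0"
  shows "g2_bracket (g2_diag x y z) (g2_k i c) = g2_scale (vector [x, y, z] $ i) (g2_k i c)"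
    and "g2_bracket (g2_diag x y z) (g2_m i c) = g2_scale (- vector [x, y, z] $ i) (g2_m i c)"
    and "i \<noteq> j \<Longrightarrow> g2_bracket (g2_diag x y z) (g2_unit i j c) =
      g2_scale (vector [x, y, z] $ i - vector [x, y, z] $ j) (g2_unit i j c)"
proof -
  show "g2_bracket (g2_diag x y z) (g2_k i c) = g2_scale (vector [x, y, z] $ i) (g2_k i c)"
    unfolding g2_k_def g2_bracket_diag[OF assms trace0_0] g2_scale_der g2_der_eq_iff
    by (auto simp: vec_eq_iff axis_def)
  show "g2_bracket (g2_diag x y z) (g2_m i c) = g2_scale (- vector [x, y, z] $ i) (g2_m i c)"
    unfolding g2_m_def g2_bracket_diag[OF assms trace0_0] g2_scale_der g2_der_eq_iff
    by (auto simp: vec_eq_iff axis_def)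
  assume "i \<noteq> j"
  then have "trace0 (\<chi> r s. if r = i \<and> s = j then c else 0)" by auto
  from g2_bracket_diag[OF assms this]
  show "g2_bracket (g2_diag x y z) (g2_unit i j c) =
      g2_scale (vector [x, y, z] $ i - vector [x, y, z] $ j) (g2_unit i j c)"
    unfolding g2_unit_def g2_scale_der by (auto simp: g2_der_eq_iff vec_eq_iff)
qed

lemma g2_bracket_kk:
  fixes c d :: "'f::field_char_0"
  shows "g2_bracket (g2_k 2 c) (g2_k 3 d) = g2_m 1 (2 * c * d)"
    "g2_bracket (g2_k 3 c) (g2_k 1 d) = g2_m 2 (2 * c * d)"
    "g2_bracket (g2_k 1 c) (g2_k 2 d) = g2_m 3 (2 * c * d)"
  unfolding g2_k_def g2_m_def g2_bracket_der[OF trace0_0 trace0_0] g2_der_eq_iff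
  by (auto simp: vec3_simps axis_def)

lemma g2_bracket_km:
  fixes c d :: "'f::field_char_0"
  assumes "i \<noteq> j"
  shows "g2_bracket (g2_k i c) (g2_m j d) = g2_unit i j (- 3 * c * d)"
  unfolding g2_k_def g2_m_def g2_unit_def g2_bracket_der[OF trace0_0 trace0_0] g2_der_eq_iff
  using exhaust_3[of i] exhaust_3[of j] assms
  by (elim disjE) (simp_all add: vec3_simps axis_def)

lemma g2_bracket_km_diag:
  fixes c d :: "'f::field_char_0"
  shows "g2_bracket (g2_k 3 c) (g2_m 3 d) = g2_diag (c * d) (c * d) (- 2 * c * d)"
    "g2_bracket (g2_m 1 d) (g2_k 1 c) = g2_diag (2 * c * d) (- c * d) (- c * d)"
  unfolding g2_k_def g2_m_def g2_diag_def g2_bracket_der[OF trace0_0 trace0_0] g2_der_eq_iff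
  by (simp_all add: vec3_simps axis_def algebra_simps)

lemma g2_basis_nonzero:
  fixes c :: "'f::field_char_0"
  assumes "c \<noteq> 0"
  shows "g2_k i c \<noteq> 0" "g2_m i c \<noteq> 0" "g2_unit i j c \<noteq> 0"
  unfolding g2_basis_defs g2_der_zero[symmetric] g2_der_eq_iff
  using assms by (auto simp: vec_eq_iff axis_def)

section \<open>Transport of the algebraic claims along an injective representation\<close>

locale split_g2_representation =
  fixes sc :: "'f::real_normed_field \<Rightarrow> 'v::ab_group_add \<Rightarrow> 'v"
    and br :: "'v \<Rightarrow> 'v \<Rightarrow> 'v"
    and \<Phi> :: "('f zorn \<Rightarrow> 'f zorn) \<Rightarrow> 'v"
  assumes vector_space_sc: "vector_space sc"
    and add: "D \<in> split_g2 \<Longrightarrow> E \<in> split_g2 \<Longrightarrow> \<Phi> (D + E) = \<Phi> D + \<Phi> E"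
    and scale: "D \<in> split_g2 \<Longrightarrow> \<Phi> (g2_scale c D) = sc c (\<Phi> D)"
    and bracket: "D \<in> split_g2 \<Longrightarrow> E \<in> split_g2 \<Longrightarrow> \<Phi> (g2_bracket D E) = br (\<Phi> D) (\<Phi> E)"
    and inj: "inj_on \<Phi> split_g2"
begin

interpretation vector_space sc by (rule vector_space_sc)

lemma zero: "\<Phi> 0 = 0"
  using add[OF split_g2_zero split_g2_zero] by simp

lemma diff_diag:
  assumes "x + y + z = 0" "x' + y' + z' = 0"
  shows "\<Phi> (g2_diag x y z) - \<Phi> (g2_diag x' y' z') = \<Phi> (g2_diag (x - x') (y - y') (z - z'))"
proof -
  have "x - x' + (y - y') + (z - z') = 0"
    using arg_cong2[OF assms, of "(-)"] by (simp add: algebra_simps)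
  then show ?thesis
    using add[of "g2_diag (x - x') (y - y') (z - z')" "g2_diag x' y' z'"] assms
    by (simp add: g2_basis_sub)
qed

lemma image_subspace: "subspace (\<Phi> ` split_g2)"
proof (rule subspaceI)
  show "0 \<in> \<Phi> ` split_g2"
    using zero split_g2_zero by (metis image_eqI)
next
  fix x y assume "x \<in> \<Phi> ` split_g2" "y \<in> \<Phi> ` split_g2"
  then show "x + y \<in> \<Phi> ` split_g2"
    by (auto simp: add[symmetric] intro!: imageI split_g2_add)
next
  fix c x assume "x \<in> \<Phi> ` split_g2"
  then show "sc c x \<in> \<Phi> ` split_g2"
    by (auto simp: scale[symmetric] intro!: imageI split_g2_scale)
qed

lemma jacobi:
  fixes D E F :: "'f zorn \<Rightarrow> 'f zorn"
  assumes "D \<in> split_g2" "E \<in> split_g2" "F \<in> split_g2"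
  shows "g2_bracket D (g2_bracket E F) + g2_bracket E (g2_bracket F D) + g2_bracket F (g2_bracket D E)
    = 0"
proof -
  have *: "G (x - y) = G x - G y" if "G \<in> split_g2" for G :: "'f zorn \<Rightarrow> 'f zorn" and x y
  proof -
    have "G (x - y + y) = G (x - y) + G y"
      using that unfolding split_g2_def by blast
    then show ?thesis by (simp add: eq_diff_eq)
  qed
  show ?thesis
    by (rule ext) (simp add: g2_bracket_def *[OF assms(1)] *[OF assms(2)] *[OF assms(3)])
qed

lemma lie_algebra_image: "lie_algebra_on sc br (\<Phi> ` split_g2)"
proof -
  have bi: "g2_bracket (D + E) F = g2_bracket D F + g2_bracket E F"
    "g2_bracket F (D + E) = g2_bracket F D + g2_bracket F E" if "F \<in> split_g2" for D E F :: "'f zorn \<Rightarrow> 'f zorn"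
  proof -
    have "F (x + y) = F x + F y" for x y using that unfolding split_g2_def by blast
    then show "g2_bracket (D + E) F = g2_bracket D F + g2_bracket E F"
      "g2_bracket F (D + E) = g2_bracket F D + g2_bracket F E"
      by (simp_all add: g2_bracket_def fun_eq_iff del: split_paired_All)
  qed
  have sc2: "zorn_scale c (x - y) = zorn_scale c x - zorn_scale c y" for c and x y :: "'f zorn"
    by (cases x; cases y) (simp add: algebra_simps vec_eq_iff)
  have bs: "g2_bracket (g2_scale c D) F = g2_scale c (g2_bracket D F)"
    "g2_bracket F (g2_scale c D) = g2_scale c (g2_bracket F D)" if "F \<in> split_g2" for c and D F :: "'f zorn \<Rightarrow> 'f zorn"
  proof -
    have "F (zorn_scale c x) = zorn_scale c (F x)" for x using that unfolding split_g2_def by blast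
    then show "g2_bracket (g2_scale c D) F = g2_scale c (g2_bracket D F)"
      "g2_bracket F (g2_scale c D) = g2_scale c (g2_bracket F D)"
      by (simp_all add: g2_bracket_def g2_scale_def sc2 fun_eq_iff del: split_paired_All)
  qed
  have alt: "g2_bracket D D = 0" for D :: "'f zorn \<Rightarrow> 'f zorn"
    by (simp add: g2_bracket_def zero_fun_def)
  show ?thesis
    unfolding lie_algebra_on_def
    by (intro conjI ballI allI vector_space_sc image_subspace; elim imageE; hypsubst)
      (auto simp: add[symmetric] scale[symmetric] bracket[symmetric] zero[symmetric] alt bi bs jacobi
         split_g2_add split_g2_scale split_g2_bracket simp del: split_paired_All)
qed

lemma isomorphic_image:
  "lie_isomorphic sc br (\<Phi> ` split_g2) g2_scale g2_bracket (split_g2 :: ('f zorn \<Rightarrow> 'f zorn) set)"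
  unfolding lie_isomorphic_def
proof (intro exI conjI ballI allI)
  let ?\<phi> = "inv_into split_g2 \<Phi>"
  note [simp] = inv_into_f_f[OF inj] split_g2_add split_g2_scale split_g2_bracket
  show "bij_betw ?\<phi> (\<Phi> ` split_g2) split_g2"
    using inj by (simp add: bij_betw_inv_into inj_on_imp_bij_betw)
  fix x y c assume x: "x \<in> \<Phi> ` split_g2"
  then show "?\<phi> (sc c x) = g2_scale c (?\<phi> x)"
    by (auto simp: scale[symmetric])
  assume "y \<in> \<Phi> ` split_g2"
  with x show "?\<phi> (x + y) = ?\<phi> x + ?\<phi> y" "?\<phi> (br x y) = g2_bracket (?\<phi> x) (?\<phi> y)"
    by (auto simp: add[symmetric] bracket[symmetric])
qed

abbreviation (input) "r3 \<equiv> of_real (sqrt 3) :: 'f"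

text \<open>One formula serves both halves of the basis claim: solving its right-hand side for a
  given derivation gives spanning, and reading off its entries when it is zero gives
  independence.\<close>

lemma basis_combination:
  "sc a1 (\<Phi> (g2_k 2 (- 1))) + sc a2 (\<Phi> (g2_k 3 (- 1))) + sc a3 (\<Phi> (g2_k 1 (- 1))) +
   sc a4 (\<Phi> (g2_m 1 2)) + sc a5 (\<Phi> (g2_m 2 2)) + sc a6 (\<Phi> (g2_m 3 2)) +
   sc a7 (\<Phi> (g2_diag (- 1 / 2) 1 (- 1 / 2))) + sc a8 (\<Phi> (g2_diag (- r3 / 2) 0 (r3 / 2))) +
   sc a9 (\<Phi> (g2_unit 2 1 6)) + sc a10 (\<Phi> (g2_unit 3 1 6)) + sc a11 (\<Phi> (g2_unit 3 2 6)) +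
   sc a12 (\<Phi> (g2_unit 1 2 6)) + sc a13 (\<Phi> (g2_unit 1 3 6)) + sc a14 (\<Phi> (g2_unit 2 3 6)) =
   \<Phi> (g2_der
     (vector [vector [- a7 / 2 - r3 / 2 * a8, 6 * a12, 6 * a13],
              vector [6 * a9, a7, 6 * a14],
              vector [6 * a10, 6 * a11, - a7 / 2 + r3 / 2 * a8]])
     (vector [- a3, - a1, - a2]) (vector [2 * a4, 2 * a5, 2 * a6]))"
  (is "?l = \<Phi> ?r")
proof -
  note [simp] = split_g2_add split_g2_scale split_g2_bracket
  have "?l = \<Phi> (g2_scale a1 (g2_k 2 (- 1)) + g2_scale a2 (g2_k 3 (- 1)) + g2_scale a3 (g2_k 1 (- 1)) +
   g2_scale a4 (g2_m 1 2) + g2_scale a5 (g2_m 2 2) + g2_scale a6 (g2_m 3 2) +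
   g2_scale a7 (g2_diag (- 1 / 2) 1 (- 1 / 2)) + g2_scale a8 (g2_diag (- r3 / 2) 0 (r3 / 2)) +
   g2_scale a9 (g2_unit 2 1 6) + g2_scale a10 (g2_unit 3 1 6) + g2_scale a11 (g2_unit 3 2 6) +
   g2_scale a12 (g2_unit 1 2 6) + g2_scale a13 (g2_unit 1 3 6) + g2_scale a14 (g2_unit 2 3 6))"
    by (simp add: add scale del: g2_scale_basis)
  also have "\<dots> = \<Phi> ?r"
    unfolding g2_basis_defs g2_scale_der g2_der_add
    by (rule arg_cong[of _ _ \<Phi>]) (simp add: g2_der_eq_iff vec_eq_iff forall_3 axis_def)
  finally show ?thesis .
qed

definition basis :: "'v list" where
  "basis = [\<Phi> (g2_k 2 (- 1)), \<Phi> (g2_k 3 (- 1)), \<Phi> (g2_k 1 (- 1)),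
     \<Phi> (g2_m 1 2), \<Phi> (g2_m 2 2), \<Phi> (g2_m 3 2),
     \<Phi> (g2_diag (- 1 / 2) 1 (- 1 / 2)), \<Phi> (g2_diag (- r3 / 2) 0 (r3 / 2)),
     \<Phi> (g2_unit 2 1 6), \<Phi> (g2_unit 3 1 6), \<Phi> (g2_unit 3 2 6),
     \<Phi> (g2_unit 1 2 6), \<Phi> (g2_unit 1 3 6), \<Phi> (g2_unit 2 3 6)]"

lemma r3_neq_0: "r3 \<noteq> 0"
  by simp

lemma basis_span: "span (set basis) = \<Phi> ` split_g2"
proof (rule antisym)
  show "span (set basis) \<subseteq> \<Phi> ` split_g2"
    by (rule span_minimal[OF _ image_subspace]) (auto simp: basis_def)
  show "\<Phi> ` split_g2 \<subseteq> span (set basis)"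
  proof
    fix V assume "V \<in> \<Phi> ` split_g2"
    then obtain A k m where V: "V = \<Phi> (g2_der A k m)" and tr: "trace0 A"
      by (auto elim: split_g2_cases)
    have A33: "A $ 3 $ 3 = - A $ 1 $ 1 - A $ 2 $ 2"
      using tr by (simp add: eq_neg_iff_add_eq_0 algebra_simps)
    \<comment> \<open>Solves \<open>A $ 1 $ 1 = - a7 / 2 - r3 / 2 * a8\<close> and
      \<open>A $ 3 $ 3 = - a7 / 2 + r3 / 2 * a8\<close> with \<open>a7 = A $ 2 $ 2\<close>.\<close>
    let ?a8 = "(A $ 3 $ 3 - A $ 1 $ 1) / r3"
    have "g2_der A k m = g2_der
     (vector [vector [- (A $ 2 $ 2) / 2 - r3 / 2 * ?a8, 6 * (A $ 1 $ 2 / 6), 6 * (A $ 1 $ 3 / 6)],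
              vector [6 * (A $ 2 $ 1 / 6), A $ 2 $ 2, 6 * (A $ 2 $ 3 / 6)],
              vector [6 * (A $ 3 $ 1 / 6), 6 * (A $ 3 $ 2 / 6), - (A $ 2 $ 2) / 2 + r3 / 2 * ?a8]])
     (vector [- (- (k $ 1)), - (- (k $ 2)), - (- (k $ 3))])
     (vector [2 * (m $ 1 / 2), 2 * (m $ 2 / 2), 2 * (m $ 3 / 2)])"
      unfolding g2_der_eq_iff using r3_neq_0
      by (simp add: vec_eq_iff forall_3 A33 field_simps)
    then show "V \<in> span (set basis)"
      unfolding V by (simp only: basis_combination[symmetric])
        (intro span_add span_scale span_base; simp add: basis_def)
  qed
qed

lemma basis_distinct: "distinct basis"
proof -
  have *: "\<Phi> D = \<Phi> E \<longleftrightarrow> D = E" if "D \<in> split_g2" "E \<in> split_g2" for D E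
    using inj that by (auto dest: inj_onD)
  show ?thesis
    unfolding basis_def using r3_neq_0
    by (simp add: * split_g2_bracket)
      (simp add: g2_basis_defs g2_der_eq_iff vec_eq_iff forall_3 axis_def)
qed

lemma basis_independent: "\<not> dependent (set basis)"
proof
  assume "dependent (set basis)"
  then obtain u where u: "(\<Sum>v\<in>set basis. sc (u v) v) = 0" and nz: "\<exists>v\<in>set basis. u v \<noteq> 0"
    using dependent_finite[of "set basis"] by auto
  let ?a = "\<lambda>i. u (basis ! i)"
  let ?D = "g2_der
     (vector [vector [- ?a 6 / 2 - r3 / 2 * ?a 7, 6 * ?a 11, 6 * ?a 12],
              vector [6 * ?a 8, ?a 6, 6 * ?a 13],
              vector [6 * ?a 9, 6 * ?a 10, - ?a 6 / 2 + r3 / 2 * ?a 7]])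
     (vector [- ?a 2, - ?a 0, - ?a 1]) (vector [2 * ?a 3, 2 * ?a 4, 2 * ?a 5])"
  have "(\<Sum>v\<in>set basis. sc (u v) v) = sum_list (map (\<lambda>v. sc (u v) v) basis)"
    by (rule sum.distinct_set_conv_list[OF basis_distinct])
  also have "\<dots> = \<Phi> ?D"
    unfolding basis_combination[symmetric] by (simp add: basis_def add.assoc)
  finally have "\<Phi> ?D = \<Phi> 0"
    using u zero by simp
  moreover have "?D \<in> split_g2"
    by (rule g2_der_in_split_g2) simp
  ultimately have "?D = g2_der 0 0 0"
    using inj split_g2_zero by (metis g2_der_zero inj_onD)
  then have "\<forall>i<14. ?a i = 0"
    unfolding g2_der_eq_iff using r3_neq_0
    by (auto simp: vec_eq_iff forall_3 numeral_eq_Suc All_less_Suc)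
  moreover have "length basis = 14" by (simp add: basis_def)
  ultimately show False using nz by (metis in_set_conv_nth)
qed

lemma root_bracket:
  assumes "x + y + z = 0"
  shows "br (\<Phi> (g2_diag x y z)) (\<Phi> (g2_k i c)) = sc (vector [x, y, z] $ i) (\<Phi> (g2_k i c))"
    and "br (\<Phi> (g2_diag x y z)) (\<Phi> (g2_m i c)) = sc (- vector [x, y, z] $ i) (\<Phi> (g2_m i c))"
    and "i \<noteq> j \<Longrightarrow> br (\<Phi> (g2_diag x y z)) (\<Phi> (g2_unit i j c)) =
      sc (vector [x, y, z] $ i - vector [x, y, z] $ j) (\<Phi> (g2_unit i j c))"
  using assms
  by (simp_all only: bracket[symmetric] scale[symmetric] g2_basis_in g2_root_bracket not_False_eq_True)

text \<open>The \<open>i\<close>-th diagonal entries of the two matrices are the coordinates of the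
  root of \<open>g2_k i\<close>: the pairs (-1/2, -sqrt 3/2), (1, 0), (-1/2, sqrt 3/2) are the roots
  of \<open>S3\<close>, \<open>S1\<close>, \<open>S2\<close>.\<close>

abbreviation "h1 \<equiv> \<Phi> (g2_diag (- 1 / 2) 1 (- 1 / 2))"
abbreviation "h2 \<equiv> \<Phi> (g2_diag (- r3 / 2) 0 (r3 / 2))"

lemma cartan_span:
  "span {h1, h2} = {\<Phi> (g2_diag x y z) | x y z. x + y + z = 0}" (is "_ = ?K")
proof (rule antisym)
  have "subspace ?K"
  proof (rule subspaceI)
    have "g2_diag 0 0 0 = (0 :: 'f zorn \<Rightarrow> 'f zorn)"
      unfolding g2_basis_defs g2_der_zero[symmetric] g2_der_eq_iff by (simp add: vec_eq_iff forall_3)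
    then show "0 \<in> ?K" using zero by (metis (mono_tags, lifting) add.right_neutral mem_Collect_eq)
  next
    fix V W assume "V \<in> ?K" "W \<in> ?K"
    then obtain x y z x' y' z' where V: "V = \<Phi> (g2_diag x y z)" "x + y + z = 0"
      and W: "W = \<Phi> (g2_diag x' y' z')" "x' + y' + z' = 0" by blast
    have "(x + x') + (y + y') + (z + z') = 0"
      using arg_cong2[OF V(2) W(2), of "(+)"] by (simp add: algebra_simps)
    moreover have "V + W = \<Phi> (g2_diag (x + x') (y + y') (z + z'))"
      using V W by (simp add: add[symmetric] g2_basis_sub)
    ultimately show "V + W \<in> ?K" by blast
  next
    fix c V assume "V \<in> ?K"
    then obtain x y z where V: "V = \<Phi> (g2_diag x y z)" "x + y + z = 0" by blast
    have "c * x + c * y + c * z = 0"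
      using V(2) by (simp flip: distrib_left)
    moreover have "sc c V = \<Phi> (g2_diag (c * x) (c * y) (c * z))"
      using V by (simp add: scale[symmetric])
    ultimately show "sc c V \<in> ?K" by blast
  qed
  then show "span {h1, h2} \<subseteq> ?K"
    by (rule span_minimal[rotated]) force
  show "?K \<subseteq> span {h1, h2}"
  proof
    fix V assume "V \<in> ?K"
    then obtain x y z where V: "V = \<Phi> (g2_diag x y z)" and s: "x + y + z = 0" by blast
    have z: "z = - x - y" using s by (simp add: eq_neg_iff_add_eq_0 algebra_simps)
    have "g2_diag x y z = g2_scale y (g2_diag (- 1 / 2) 1 (- 1 / 2)) +
        g2_scale ((z - x) / r3) (g2_diag (- r3 / 2) 0 (r3 / 2))"
      unfolding g2_scale_basis g2_basis_sub unfolding g2_basis_defs g2_der_eq_iff using r3_neq_0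
      by (simp add: vec_eq_iff forall_3 z field_simps)
    then have "V = sc y h1 + sc ((z - x) / r3) h2"
      unfolding V by (simp add: add scale split_g2_scale del: g2_scale_basis)
    then show "V \<in> span {h1, h2}"
      by (simp add: span_add span_scale span_base)
  qed
qed

lemma cartan_abelian:
  assumes "V \<in> span {h1, h2}" "W \<in> span {h1, h2}"
  shows "br V W = 0"
proof -
  obtain x y z x' y' z' where V: "V = \<Phi> (g2_diag x y z)" "x + y + z = 0"
      and W: "W = \<Phi> (g2_diag x' y' z')" "x' + y' + z' = 0" using assms unfolding cartan_span by blast
  have tr: "trace0 (vector [vector [x', 0, 0], vector [0, y', 0], vector [0, 0, z']] :: 'f ^ 3 ^ 3)"
    using W(2) by simp
  have "g2_bracket (g2_diag x y z) (g2_diag x' y' z') = 0"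
    unfolding g2_diag_def[of x'] g2_bracket_diag[OF V(2) tr] g2_der_zero[symmetric] g2_der_eq_iff
    by (simp add: vec_eq_iff forall_3)
  then show ?thesis
    using V W zero by (simp add: bracket[symmetric])
qed

lemma cartan: "cartan_subalgebra sc br (\<Phi> ` split_g2) (span {h1, h2})"
proof -
  let ?K = "span {h1, h2}"
  have 0: "0 \<in> ?K" by (rule span_zero)
  have sub: "?K \<subseteq> \<Phi> ` split_g2"
    unfolding cartan_span by auto
  have "{br x y | x y. x \<in> ?K \<and> y \<in> ?K} = {0}"
    (is "?B = _")
  proof
    show "?B \<subseteq> {0}" using cartan_abelian by blast
    show "{0} \<subseteq> ?B" using cartan_abelian[OF 0 0, symmetric] 0 by blast
  qed
  \<comment> \<open>Index 0 of the series is the subalgebra itself, so commutativity shows at index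
    1.\<close>
  then have low: "lower_central sc br ?K (Suc 0) = {0}"
    by (simp add: span_insert_0)
  have nrm: "V \<in> ?K" if V: "V \<in> \<Phi> ` split_g2" and V_nrm: "\<forall>W\<in>?K. br V W \<in> ?K" for V
  proof -
    obtain A k m where D: "V = \<Phi> (g2_der A k m)" and tr: "trace0 A"
      using V by (auto elim: split_g2_cases)
    have *: "(\<forall>i. vector [x, y, z] $ i * k $ i = 0 \<and> vector [x, y, z] $ i * m $ i = 0) \<and>
      (\<forall>i j. i \<noteq> j \<longrightarrow> (vector [x, y, z] $ i - vector [x, y, z] $ j) * A $ i $ j = 0)"
      if s: "x + y + z = 0" for x y z :: 'f
    proof -
      have W: "\<Phi> (g2_diag x y z) \<in> ?K" unfolding cartan_span using s by blast
      have "br V (\<Phi> (g2_diag x y z)) \<in> ?K" using V_nrm W by blast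
      moreover have "br V (\<Phi> (g2_diag x y z)) =
          \<Phi> (g2_bracket (g2_der A k m) (g2_diag x y z))"
        unfolding D using g2_der_in_split_g2[OF tr] s by (simp add: bracket)
      ultimately obtain x' y' z' where s': "x' + y' + z' = 0"
        and "\<Phi> (g2_bracket (g2_der A k m) (g2_diag x y z)) = \<Phi> (g2_diag x' y' z')"
        unfolding cartan_span by auto
      then have "g2_bracket (g2_der A k m) (g2_diag x y z) = g2_diag x' y' z'"
        using inj s s' g2_der_in_split_g2[OF tr] by (auto dest!: inj_onD intro!: split_g2_bracket)
      moreover have "g2_bracket (g2_der A k m) (g2_diag x y z) =
          g2_scale (- 1) (g2_bracket (g2_diag x y z) (g2_der A k m))"
      proof
        fix w
        show "g2_bracket (g2_der A k m) (g2_diag x y z) w =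
          g2_scale (- 1) (g2_bracket (g2_diag x y z) (g2_der A k m)) w"
          by (cases "g2_der A k m (g2_diag x y z w)"; cases "g2_diag x y z (g2_der A k m w)")
            (simp add: g2_bracket_def g2_scale_def vec_eq_iff)
      qed
      ultimately have "g2_der (\<chi> i j. - ((vector [x, y, z] $ i - vector [x, y, z] $ j) * A $ i $ j))
          (\<chi> i. - (vector [x, y, z] $ i * k $ i)) (\<chi> i. vector [x, y, z] $ i * m $ i) = g2_diag x' y' z'"
        unfolding g2_bracket_diag[OF s tr] g2_scale_der by (simp add: vector_scalar_mult_def)
      then show ?thesis
        unfolding g2_diag_def g2_der_eq_iff by (simp add: vec_eq_iff forall_3)
    qed
    \<comment> \<open>The diagonal (1, 2, -3) is regular: its entries and their differences are
      nonzero, so no root vanishes on it, and each root component of a normalising element must be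
      zero.\<close>
    have A: "A = vector [vector [A $ 1 $ 1, 0, 0], vector [0, A $ 2 $ 2, 0], vector [0, 0, A $ 3 $ 3]]"
      using *[of "1" "2" "- 3"] by (simp add: vec_eq_iff forall_3)
    have "k = 0" "m = 0"
      using *[of "1" "2" "- 3"] by (simp_all add: vec_eq_iff forall_3)
    then have "V = \<Phi> (g2_diag (A $ 1 $ 1) (A $ 2 $ 2) (A $ 3 $ 3))"
      unfolding D g2_diag_def using A by simp
    then show "V \<in> ?K" unfolding cartan_span using tr by blast
  qed
  have cl: "br V W \<in> ?K" if "V \<in> ?K" "W \<in> ?K" for V W
    using cartan_abelian[OF that] 0 by simp
  have "{V \<in> \<Phi> ` split_g2. \<forall>W\<in>?K. br V W \<in> ?K} = ?K"
  proof (intro equalityI subsetI)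
    fix V assume "V \<in> ?K"
    then show "V \<in> {V \<in> \<Phi> ` split_g2. \<forall>W\<in>?K. br V W \<in> ?K}"
      using subsetD[OF sub, of V] cl[of V] by blast
  next
    fix V assume "V \<in> {V \<in> \<Phi> ` split_g2. \<forall>W\<in>?K. br V W \<in> ?K}"
    then show "V \<in> ?K" using nrm[of V] by blast
  qed
  then show ?thesis
    unfolding cartan_subalgebra_def
    by (intro conjI subspace_span[of "{h1, h2}"] sub ballI cl exI[of _ "Suc 0"] low)
qed

text \<open>\<open>S1\<close>, \<open>S2\<close>, \<open>S3\<close> correspond to
  \<open>g2_k\<close> with indices 2, 3, 1, which gives \<open>S4\<close>, \<open>S5\<close>,
  \<open>S6\<close> the indices 1, 2, 3. Both \<open>h\<close> and \<open>H\<close> are proportional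
  to the product of the three coefficients, and the prescribed eigenvalues force this product to be
  -1. With each coefficient -1, the vectors in V* get the factor 2 and the long root vectors get
  \<open>6 = - 3 * (- 1) * 2\<close>.\<close>

lemma chain:
  "br (\<Phi> (g2_k 2 (- 1))) (\<Phi> (g2_k 3 (- 1))) = \<Phi> (g2_m 1 2)"
  "br (\<Phi> (g2_k 3 (- 1))) (\<Phi> (g2_k 1 (- 1))) = \<Phi> (g2_m 2 2)"
  "br (\<Phi> (g2_k 1 (- 1))) (\<Phi> (g2_k 2 (- 1))) = \<Phi> (g2_m 3 2)"
  "i \<noteq> j \<Longrightarrow> br (\<Phi> (g2_k i (- 1))) (\<Phi> (g2_m j 2)) = \<Phi> (g2_unit i j 6)"
  "br (\<Phi> (g2_k 3 (- 1))) (\<Phi> (g2_m 3 2)) = \<Phi> (g2_diag (- 2) (- 2) 4)"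
  "br (\<Phi> (g2_m 1 2)) (\<Phi> (g2_k 1 (- 1))) = \<Phi> (g2_diag (- 4) 2 2)"
  by (simp_all add: bracket[symmetric] g2_bracket_kk g2_bracket_km g2_bracket_km_diag)

lemma cartan_elements:
  "sc (1 / 4) (\<Phi> (g2_diag (- 4) 2 2) - \<Phi> (g2_diag (- 2) (- 2) 4)) = h1"
  "sc (of_real (sqrt 3 / 12)) (\<Phi> (g2_diag (- 4) 2 2) + \<Phi> (g2_diag (- 2) (- 2) 4)) = h2"
  by (simp_all add: diff_diag add[symmetric] g2_basis_sub scale[symmetric])

lemma \<Phi>_nonzero: "D \<in> split_g2 \<Longrightarrow> D \<noteq> 0 \<Longrightarrow> \<Phi> D \<noteq> 0"
  using inj split_g2_zero zero by (metis inj_onD)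

lemma roots:
  "\<forall>(V, \<alpha>, \<beta>) \<in> set
     [(\<Phi> (g2_k 2 (- 1)), 1, 0), (\<Phi> (g2_m 2 2), -1, 0),
      (\<Phi> (g2_m 1 2), 1/2, sqrt 3 / 2), (\<Phi> (g2_k 1 (- 1)), -1/2, - sqrt 3 / 2),
      (\<Phi> (g2_k 3 (- 1)), -1/2, sqrt 3 / 2), (\<Phi> (g2_m 3 2), 1/2, - sqrt 3 / 2),
      (\<Phi> (g2_unit 3 1 6), 0, sqrt 3), (\<Phi> (g2_unit 1 3 6), 0, - sqrt 3),
      (\<Phi> (g2_unit 2 1 6), 3/2, sqrt 3 / 2), (\<Phi> (g2_unit 1 2 6), -3/2, - sqrt 3 / 2),
      (\<Phi> (g2_unit 3 2 6), -3/2, sqrt 3 / 2), (\<Phi> (g2_unit 2 3 6), 3/2, - sqrt 3 / 2)].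
     V \<noteq> 0 \<and> br h1 V = sc (of_real \<alpha>) V \<and> br h2 V = sc (of_real \<beta>) V"
  by (simp add: \<Phi>_nonzero g2_basis_nonzero root_bracket)

text \<open>This repeats the algebraic part of \<open>pairwise_bracket_generates_split_g2\<close>
  with abstract \<open>sc\<close> and \<open>br\<close>, so that it becomes the required statement
  once the images of the three generators are identified with the vector fields.\<close>

lemma generation:
  "let S1 = \<Phi> (g2_k 2 (- 1)); S2 = \<Phi> (g2_k 3 (- 1)); S3 = \<Phi> (g2_k 1 (- 1));
       S4 = br S1 S2; S5 = br S2 S3; S6 = br S3 S1;
       L1 = br S1 S4; L2 = br S2 S4; L3 = br S2 S5;
       L4 = br S3 S5; L5 = br S3 S6; L6 = br S1 S6;
       H = br S2 S6; h = br S4 S3;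
       h1 = sc (1/4) (h - H);
       h2 = sc (of_real (sqrt 3 / 12)) (h + H);
       B = [S1, S2, S3, S4, S5, S6, h1, h2, L1, L2, L3, L4, L5, L6];
       L = module.span sc (set B)
   in distinct B \<and> \<not> module.dependent sc (set B) \<and>
      lie_algebra_on sc br L \<and>
      lie_isomorphic sc br L g2_scale g2_bracket split_g2 \<and>
      cartan_subalgebra sc br L (module.span sc {h1, h2}) \<and>
      (\<forall>(V, \<alpha>, \<beta>) \<in> set
         [(S1, 1, 0), (S5, -1, 0),
          (S4, 1/2, sqrt 3 / 2), (S3, -1/2, - sqrt 3 / 2),
          (S2, -1/2, sqrt 3 / 2), (S6, 1/2, - sqrt 3 / 2),
          (L2, 0, sqrt 3), (L5, 0, - sqrt 3),
          (L1, 3/2, sqrt 3 / 2), (L4, -3/2, - sqrt 3 / 2),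
          (L3, -3/2, sqrt 3 / 2), (L6, 3/2, - sqrt 3 / 2)].
         V \<noteq> 0 \<and> br h1 V = sc (of_real \<alpha>) V \<and> br h2 V = sc (of_real \<beta>) V)"
  unfolding Let_def chain(1-3) chain(4)[OF three_neq(1)] chain(4)[OF three_neq(2)]
    chain(4)[OF three_neq(3)] chain(4)[OF three_neq(4)] chain(4)[OF three_neq(5)]
    chain(4)[OF three_neq(6)] chain(5-6) cartan_elements basis_def[symmetric] basis_span
  using basis_distinct basis_independent lie_algebra_image isomorphic_image cartan roots
  by (rule conjI[OF _ conjI[OF _ conjI[OF _ conjI[OF _ conjI]]]])

end

section \<open>Directional derivatives and commuting partial derivatives\<close>

locale scalar_domain =
  fixes \<iota> :: "'k::real_normed_field \<Rightarrow> 'f::real_normed_field" and U :: "'k point set"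
  assumes embedding: "scalar_embedding \<iota>" and open_U: "open U"
begin

lemma embedding_bounded_linear: "bounded_linear \<iota>" and embedding_one: "\<iota> 1 = 1"
  using embedding by (auto simp: scalar_embedding_def)

lemma sderiv_const: "has_sderiv \<iota> (\<lambda>t. c) 0 x"
  by (simp add: has_sderiv_def)

lemma sderiv_add: "has_sderiv \<iota> f D x \<Longrightarrow> has_sderiv \<iota> g E x \<Longrightarrow> has_sderiv \<iota> (\<lambda>t. f t + g t) (D + E) x"
  unfolding has_sderiv_def by (drule (1) has_derivative_add) (simp add: distrib_left)

lemma sderiv_mult:
  "has_sderiv \<iota> f D x \<Longrightarrow> has_sderiv \<iota> g E x \<Longrightarrow> has_sderiv \<iota> (\<lambda>t. f t * g t) (D * g x + f x * E) x"
  unfolding has_sderiv_def by (drule (1) has_derivative_mult) (simp add: algebra_simps)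

lemma sderiv_divide:
  "has_sderiv \<iota> f D x \<Longrightarrow> has_sderiv \<iota> g E x \<Longrightarrow> g x \<noteq> 0 \<Longrightarrow>
   has_sderiv \<iota> (\<lambda>t. f t / g t) (D / g x - f x * E / (g x)^2) x"
  unfolding has_sderiv_def
  by (drule (2) has_derivative_divide) (simp add: field_simps power2_eq_square)

lemma sderiv_chain:
  assumes "has_sderiv \<iota> g D x" "(f has_field_derivative E) (at (g x))"
  shows "has_sderiv \<iota> (\<lambda>t. f (g t)) (D * E) x"
  using has_derivative_compose[OF assms(1)[unfolded has_sderiv_def]
      assms(2)[unfolded has_field_derivative_def]]
  by (simp add: has_sderiv_def ac_simps)

text \<open>The two derivatives agree as linear maps; evaluating them at 1, where
  \<open>\<iota> 1 = 1\<close>, recovers the coefficient.\<close>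

lemma sderiv_unique: "has_sderiv \<iota> g D x \<Longrightarrow> has_sderiv \<iota> g E x \<Longrightarrow> D = E"
  unfolding has_sderiv_def using has_derivative_unique[of g "\<lambda>h. \<iota> h * D" x "\<lambda>h. \<iota> h * E"] embedding_one
  by (metis mult_1)

lemma sderiv_eq: "has_sderiv \<iota> g D x \<Longrightarrow> sderiv \<iota> g x = D"
  unfolding sderiv_def using sderiv_unique by blast

lemma sdiffD: "sdiff \<iota> g x \<Longrightarrow> has_sderiv \<iota> g (sderiv \<iota> g x) x"
  using sderiv_eq unfolding sdiff_def by blast

lemma sderiv_cong:
  assumes "has_sderiv \<iota> g D x" "open S" "x \<in> S" "\<And>t. t \<in> S \<Longrightarrow> g t = h t"
  shows "has_sderiv \<iota> h D x"
  using assms has_derivative_transform_within_open[of g _ x UNIV S h] unfolding has_sderiv_def by simp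

lemma sderiv_continuous: "has_sderiv \<iota> g D x \<Longrightarrow> isCont g x"
  unfolding has_sderiv_def by (rule has_derivative_continuous)

definition has_partial :: "coord \<Rightarrow> ('k point \<Rightarrow> 'f) \<Rightarrow> 'f \<Rightarrow> 'k point \<Rightarrow> bool" where
  "has_partial i g D v \<longleftrightarrow> has_sderiv \<iota> (\<lambda>t. g (v + axis i t)) D 0"

lemma partial_eq: "has_partial i g D v \<Longrightarrow> partial \<iota> i g v = D"
  unfolding has_partial_def partial_def by (rule sderiv_eq)

lemma has_partial_pdiff: "has_partial i g D v \<Longrightarrow> pdiff \<iota> i g v"
  unfolding has_partial_def pdiff_def sdiff_def by blast

lemma pdiffD: "pdiff \<iota> i g v \<Longrightarrow> has_partial i g (partial \<iota> i g v) v"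
  unfolding has_partial_def pdiff_def partial_def by (rule sdiffD)

lemma has_partial_const: "has_partial i (\<lambda>_. c) 0 v"
  by (simp add: has_partial_def sderiv_const)

lemma has_partial_add:
  "has_partial i f D v \<Longrightarrow> has_partial i g E v \<Longrightarrow> has_partial i (\<lambda>w. f w + g w) (D + E) v"
  unfolding has_partial_def by (rule sderiv_add)

lemma has_partial_mult:
  "has_partial i f D v \<Longrightarrow> has_partial i g E v \<Longrightarrow> has_partial i (\<lambda>w. f w * g w) (D * g v + f v * E) v"
  unfolding has_partial_def by (drule (1) sderiv_mult) (simp add: axis_def zero_vec_def[symmetric])

lemma continuous_axis: "continuous_on UNIV (\<lambda>t. v + axis i t :: 'k point)"
  unfolding axis_def
proof (intro continuous_on_add continuous_on_const continuous_on_vec_lambda)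
  fix j
  show "continuous_on UNIV (\<lambda>t. if j = i then t else 0)" by (cases "j = i") simp_all
qed

lemma has_partial_cong:
  assumes "has_partial i g D v" "v \<in> U" "\<And>w. w \<in> U \<Longrightarrow> g w = h w"
  shows "has_partial i h D v"
  unfolding has_partial_def
proof (rule sderiv_cong)
  show "has_sderiv \<iota> (\<lambda>t. g (v + axis i t)) D 0" using assms(1) by (simp add: has_partial_def)
  show "open ((\<lambda>t. v + axis i t) -` U)"
    using continuous_axis open_U by (rule open_vimage[rotated])
  show "0 \<in> (\<lambda>t. v + axis i t) -` U"
    using assms(2) by (simp add: axis_def zero_vec_def[symmetric])
qed (use assms(3) in auto)

text \<open>No differentiability is assumed: the predicates under \<open>THE\<close> coincide, hence
  so do their values, specified or not.\<close>

lemma partial_cong: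
  assumes "v \<in> U" "\<And>w. w \<in> U \<Longrightarrow> g w = h w"
  shows "partial \<iota> i g v = partial \<iota> i h v"
proof -
  have "has_partial i g D v \<longleftrightarrow> has_partial i h D v" for D
    using has_partial_cong[of i g D v h] has_partial_cong[of i h D v g] assms by auto
  then show ?thesis
    unfolding partial_def sderiv_def has_partial_def by presburger
qed

lemma has_partial_coord: "has_partial i (\<lambda>v. \<iota> (v $ j)) (if i = j then 1 else 0) v"
proof (cases "i = j")
  case True
  interpret bounded_linear \<iota> by (rule embedding_bounded_linear)
  have "(\<lambda>t. \<iota> ((v + axis i t) $ j)) = (\<lambda>t. \<iota> (v $ j) + \<iota> t)"
    using True by (simp add: add)
  moreover have "((\<lambda>t. \<iota> (v $ j) + \<iota> t) has_derivative (\<lambda>t. 0 + \<iota> t)) (at 0)"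
    by (rule has_derivative_add[OF has_derivative_const]) (rule bounded_linear_imp_has_derivative[OF embedding_bounded_linear])
  ultimately show ?thesis using True by (simp add: has_partial_def has_sderiv_def)
next
  case False
  then have "(\<lambda>t. \<iota> ((v + axis i t) $ j)) = (\<lambda>t. \<iota> (v $ j))" by (simp add: axis_def)
  then show ?thesis using False by (simp add: has_partial_def sderiv_const)
qed

lemma has_partial_x:
  assumes "has_sderiv \<iota> g D (v $ Xc)"
  shows "has_partial i (\<lambda>v. g (v $ Xc)) (if i = Xc then D else 0) v"
proof (cases "i = Xc")
  case True
  have "((\<lambda>t. v $ Xc + t) has_derivative (\<lambda>t. t)) (at 0)"
    by (auto intro!: derivative_eq_intros)
  from has_derivative_compose[OF this, of g "\<lambda>h. \<iota> h * D"] assms True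
  show ?thesis by (simp add: has_partial_def has_sderiv_def)
next
  case False
  then have "(\<lambda>t. g ((v + axis i t) $ Xc)) = (\<lambda>t. g (v $ Xc))" by (simp add: axis_def)
  then show ?thesis using False by (simp add: has_partial_def sderiv_const)
qed

definition dird :: "'f ^ coord \<Rightarrow> ('k point \<Rightarrow> 'f) \<Rightarrow> 'k point \<Rightarrow> 'f" where
  "dird u g v = (\<Sum>i\<in>UNIV. u $ i * partial \<iota> i g v)"

text \<open>Only partial derivatives are required, as in \<open>Ck\<close>, not total
  differentiability. Sum and product rules are inherited from the partial ones, and linearity in
  \<open>u\<close> is built in.\<close>

definition has_dird :: "'f ^ coord \<Rightarrow> ('k point \<Rightarrow> 'f) \<Rightarrow> 'f \<Rightarrow> 'k point \<Rightarrow> bool" where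
  "has_dird u g D v \<longleftrightarrow> (\<forall>i. pdiff \<iota> i g v) \<and> dird u g v = D"

lemma hdI: "(\<And>i. has_partial i g (d i) v) \<Longrightarrow> D = (\<Sum>i\<in>UNIV. u $ i * d i) \<Longrightarrow> has_dird u g D v"
  unfolding has_dird_def dird_def using has_partial_pdiff partial_eq by (metis (no_types, lifting) sum.cong)

lemma has_dird_dird: "has_dird u g D v \<Longrightarrow> dird u g v = D"
  by (simp add: has_dird_def)

lemma has_dird_partial: "has_dird u g D v \<Longrightarrow> has_partial i g (partial \<iota> i g v) v"
  unfolding has_dird_def using pdiffD by blast

lemma has_dird_const: "has_dird u (\<lambda>_. c) 0 v"
  by (rule hdI[OF has_partial_const]) simp

lemma has_dird_add: "has_dird u f D v \<Longrightarrow> has_dird u g E v \<Longrightarrow> has_dird u (\<lambda>w. f w + g w) (D + E) v"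
  by (rule hdI[OF has_partial_add[OF has_dird_partial has_dird_partial]], assumption, assumption)
    (auto simp: has_dird_def dird_def sum.distrib distrib_left)

lemma has_dird_mult: "has_dird u f D v \<Longrightarrow> has_dird u g E v \<Longrightarrow> has_dird u (\<lambda>w. f w * g w) (D * g v + f v * E) v"
  by (rule hdI[OF has_partial_mult[OF has_dird_partial has_dird_partial]], assumption, assumption)
    (auto simp: has_dird_def dird_def sum.distrib algebra_simps sum_distrib_left sum_distrib_right)

lemma has_dird_coord: "has_dird u (\<lambda>v. \<iota> (v $ j)) (u $ j) v"
  by (rule hdI[OF has_partial_coord]) (simp add: sum.delta if_distrib cong: if_cong)

lemma has_dird_x: "has_sderiv \<iota> g D (v $ Xc) \<Longrightarrow> has_dird u (\<lambda>v. g (v $ Xc)) (u $ Xc * D) v"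
  by (rule hdI[OF has_partial_x], assumption) (simp add: sum.delta if_distrib cong: if_cong)

lemma has_dird_cong: "has_dird u g D v \<Longrightarrow> v \<in> U \<Longrightarrow> (\<And>w. w \<in> U \<Longrightarrow> g w = h w) \<Longrightarrow> has_dird u h D v"
  using has_partial_cong[of _ g _ v h] partial_cong[of v g h] has_partial_pdiff pdiffD
  unfolding has_dird_def dird_def by (metis (no_types, lifting) sum.cong)

lemma has_dird_cmult: "has_dird u f D v \<Longrightarrow> has_dird u (\<lambda>w. c * f w) (c * D) v"
  using has_dird_mult[OF has_dird_const] by simp

lemma has_dird_uminus: "has_dird u f D v \<Longrightarrow> has_dird u (\<lambda>w. - f w) (- D) v"
  using has_dird_cmult[of u f D v "- 1"] by simp

lemma has_dird_diff: "has_dird u f D v \<Longrightarrow> has_dird u g E v \<Longrightarrow> has_dird u (\<lambda>w. f w - g w) (D - E) v"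
  using has_dird_add[OF _ has_dird_uminus] by fastforce

lemma has_dird_power2: "has_dird u f D v \<Longrightarrow> has_dird u (\<lambda>w. (f w)^2) (2 * f v * D) v"
  using has_dird_mult[of u f D v f D] by (simp add: power2_eq_square algebra_simps)

lemma has_dird_eq: "has_dird u f D v \<Longrightarrow> D = E \<Longrightarrow> has_dird u f E v"
  by simp

lemma has_dird_sum:
  "finite J \<Longrightarrow> (\<And>j. j \<in> J \<Longrightarrow> has_dird u (f j) (D j) v) \<Longrightarrow> has_dird u (\<lambda>w. \<Sum>j\<in>J. f j w) (\<Sum>j\<in>J. D j) v"
  by (induction J rule: finite_induct) (auto intro: has_dird_const has_dird_add)

lemmas has_dird_intros = has_dird_const has_dird_uminus has_dird_add has_dird_diff has_dird_power2 has_dird_mult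

lemma dird_add: "dird (u + u') g v = dird u g v + dird u' g v"
  by (simp add: dird_def distrib_right sum.distrib)

lemma dird_scale: "dird (c *s u) g v = c * dird u g v"
  by (simp add: dird_def sum_distrib_left mult.assoc)

lemma lie_bracket_nth:
  "v \<in> U \<Longrightarrow> lie_bracket \<iota> U V W v $ i = dird (V v) (\<lambda>w. W w $ i) v - dird (W v) (\<lambda>w. V w $ i) v"
  by (simp add: lie_bracket_def on_dom_def dird_def sum_subtractf)

end

text \<open>The algebra generated over the scalars by the coordinates and a set \<open>G\<close> of functions of \<open>x\<close>.
  Commutation of second partial derivatives is inherited from the generators, so no analysis of
  mixed derivatives is needed.\<close>

locale coefficient_algebra = scalar_domain \<iota> U
  for \<iota> :: "'k::real_normed_field \<Rightarrow> 'f::real_normed_field" and U :: "'k point set" +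
  fixes G :: "('k \<Rightarrow> 'f) set"
begin

inductive_set alg :: "('k point \<Rightarrow> 'f) set" where
  gen: "g \<in> G \<Longrightarrow> (\<lambda>v. g (v $ Xc)) \<in> alg"
| coord: "(\<lambda>v. \<iota> (v $ i)) \<in> alg"
| const: "(\<lambda>_. c) \<in> alg"
| add: "f \<in> alg \<Longrightarrow> g \<in> alg \<Longrightarrow> (\<lambda>v. f v + g v) \<in> alg"
| mult: "f \<in> alg \<Longrightarrow> g \<in> alg \<Longrightarrow> (\<lambda>v. f v * g v) \<in> alg"
| eq_on: "f \<in> alg \<Longrightarrow> (\<And>v. v \<in> U \<Longrightarrow> f v = g v) \<Longrightarrow> g \<in> alg"

lemma alg_uminus: "f \<in> alg \<Longrightarrow> (\<lambda>v. - f v) \<in> alg"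
  using alg.mult[OF alg.const[of "- 1"]] by simp

lemma alg_diff: "f \<in> alg \<Longrightarrow> g \<in> alg \<Longrightarrow> (\<lambda>v. f v - g v) \<in> alg"
  using alg.add[OF _ alg_uminus] by fastforce

lemma alg_power: "f \<in> alg \<Longrightarrow> (\<lambda>v. f v ^ n) \<in> alg"
  by (induction n) (auto intro: alg.const alg.mult)

lemma alg_cdivide: "f \<in> alg \<Longrightarrow> (\<lambda>v. f v / c) \<in> alg"
  using alg.mult[OF _ alg.const[of "inverse c"]] by (simp add: divide_inverse)

lemma alg_sum: "finite J \<Longrightarrow> (\<And>j. j \<in> J \<Longrightarrow> f j \<in> alg) \<Longrightarrow> (\<lambda>v. \<Sum>j\<in>J. f j v) \<in> alg"
  by (induction J rule: finite_induct) (auto intro: alg.const alg.add)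

lemmas alg_intros = alg_uminus alg_diff alg_power alg_cdivide alg.const alg.add alg.mult alg.coord

end

locale differential_algebra = coefficient_algebra \<iota> U G
  for \<iota> :: "'k::real_normed_field \<Rightarrow> 'f::real_normed_field" and U :: "'k point set"
    and G :: "('k \<Rightarrow> 'f) set" +
  assumes G_deriv: "g \<in> G \<Longrightarrow>
    \<exists>g'. (\<lambda>v. g' (v $ Xc)) \<in> alg \<and> (\<forall>v\<in>U. has_sderiv \<iota> g (g' (v $ Xc)) (v $ Xc))"
begin

lemma alg_partial_ex: "g \<in> alg \<Longrightarrow> \<exists>h\<in>alg. \<forall>v\<in>U. has_partial i g (h v) v"
proof (induction rule: alg.induct)
  case (gen g)
  then obtain g' where g': "(\<lambda>v. g' (v $ Xc)) \<in> alg" "\<forall>v\<in>U. has_sderiv \<iota> g (g' (v $ Xc)) (v $ Xc)"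
    using G_deriv by blast
  show ?case
  proof (cases "i = Xc")
    case True
    then show ?thesis using g' has_partial_x[of g _ _ i] by (intro bexI[OF _ g'(1)]) auto
  next
    case False
    then show ?thesis using g' has_partial_x[of g _ _ i] by (intro bexI[OF _ alg.const[of 0]]) auto
  qed
next
  case (coord j)
  show ?case using has_partial_coord alg.const by fast
next
  case (const c)
  show ?case using has_partial_const alg.const by fast
next
  case (add f g)
  then show ?case using has_partial_add alg.add by (metis (no_types, lifting))
next
  case (mult f g)
  then obtain f' g' where "f' \<in> alg" "g' \<in> alg"
    "\<forall>v\<in>U. has_partial i f (f' v) v" "\<forall>v\<in>U. has_partial i g (g' v) v" by blast
  then show ?case
    using mult.hyps by (intro bexI[of _ "\<lambda>v. f' v * g v + f v * g' v"] ballI has_partial_mult alg.add alg.mult) auto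
next
  case (eq_on f g)
  then show ?case using has_partial_cong by metis
qed

lemma alg_has_partial: "g \<in> alg \<Longrightarrow> v \<in> U \<Longrightarrow> has_partial i g (partial \<iota> i g v) v"
  using alg_partial_ex partial_eq by metis

text \<open>An element of \<open>alg\<close> is known to agree with the derivative only on
  \<open>U\<close>; values elsewhere are arbitrary, which is what the rule \<open>eq_on\<close> of
  \<open>alg\<close> absorbs.\<close>

lemma alg_partial: "g \<in> alg \<Longrightarrow> partial \<iota> i g \<in> alg"
  using alg_partial_ex[of g i] partial_eq alg.eq_on by metis

lemma alg_hd: "g \<in> alg \<Longrightarrow> v \<in> U \<Longrightarrow> has_dird u g (dird u g v) v"
  using alg_has_partial has_partial_pdiff by (simp add: has_dird_def) blast

lemma alg_continuous: "g \<in> alg \<Longrightarrow> continuous_on U g"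
proof (induction rule: alg.induct)
  case (gen g)
  show ?case
  proof (rule continuous_at_imp_continuous_on, rule ballI)
    fix v assume "v \<in> U"
    then have "isCont g (v $ Xc)" using G_deriv[OF gen] sderiv_continuous by blast
    then show "isCont (\<lambda>v. g (v $ Xc)) v"
      by (rule isCont_o2[rotated]) (intro continuous_intros)
  qed
next
  case (coord i)
  have "continuous_on UNIV \<iota>" using embedding_bounded_linear by (rule linear_continuous_on)
  then show ?case by (rule continuous_on_compose2) (auto intro: continuous_intros)
next
  case (eq_on f g)
  then show ?case using continuous_on_cong by metis
qed (auto intro: continuous_intros)

lemma alg_Ck: "g \<in> alg \<Longrightarrow> Ck \<iota> n U g"
  by (induction n arbitrary: g) (auto simp: alg_continuous intro: alg_partial has_partial_pdiff[OF alg_has_partial])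

lemma alg_partial_commute: "g \<in> alg \<Longrightarrow> v \<in> U \<Longrightarrow>
  partial \<iota> i (partial \<iota> j g) v = partial \<iota> j (partial \<iota> i g) v"
proof (induction arbitrary: v rule: alg.induct)
  case (gen g)
  then obtain g' where g': "(\<lambda>v. g' (v $ Xc)) \<in> alg" "\<And>v. v \<in> U \<Longrightarrow> has_sderiv \<iota> g (g' (v $ Xc)) (v $ Xc)"
    using G_deriv by blast
  have 1: "partial \<iota> i (partial \<iota> j (\<lambda>v. g (v $ Xc))) v =
      partial \<iota> i (\<lambda>v. if j = Xc then g' (v $ Xc) else 0) v" for i j
    using gen.prems g'(2) by (intro partial_cong partial_eq has_partial_x)
  \<comment> \<open>For a function of \<open>x\<close> alone and distinct indices, at least one
    differentiation is not in \<open>x\<close>, so both mixed derivatives vanish.\<close>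
  have 2: "partial \<iota> i (\<lambda>v. if j = Xc then g' (v $ Xc) else 0) v = 0" if "i \<noteq> j" for i j
  proof (cases "j = Xc")
    case True
    then have "(\<lambda>t. g' ((v + axis i t) $ Xc)) = (\<lambda>t. g' (v $ Xc))" using that by (simp add: axis_def)
    then have "has_partial i (\<lambda>v. g' (v $ Xc)) 0 v" by (simp add: has_partial_def sderiv_const)
    then show ?thesis using True partial_eq by simp
  qed (simp add: partial_eq[OF has_partial_const])
  show ?case using 1 2 by (cases "i = j") simp_all
next
  case (coord k)
  have "partial \<iota> i (partial \<iota> j (\<lambda>v. \<iota> (v $ k))) v = 0" for i j
  proof -
    have "partial \<iota> j (\<lambda>v. \<iota> (v $ k)) = (\<lambda>_. if j = k then 1 else 0)"
      using partial_eq[OF has_partial_coord] by blast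
    then show ?thesis by (simp add: partial_eq[OF has_partial_const])
  qed
  then show ?case by simp
next
  case (const c)
  have "partial \<iota> i (partial \<iota> j (\<lambda>v. c)) v = 0" for i j
  proof -
    have "partial \<iota> j (\<lambda>v :: 'k point. c) = (\<lambda>_. 0)"
      using partial_eq[OF has_partial_const] by blast
    then show ?thesis by (simp add: partial_eq[OF has_partial_const])
  qed
  then show ?case by simp
next
  case (add f g)
  have "partial \<iota> i (partial \<iota> j (\<lambda>v. f v + g v)) v =
    partial \<iota> i (partial \<iota> j f) v + partial \<iota> i (partial \<iota> j g) v" for i j
  proof -
    have "partial \<iota> i (partial \<iota> j (\<lambda>v. f v + g v)) v =
        partial \<iota> i (\<lambda>v. partial \<iota> j f v + partial \<iota> j g v) v"
      using add by (intro partial_cong partial_eq has_partial_add alg_has_partial)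
    then show ?thesis
      using add by (simp add: partial_eq[OF has_partial_add[OF alg_has_partial alg_has_partial]] alg_partial)
  qed
  then show ?case using add by simp
next
  case (mult f g)
  have "partial \<iota> i (partial \<iota> j (\<lambda>v. f v * g v)) v =
    partial \<iota> i (partial \<iota> j f) v * g v + partial \<iota> j f v * partial \<iota> i g v +
    (partial \<iota> i f v * partial \<iota> j g v + f v * partial \<iota> i (partial \<iota> j g) v)" for i j
  proof -
    have "partial \<iota> i (partial \<iota> j (\<lambda>v. f v * g v)) v =
        partial \<iota> i (\<lambda>v. partial \<iota> j f v * g v + f v * partial \<iota> j g v) v"
      using mult by (intro partial_cong partial_eq has_partial_mult alg_has_partial)
    also have "\<dots> = partial \<iota> i (partial \<iota> j f) v * g v + partial \<iota> j f v * partial \<iota> i g v +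
      (partial \<iota> i f v * partial \<iota> j g v + f v * partial \<iota> i (partial \<iota> j g) v)"
      using mult by (intro partial_eq has_partial_add has_partial_mult alg_has_partial alg_partial)
    finally show ?thesis .
  qed
  then show ?case using mult by simp
next
  case (eq_on f g)
  have "partial \<iota> i (partial \<iota> j g) v = partial \<iota> i (partial \<iota> j f) v" for i j
    using eq_on by (intro partial_cong) auto
  then show ?case using eq_on by simp
qed

definition alg_field :: "('k, 'f) vfield \<Rightarrow> bool" where
  "alg_field V \<longleftrightarrow> (\<forall>i. (\<lambda>v. V v $ i) \<in> alg)"

lemma alg_field_smooth: "alg_field V \<Longrightarrow> smooth_field \<iota> U V"
  by (simp add: alg_field_def smooth_field_def alg_Ck)

lemma alg_dird: "alg_field V \<Longrightarrow> g \<in> alg \<Longrightarrow> (\<lambda>v. dird (V v) g v) \<in> alg"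
  unfolding dird_def alg_field_def by (auto intro!: alg_sum alg.mult alg_partial)

lemma alg_field_on_dom: "alg_field V \<Longrightarrow> alg_field (on_dom U V)"
  unfolding alg_field_def by (auto simp: on_dom_def intro: alg.eq_on)

lemma alg_field_lie_bracket:
  assumes "alg_field V" "alg_field W"
  shows "alg_field (lie_bracket \<iota> U V W)"
  unfolding alg_field_def
proof
  fix i
  have "(\<lambda>v. dird (V v) (\<lambda>w. W w $ i) v - dird (W v) (\<lambda>w. V w $ i) v) \<in> alg"
    using assms by (intro alg_diff alg_dird) (auto simp: alg_field_def)
  then show "(\<lambda>v. lie_bracket \<iota> U V W v $ i) \<in> alg"
    by (rule alg.eq_on) (simp add: lie_bracket_nth)
qed

text \<open>On \<open>alg\<close> the fields act as derivations and the bracket is their commutator: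
  the second-order terms of the two compositions agree because partial derivatives commute on
  \<open>alg\<close>. This allows brackets to be computed on the entries of a chart instead of in
  the coordinates.\<close>

lemma dird_lie_bracket:
  assumes V: "alg_field V" and W: "alg_field W" and g: "g \<in> alg" and v: "v \<in> U"
  shows "dird (lie_bracket \<iota> U V W v) g v =
    dird (V v) (\<lambda>w. dird (W w) g w) v - dird (W v) (\<lambda>w. dird (V w) g w) v"
proof -
  have *: "dird (V v) (\<lambda>w. dird (W w) g w) v =
      (\<Sum>i\<in>UNIV. dird (V v) (\<lambda>w. W w $ i) v * partial \<iota> i g v) +
      (\<Sum>j\<in>UNIV. \<Sum>i\<in>UNIV. V v $ j * W v $ i * partial \<iota> j (partial \<iota> i g) v)"
    if "alg_field V" "alg_field W" for V W
  proof -
    have "has_dird (V v) (\<lambda>w. \<Sum>i\<in>UNIV. W w $ i * partial \<iota> i g w)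
      (\<Sum>i\<in>UNIV. dird (V v) (\<lambda>w. W w $ i) v * partial \<iota> i g v + W v $ i * dird (V v) (partial \<iota> i g) v) v"
      using that g v by (intro has_dird_sum has_dird_mult alg_hd alg_partial) (auto simp: alg_field_def)
    then have "dird (V v) (\<lambda>w. dird (W w) g w) v =
        (\<Sum>i\<in>UNIV. dird (V v) (\<lambda>w. W w $ i) v * partial \<iota> i g v + W v $ i * dird (V v) (partial \<iota> i g) v)"
      by (simp add: has_dird_dird dird_def[of "W _"])
    also have "\<dots> = (\<Sum>i\<in>UNIV. dird (V v) (\<lambda>w. W w $ i) v * partial \<iota> i g v) +
        (\<Sum>i\<in>UNIV. \<Sum>j\<in>UNIV. V v $ j * W v $ i * partial \<iota> j (partial \<iota> i g) v)"
      by (simp add: sum.distrib dird_def[of _ "partial _ _ _"] sum_distrib_left mult.left_commute mult.assoc)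
    finally show ?thesis by (subst sum.swap)
  qed
  have "(\<Sum>j\<in>UNIV. \<Sum>i\<in>UNIV. V v $ j * W v $ i * partial \<iota> j (partial \<iota> i g) v) =
      (\<Sum>j\<in>UNIV. \<Sum>i\<in>UNIV. W v $ j * V v $ i * partial \<iota> j (partial \<iota> i g) v)"
    by (subst sum.swap) (simp add: alg_partial_commute[OF g v] mult.commute)
  then show ?thesis
    unfolding *[OF V W] *[OF W V]
    by (simp add: dird_def[of "lie_bracket _ _ _ _ _"] lie_bracket_nth[OF v] algebra_simps sum_subtractf)
qed

end

section \<open>The projective action in a chart\<close>

lemma zorn_scale_eq:
  "zorn_scale c x = (c * fst x, c *s fst (snd x), c *s fst (snd (snd x)), c * snd (snd (snd x)))"
  by (cases x) simp

lemma g2_der_eq: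
  "g2_der A k m x =
     (- dot3 k (fst (snd (snd x))) - dot3 m (fst (snd x)),
      A *v fst (snd x) + (fst x - snd (snd (snd x))) *s k + crossp3 m (fst (snd (snd x))),
      - (transpose A *v fst (snd (snd x))) + (fst x - snd (snd (snd x))) *s m + crossp3 k (fst (snd x)),
      dot3 k (fst (snd (snd x))) + dot3 m (fst (snd x)))"
  by (cases x) (simp add: g2_der_def)

context scalar_domain
begin

definition has_dirz :: "'f ^ coord \<Rightarrow> ('k point \<Rightarrow> 'f zorn) \<Rightarrow> 'f zorn \<Rightarrow> 'k point \<Rightarrow> bool" where
  "has_dirz u Z D v \<longleftrightarrow>
     has_dird u (\<lambda>w. fst (Z w)) (fst D) v \<and>
     (\<forall>i. has_dird u (\<lambda>w. fst (snd (Z w)) $ i) (fst (snd D) $ i) v) \<and>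
     (\<forall>i. has_dird u (\<lambda>w. fst (snd (snd (Z w))) $ i) (fst (snd (snd D)) $ i) v) \<and>
     has_dird u (\<lambda>w. snd (snd (snd (Z w)))) (snd (snd (snd D))) v"

lemma has_dird_unique: "has_dird u g D v \<Longrightarrow> has_dird u g E v \<Longrightarrow> D = E"
  by (simp add: has_dird_def)

lemma has_dirz_unique: "has_dirz u Z D v \<Longrightarrow> has_dirz u Z E v \<Longrightarrow> D = E"
  unfolding has_dirz_def prod_eq_iff vec_eq_iff by (blast intro: has_dird_unique)

lemma has_dirz_der:
  assumes "has_dirz u Z D v"
  shows "has_dirz u (\<lambda>w. g2_der A k m (Z w)) (g2_der A k m D) v"
  unfolding has_dirz_def g2_der_eq fst_conv snd_conv forall_3 dot3_def crossp3_def sum_3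
    matrix_vector_mult_def transpose_def vec_lambda_beta vector_add_component vector_minus_component
    vector_uminus_component vector_smult_component vector_3
  using assms unfolding has_dirz_def forall_3
  by (elim conjE, intro conjI)
    (rule has_dird_eq, (rule has_dird_const | assumption | rule has_dird_intros)+, simp)+

lemma has_dirz_scale:
  assumes "has_dird u f F v" "has_dirz u Z D v"
  shows "has_dirz u (\<lambda>w. zorn_scale (f w) (Z w)) (zorn_scale F (Z v) + zorn_scale (f v) D) v"
  using assms unfolding has_dirz_def zorn_scale_eq by (auto intro!: has_dird_mult)

lemma has_dirz_diff: "has_dirz u Z D v \<Longrightarrow> has_dirz u Z' D' v \<Longrightarrow> has_dirz u (\<lambda>w. Z w - Z' w) (D - D') v"
  unfolding has_dirz_def by (auto intro!: has_dird_diff)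

lemma has_dirz_cong:
  assumes "has_dirz u Z D v" "v \<in> U" "\<And>w. w \<in> U \<Longrightarrow> Z w = Z' w"
  shows "has_dirz u Z' D v"
  unfolding has_dirz_def
  by (intro conjI allI)
    (rule has_dird_cong[OF _ assms(2)], use assms(1)[unfolded has_dirz_def] in blast, simp add: assms(3))+

lemma has_dird_add_left: "has_dird u g D v \<Longrightarrow> has_dird u' g D' v \<Longrightarrow> has_dird (u + u') g (D + D') v"
  by (auto simp: has_dird_def dird_add)

lemma has_dird_scale_left: "has_dird u g D v \<Longrightarrow> has_dird (c *s u) g (c * D) v"
  by (auto simp: has_dird_def dird_scale)

lemma has_dirz_add_left: "has_dirz u Z D v \<Longrightarrow> has_dirz u' Z D' v \<Longrightarrow> has_dirz (u + u') Z (D + D') v"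
  unfolding has_dirz_def by (auto intro!: has_dird_add_left)

lemma has_dirz_scale_left: "has_dirz u Z D v \<Longrightarrow> has_dirz (c *s u) Z (zorn_scale c D) v"
  unfolding has_dirz_def zorn_scale_eq by (auto intro!: has_dird_scale_left)

end

definition \<tau> :: "'f zorn \<Rightarrow> 'f" where
  "\<tau> x = fst (snd x) $ 1"

locale zorn_chart = differential_algebra \<iota> U G
  for \<iota> :: "'k::real_normed_field \<Rightarrow> 'f::real_normed_field" and U :: "'k point set"
    and G :: "('k \<Rightarrow> 'f) set" +
  fixes W :: "'k point \<Rightarrow> 'f zorn"
  assumes W_alg: "(\<lambda>v. fst (W v)) \<in> alg" "(\<lambda>v. fst (snd (W v)) $ i) \<in> alg"
      "(\<lambda>v. fst (snd (snd (W v))) $ i) \<in> alg" "(\<lambda>v. snd (snd (snd (W v)))) \<in> alg"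
    and immersion: "v \<in> U \<Longrightarrow> has_dirz u W 0 v \<Longrightarrow> u = 0"
begin

definition dirz :: "'f ^ coord \<Rightarrow> 'k point \<Rightarrow> 'f zorn" where
  "dirz u v = (dird u (\<lambda>w. fst (W w)) v, \<chi> i. dird u (\<lambda>w. fst (snd (W w)) $ i) v,
     \<chi> i. dird u (\<lambda>w. fst (snd (snd (W w))) $ i) v, dird u (\<lambda>w. snd (snd (snd (W w)))) v)"

lemma has_dirz_dirz: "v \<in> U \<Longrightarrow> has_dirz u W (dirz u v) v"
  unfolding has_dirz_def dirz_def by (simp add: alg_hd W_alg)

text \<open>The field moves the line through \<open>W\<close> by \<open>- D\<close>; the first summand preserves the normalisation
  \<open>\<tau> W = 1\<close>.  The sign makes \<open>D \<mapsto> V\<close> a homomorphism rather than an antihomomorphism.\<close>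

definition realizes :: "('k, 'f) vfield \<Rightarrow> ('f zorn \<Rightarrow> 'f zorn) \<Rightarrow> bool" where
  "realizes V D \<longleftrightarrow> D \<in> split_g2 \<and> alg_field V \<and> (\<forall>v. v \<notin> U \<longrightarrow> V v = 0) \<and>
     (\<forall>v\<in>U. has_dirz (V v) W (zorn_scale (\<tau> (D (W v))) (W v) - D (W v)) v)"

lemma realizes_unique:
  assumes "realizes V D" "realizes V' D"
  shows "V = V'"
proof
  fix v
  show "V v = V' v"
  proof (cases "v \<in> U")
    case True
    then have "has_dirz (V v + (- 1) *s V' v) W
        (zorn_scale (\<tau> (D (W v))) (W v) - D (W v) +
         zorn_scale (- 1) (zorn_scale (\<tau> (D (W v))) (W v) - D (W v))) v"
      using assms by (intro has_dirz_add_left has_dirz_scale_left) (auto simp: realizes_def)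
    also have "zorn_scale (\<tau> (D (W v))) (W v) - D (W v) +
         zorn_scale (- 1) (zorn_scale (\<tau> (D (W v))) (W v) - D (W v)) = 0"
      by (simp add: zorn_scale_eq prod_eq_iff vec_eq_iff)
    finally have "V v + (- 1) *s V' v = 0" by (rule immersion[OF True])
    then show ?thesis by (simp add: vec_eq_iff)
  qed (use assms in \<open>simp add: realizes_def\<close>)
qed

lemma realizes_add:
  assumes "realizes V D" "realizes V' D'"
  shows "realizes (V + V') (D + D')"
proof -
  have "alg_field (V + V')"
    using assms by (auto simp: realizes_def alg_field_def intro: alg.add)
  moreover have "has_dirz (V v + V' v) W (zorn_scale (\<tau> (D (W v) + D' (W v))) (W v) - (D (W v) + D' (W v))) v"
    if "v \<in> U" for v
  proof -
    have "has_dirz (V v + V' v) W (zorn_scale (\<tau> (D (W v))) (W v) - D (W v) +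
         (zorn_scale (\<tau> (D' (W v))) (W v) - D' (W v))) v"
      using assms that by (intro has_dirz_add_left) (auto simp: realizes_def)
    also have "zorn_scale (\<tau> (D (W v))) (W v) - D (W v) + (zorn_scale (\<tau> (D' (W v))) (W v) - D' (W v)) =
      zorn_scale (\<tau> (D (W v) + D' (W v))) (W v) - (D (W v) + D' (W v))"
      by (simp add: \<tau>_def zorn_scale_eq prod_eq_iff vec_eq_iff algebra_simps)
    finally show ?thesis .
  qed
  ultimately show ?thesis
    using assms by (simp add: realizes_def split_g2_add)
qed

lemma realizes_scale:
  assumes "realizes V D"
  shows "realizes (vf_scale c V) (g2_scale c D)"
proof -
  have "alg_field (vf_scale c V)"
    using assms by (auto simp: realizes_def alg_field_def vf_scale_def intro: alg.mult alg.const)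
  moreover have "has_dirz (c *s V v) W (zorn_scale (\<tau> (zorn_scale c (D (W v)))) (W v) - zorn_scale c (D (W v))) v"
    if "v \<in> U" for v
  proof -
    have "has_dirz (c *s V v) W (zorn_scale c (zorn_scale (\<tau> (D (W v))) (W v) - D (W v))) v"
      using assms that by (intro has_dirz_scale_left) (auto simp: realizes_def)
    also have "zorn_scale c (zorn_scale (\<tau> (D (W v))) (W v) - D (W v)) =
      zorn_scale (\<tau> (zorn_scale c (D (W v)))) (W v) - zorn_scale c (D (W v))"
      by (simp add: \<tau>_def zorn_scale_eq prod_eq_iff vec_eq_iff algebra_simps)
    finally show ?thesis .
  qed
  ultimately show ?thesis
    using assms split_g2_scale[of D c] by (simp add: realizes_def vf_scale_def g2_scale_def)
qed

text \<open>Differentiating \<open>\<tau> (D' W) W - D' W\<close> along \<open>V\<close> by the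
  product rule, every term containing the factor \<open>\<tau> (D W)\<close> or
  \<open>\<tau> (D' W)\<close> is symmetric under exchange of the two derivations or belongs to a
  symmetric pair. The commutator therefore keeps only \<open>D (D' W)\<close> and
  \<open>D' (D W)\<close>, each with its normalising multiple of \<open>W\<close>.\<close>

lemma realizes_bracket:
  assumes V: "realizes V D" and V': "realizes V' D'"
  shows "realizes (lie_bracket \<iota> U V V') (g2_bracket D D')"
proof -
  have alg: "alg_field V" "alg_field V'" using V V' by (auto simp: realizes_def)
  have twice: "has_dirz (V v) (\<lambda>w. dirz (V' w) w)
      (zorn_scale (\<tau> (D' X)) (W v) + zorn_scale (\<tau> (D' (W v))) X - D' X) v"
    if V: "realizes V D" and V': "realizes V' D'" and v: "v \<in> U"
      and X: "X = zorn_scale (\<tau> (D (W v))) (W v) - D (W v)" for V V' D D' v X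
  proof -
    obtain A k m where D': "D' = g2_der A k m"
      using V' by (auto simp: realizes_def elim: split_g2_cases)
    have 1: "has_dirz (V v) W X v" using V v X by (simp add: realizes_def)
    from has_dirz_der[OF 1] have 2: "has_dirz (V v) (\<lambda>w. D' (W w)) (D' X) v" unfolding D' .
    then have 3: "has_dird (V v) (\<lambda>w. \<tau> (D' (W w))) (\<tau> (D' X)) v"
      by (simp add: has_dirz_def \<tau>_def)
    \<comment> \<open>The derivative of \<open>W\<close> along \<open>V'\<close> is known at every
      point of \<open>U\<close>, so it may be differentiated again in the form given by
      \<open>D'\<close>.\<close>
    show ?thesis
    proof (rule has_dirz_cong[OF has_dirz_diff[OF has_dirz_scale[OF 3 1] 2] v])
      fix w assume w: "w \<in> U"
      then have "has_dirz (V' w) W (zorn_scale (\<tau> (D' (W w))) (W w) - D' (W w)) w"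
        using V' by (simp add: realizes_def)
      from has_dirz_unique[OF this has_dirz_dirz[OF w]]
      show "zorn_scale (\<tau> (D' (W w))) (W w) - D' (W w) = dirz (V' w) w" .
    qed
  qed
  have "has_dirz (lie_bracket \<iota> U V V' v) W
      (zorn_scale (\<tau> (g2_bracket D D' (W v))) (W v) - g2_bracket D D' (W v)) v" if v: "v \<in> U" for v
  proof -
    define X where "X = zorn_scale (\<tau> (D (W v))) (W v) - D (W v)"
    define X' where "X' = zorn_scale (\<tau> (D' (W v))) (W v) - D' (W v)"
    have eq: "dirz (lie_bracket \<iota> U V V' v) v =
      (zorn_scale (\<tau> (D' X)) (W v) + zorn_scale (\<tau> (D' (W v))) X - D' X) -
      (zorn_scale (\<tau> (D X')) (W v) + zorn_scale (\<tau> (D (W v))) X' - D X')"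
      using twice[OF V V' v X_def] twice[OF V' V v X'_def]
      unfolding has_dirz_def has_dird_def by (simp add: dirz_def prod_eq_iff vec_eq_iff dird_lie_bracket[OF alg W_alg(1) v]
        dird_lie_bracket[OF alg W_alg(2) v] dird_lie_bracket[OF alg W_alg(3) v]
        dird_lie_bracket[OF alg W_alg(4) v])
    have lin: "E (zorn_scale c x - y) = zorn_scale c (E x) - E y" if E: "E \<in> split_g2"
      for E :: "'f zorn \<Rightarrow> 'f zorn" and c x y
    proof -
      have "E (zorn_scale c x - y + y) = E (zorn_scale c x - y) + E y"
        "E (zorn_scale c x) = zorn_scale c (E x)"
        using E unfolding split_g2_def by blast+
      then show ?thesis by (simp add: eq_diff_eq)
    qed
    have DX: "D' X = zorn_scale (\<tau> (D (W v))) (D' (W v)) - D' (D (W v))"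
      "D X' = zorn_scale (\<tau> (D' (W v))) (D (W v)) - D (D' (W v))"
      unfolding X_def X'_def using V V' by (auto simp: lin realizes_def)
    have "dirz (lie_bracket \<iota> U V V' v) v =
      zorn_scale (\<tau> (g2_bracket D D' (W v))) (W v) - g2_bracket D D' (W v)"
      unfolding eq DX unfolding X_def X'_def
      by (simp add: g2_bracket_def \<tau>_def zorn_scale_eq prod_eq_iff vec_eq_iff algebra_simps)
    then show ?thesis using has_dirz_dirz[OF v] by metis
  qed
  moreover have "lie_bracket \<iota> U V V' v = 0" if "v \<notin> U" for v
    using that by (simp add: lie_bracket_def on_dom_def)
  ultimately show ?thesis
    using V V' by (simp add: realizes_def split_g2_bracket alg_field_lie_bracket)
qed

end

text \<open>Existence of realizing fields is thereby reduced to three: V generates, since its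
  brackets give V*, and brackets of V with V* give the matrix units and two independent diagonal
  elements.\<close>

lemma split_g2_generated:
  fixes R :: "('f::field_char_0 zorn \<Rightarrow> 'f zorn) set"
  assumes sub: "R \<subseteq> split_g2"
    and add: "\<And>D E. D \<in> R \<Longrightarrow> E \<in> R \<Longrightarrow> D + E \<in> R"
    and scale: "\<And>c D. D \<in> R \<Longrightarrow> g2_scale c D \<in> R"
    and bracket: "\<And>D E. D \<in> R \<Longrightarrow> E \<in> R \<Longrightarrow> g2_bracket D E \<in> R"
    and gen: "\<And>i. g2_k i (- 1) \<in> R"
  shows "R = split_g2"
proof (rule antisym[OF sub], rule subsetI)
  fix D :: "'f zorn \<Rightarrow> 'f zorn" assume "D \<in> split_g2"
  then obtain A k m where D: "D = g2_der A k m" and tr: "trace0 A"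
    by (auto elim: split_g2_cases)
  have A33: "A $ 3 $ 3 = - A $ 1 $ 1 - A $ 2 $ 2"
    using tr by (simp add: eq_neg_iff_add_eq_0 algebra_simps)
  have k: "g2_k i c \<in> R" for i c
    using scale[OF gen[of i], of "- c"] by simp
  have m1: "g2_m i 2 \<in> R" for i
    using exhaust_3[of i] bracket[OF k k, of 2 1 3 1] bracket[OF k k, of 3 1 1 1] bracket[OF k k, of 1 1 2 1]
    by (auto simp: g2_bracket_kk)
  have m: "g2_m i c \<in> R" for i c
    using scale[OF m1[of i], of "c / 2"] by simp
  have u: "g2_unit i j c \<in> R" if "i \<noteq> j" for i j c
    using bracket[OF k m, of i "- c / 3" j 1] that by (simp add: g2_bracket_km)
  have d: "g2_diag 1 1 (- 2) \<in> R" "g2_diag 2 (- 1) (- 1) \<in> R"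
    using bracket[OF k m, of 3 1 3 1] bracket[OF m k, of 1 1 1 1] by (simp_all add: g2_bracket_km_diag)
  \<comment> \<open>The last two coefficients \<open>s\<close>, \<open>t\<close> solve
    \<open>s + 2 * t = A $ 1 $ 1\<close> and \<open>s - t = A $ 2 $ 2\<close>; the third diagonal
    entry then agrees by trace zero.\<close>
  have "D = g2_k 1 (k $ 1) + g2_k 2 (k $ 2) + g2_k 3 (k $ 3) + g2_m 1 (m $ 1) + g2_m 2 (m $ 2) +
    g2_m 3 (m $ 3) + g2_unit 1 2 (A $ 1 $ 2) + g2_unit 1 3 (A $ 1 $ 3) + g2_unit 2 3 (A $ 2 $ 3) +
    g2_unit 2 1 (A $ 2 $ 1) + g2_unit 3 1 (A $ 3 $ 1) + g2_unit 3 2 (A $ 3 $ 2) +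
    g2_scale ((A $ 1 $ 1 + 2 * A $ 2 $ 2) / 3) (g2_diag 1 1 (- 2)) +
    g2_scale ((A $ 1 $ 1 - A $ 2 $ 2) / 3) (g2_diag 2 (- 1) (- 1))"
    unfolding D g2_scale_basis unfolding g2_basis_defs g2_der_add g2_der_eq_iff
    by (simp add: vec_eq_iff forall_3 axis_def A33 field_simps)
  then show "D \<in> R"
    using k m u d by (simp only:) (intro add scale; simp)
qed

lemma vector_space_vf_scale:
  "vector_space (vf_scale :: 'f::field \<Rightarrow> ('k, 'f) vfield \<Rightarrow> ('k, 'f) vfield)"
  by standard (auto simp: vf_scale_def fun_eq_iff vec_eq_iff algebra_simps)

context zorn_chart
begin

definition \<Phi> :: "('f zorn \<Rightarrow> 'f zorn) \<Rightarrow> ('k, 'f) vfield" where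
  "\<Phi> D = (THE V. realizes V D)"

lemma realizes_\<Phi>: "realizes V D \<Longrightarrow> \<Phi> D = V"
  unfolding \<Phi>_def using realizes_unique by blast

text \<open>The laws of \<open>\<Phi>\<close> come from uniqueness: a sum, multiple or bracket of
  realizing fields realizes the same operation on the derivations. For triviality of the kernel it
  is enough that one coordinate vector of V lies outside it, which \<open>nonzero\<close>
  provides.\<close>

lemma representation:
  assumes gen: "\<And>i. \<exists>V. realizes V (g2_k i (- 1))"
    and nonzero: "\<Phi> (g2_k 2 (- 1)) \<noteq> 0"
  shows "split_g2_representation vf_scale (lie_bracket \<iota> U) \<Phi>"
proof -
  have "{D. \<exists>V. realizes V D} = split_g2"
  proof (rule split_g2_generated)
    show "{D. \<exists>V. realizes V D} \<subseteq> split_g2" by (auto simp: realizes_def)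
  qed (use gen realizes_add realizes_scale realizes_bracket in blast)+
  then have ex: "realizes (\<Phi> D) D" if "D \<in> split_g2" for D
    using that realizes_\<Phi> by blast
  have \<Phi>_add: "\<Phi> (D + E) = \<Phi> D + \<Phi> E" if "D \<in> split_g2" "E \<in> split_g2" for D E
    using realizes_\<Phi>[OF realizes_add] ex that by blast
  have \<Phi>_scale: "\<Phi> (g2_scale c D) = vf_scale c (\<Phi> D)" if "D \<in> split_g2" for c D
    using realizes_\<Phi>[OF realizes_scale] ex that by blast
  have \<Phi>_bracket: "\<Phi> (g2_bracket D E) = lie_bracket \<iota> U (\<Phi> D) (\<Phi> E)"
    if "D \<in> split_g2" "E \<in> split_g2" for D E
    using realizes_\<Phi>[OF realizes_bracket] ex that by blast
  have vf0: "vf_scale c 0 = (0 :: ('k, 'f) vfield)" for c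
    by (simp add: vf_scale_def fun_eq_iff)
  interpret g2_ideal "{D \<in> split_g2. \<Phi> D = 0}"
  proof
    fix D E :: "'f zorn \<Rightarrow> 'f zorn" and c :: 'f
    show "D \<in> {D \<in> split_g2. \<Phi> D = 0} \<Longrightarrow> g2_scale c D \<in> {D \<in> split_g2. \<Phi> D = 0}"
      by (simp add: split_g2_scale \<Phi>_scale vf0)
    assume D: "D \<in> split_g2" and E: "E \<in> {D \<in> split_g2. \<Phi> D = 0}"
    have "dird u (\<lambda>w. 0) v = 0" for u v
      by (rule has_dird_dird[OF has_dird_const])
    then have "lie_bracket \<iota> U V 0 = 0" for V :: "('k, 'f) vfield"
      by (auto simp: fun_eq_iff vec_eq_iff lie_bracket_def on_dom_def
          dird_def[symmetric] sum_subtractf)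
    then show "g2_bracket D E \<in> {D \<in> split_g2. \<Phi> D = 0}"
      using D E by (simp add: split_g2_bracket \<Phi>_bracket)
  qed auto
  have "g2_der 0 (axis 2 1) 0 \<notin> {D \<in> split_g2. \<Phi> D = 0}"
  proof
    assume "g2_der 0 (axis 2 1) 0 \<in> {D \<in> split_g2. \<Phi> D = 0}"
    then have "g2_k 2 1 \<in> {D \<in> split_g2. \<Phi> D = 0}" by (simp only: g2_k_def)
    from g2_ideal.scale[OF g2_ideal_axioms this, of "- 1"] nonzero show False by simp
  qed
  from trivial[OF this] have ker: "D = 0" if "D \<in> split_g2" "\<Phi> D = 0" for D
    using that by simp
  have "inj_on \<Phi> split_g2"
  proof (rule inj_onI)
    fix D E assume D: "D \<in> split_g2" and E: "E \<in> split_g2" and eq: "\<Phi> D = \<Phi> E"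
    have "\<Phi> (D + g2_scale (- 1) E) = 0"
      using D E eq by (simp add: \<Phi>_add \<Phi>_scale split_g2_scale vf_scale_def fun_eq_iff)
    then have "D + g2_scale (- 1) E = 0"
      using D E ker split_g2_add split_g2_scale by blast
    then have "\<forall>x. D x = E x"
      by (simp add: fun_eq_iff g2_scale_def zorn_scale_eq prod_eq_iff vec_eq_iff del: split_paired_All)
    then show "D = E" by blast
  qed
  with vector_space_vf_scale \<Phi>_add \<Phi>_scale \<Phi>_bracket show ?thesis
    by (intro split_g2_representation.intro)
qed

end

section \<open>The flat coordinates of the Chazy distribution\<close>

locale chazy_setting =
  fixes \<iota> :: "'k::real_normed_field \<Rightarrow> 'f::{real_normed_field,banach}"
    and P A \<rho> chi :: "'k \<Rightarrow> 'f"
    and I :: "'k set" and U :: "'k point set"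
  assumes emb: "scalar_embedding \<iota>"
    and open_I: "open I"
    and chazy: "chazy_solution \<iota> (3/2) I P"
    and A_deriv: "x \<in> I \<Longrightarrow> has_sderiv \<iota> A (P x) x"
    and \<rho>_deriv: "x \<in> I \<Longrightarrow> sdiff \<iota> \<rho> x \<and> sdiff \<iota> (sderiv \<iota> \<rho>) x \<and>
           sderiv \<iota> (sderiv \<iota> \<rho>) x - 1/45 * Qf \<iota> P x * \<rho> x = 0"
    and chi_deriv: "x \<in> I \<Longrightarrow> \<rho> x \<noteq> 0 \<Longrightarrow> has_sderiv \<iota> chi (1 / (\<rho> x)^2) x"
    and U_open: "open U"
    and U_dom: "v \<in> U \<Longrightarrow> v $ Xc \<in> I \<and> \<rho> (v $ Xc) \<noteq> 0"
begin

sublocale scalar_domain \<iota> U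
  using emb U_open by unfold_locales

abbreviation "Q \<equiv> Qf \<iota> P"
abbreviation "R \<equiv> Rf \<iota> P"
abbreviation "X \<equiv> \<xi> \<iota> \<rho>"

text \<open>All exponentials of the statement are powers of \<open>em\<close> or of its reciprocal,
  so identities between coefficients become rational in \<open>em\<close> and are accessible to
  \<open>field_simps\<close>.\<close>

definition em :: "'k \<Rightarrow> 'f" where "em x = exp (- (1/3) * A x)"

lemma em_nz [simp]: "em x \<noteq> 0"
  by (simp add: em_def)

lemma exp_em: "exp (- (1/3) * A x) = em x" "exp (1/3 * A x) = 1 / em x" "exp (- (2/3) * A x) = (em x)^2"
  "exp (2/3 * A x) = 1 / (em x)^2"
proof -
  have "exp (2 * (1/3 * A x)) = (exp (1/3 * A x))^2" by (rule exp_double)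
  then show "exp (- (1/3) * A x) = em x" "exp (1/3 * A x) = 1 / em x" "exp (- (2/3) * A x) = (em x)^2"
    "exp (2/3 * A x) = 1 / (em x)^2"
    by (simp_all add: em_def exp_minus inverse_eq_divide power_one_over)
qed

lemma sderiv_uminus: "has_sderiv \<iota> f D x \<Longrightarrow> has_sderiv \<iota> (\<lambda>t. - f t) (- D) x"
  using sderiv_mult[OF sderiv_const[of "- 1"], of f D x] by simp

lemma sderiv_diff:
  "has_sderiv \<iota> f D x \<Longrightarrow> has_sderiv \<iota> g E x \<Longrightarrow> has_sderiv \<iota> (\<lambda>t. f t - g t) (D - E) x"
  using sderiv_add[OF _ sderiv_uminus] by fastforce

lemma sderiv_power2: "has_sderiv \<iota> f D x \<Longrightarrow> has_sderiv \<iota> (\<lambda>t. (f t)^2) (2 * f x * D) x"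
  using sderiv_mult[of f D x f D] by (simp add: power2_eq_square algebra_simps)

lemma sderiv_cmult: "has_sderiv \<iota> f D x \<Longrightarrow> has_sderiv \<iota> (\<lambda>t. c * f t) (c * D) x"
  using sderiv_mult[OF sderiv_const[of c], of f D x] by simp

lemma P_diff:
  assumes "x \<in> I"
  shows "has_sderiv \<iota> P (sderiv \<iota> P x) x"
    "has_sderiv \<iota> (sderiv \<iota> P) (sderiv \<iota> (sderiv \<iota> P) x) x"
    "has_sderiv \<iota> (sderiv \<iota> (sderiv \<iota> P)) (sderiv \<iota> (sderiv \<iota> (sderiv \<iota> P)) x) x"
  using chazy assms unfolding chazy_solution_def Let_def by (auto intro: sdiffD)

lemma P_deriv: "x \<in> I \<Longrightarrow> has_sderiv \<iota> P (((P x)^2 - Q x) / 6) x"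
  using P_diff(1) by (simp add: Qf_def)

lemma Q_raw: "x \<in> I \<Longrightarrow> has_sderiv \<iota> Q (2 * P x * sderiv \<iota> P x - 6 * sderiv \<iota> (sderiv \<iota> P) x) x"
  unfolding Qf_def by (intro sderiv_diff sderiv_power2 sderiv_cmult P_diff)

lemma Q_deriv: "x \<in> I \<Longrightarrow> has_sderiv \<iota> Q (2/3 * (P x * Q x - R x)) x"
proof -
  assume "x \<in> I"
  then have "has_sderiv \<iota> Q (sderiv \<iota> Q x) x" using Q_raw sderiv_eq by metis
  moreover have "2/3 * (P x * Q x - R x) = sderiv \<iota> Q x" by (simp add: Rf_def)
  ultimately show ?thesis by simp
qed

lemma R_deriv:
  assumes "x \<in> I"
  shows "has_sderiv \<iota> R (P x * R x + (Q x)^2 / 15) x"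
proof -
  let ?P1 = "sderiv \<iota> P" let ?P2 = "sderiv \<iota> ?P1" let ?P3 = "sderiv \<iota> ?P2"
  \<comment> \<open>\<open>R\<close> is defined through \<open>sderiv\<close> of \<open>Q\<close>.
    It is replaced on the open set \<open>I\<close> by a formula in the derivatives of
    \<open>P\<close>, which can be differentiated.\<close>
  have "has_sderiv \<iota> (\<lambda>t. P t * Q t - 3/2 * (2 * (P t * ?P1 t) - 6 * ?P2 t))
      (?P1 x * Q x + P x * (2 * P x * ?P1 x - 6 * ?P2 x) -
       3/2 * (2 * (?P1 x * ?P1 x + P x * ?P2 x) - 6 * ?P3 x)) x"
    using assms by (intro sderiv_diff sderiv_mult sderiv_cmult P_diff Q_raw)
  moreover have "P t * Q t - 3/2 * (2 * (P t * ?P1 t) - 6 * ?P2 t) = R t" if "t \<in> I" for t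
    using sderiv_eq[OF Q_raw[OF that]] by (simp add: Rf_def)
  ultimately have R': "has_sderiv \<iota> R (?P1 x * Q x + P x * (2 * P x * ?P1 x - 6 * ?P2 x) -
       3/2 * (2 * (?P1 x * ?P1 x + P x * ?P2 x) - 6 * ?P3 x)) x"
    by (rule sderiv_cong[OF _ open_I assms])
  \<comment> \<open>The Chazy equation solved for the third derivative. The constant comes from
    \<open>36 - (3/2)^2 = 135/4\<close>, and the base of the last square is
    \<open>- Q x\<close>.\<close>
  have "?P3 x = 2 * P x * ?P2 x - 3 * (?P1 x)^2 + 16/135 * (6 * ?P1 x - (P x)^2)^2"
  proof -
    have "?P3 x - 2 * P x * ?P2 x + 3 * (?P1 x)^2 -
        4 / (36 - (3/2)^2) * (6 * ?P1 x - (P x)^2)^2 = 0"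
      using chazy assms unfolding chazy_solution_def Let_def by blast
    moreover have "4 / (36 - (3/2)^2) = (16/135 :: 'f)"
      by (simp add: field_simps power2_eq_square)
    ultimately show ?thesis by (simp add: algebra_simps)
  qed
  moreover have "R x = P x * Q x - 3/2 * (2 * P x * ?P1 x - 6 * ?P2 x)"
    using sderiv_eq[OF Q_raw[OF assms]] by (simp add: Rf_def)
  moreover have "Q x = (P x)^2 - 6 * ?P1 x" by (simp add: Qf_def)
  ultimately have "?P1 x * Q x + P x * (2 * P x * ?P1 x - 6 * ?P2 x) -
       3/2 * (2 * (?P1 x * ?P1 x + P x * ?P2 x) - 6 * ?P3 x) = P x * R x + (Q x)^2 / 15"
    by (simp only:) (simp add: field_simps power2_eq_square)
  with R' show ?thesis by simp
qed

text \<open>Passing to the logarithmic derivative turns the linear equation for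
  \<open>\<rho>\<close> into a Riccati equation for \<open>X\<close>, so all derivatives are
  polynomial in the chosen functions.\<close>

lemma \<rho>_derivs:
  assumes "x \<in> I" "\<rho> x \<noteq> 0"
  shows "has_sderiv \<iota> \<rho> (X x * \<rho> x) x"
    "has_sderiv \<iota> (\<lambda>x. 1 / \<rho> x) (- (X x * (1 / \<rho> x))) x"
    "has_sderiv \<iota> X (Q x / 45 - (X x)^2) x"
proof -
  have 1: "has_sderiv \<iota> \<rho> (sderiv \<iota> \<rho> x) x" using \<rho>_deriv assms sdiffD by blast
  then show "has_sderiv \<iota> \<rho> (X x * \<rho> x) x" using assms by (simp add: \<xi>_def)
  show "has_sderiv \<iota> (\<lambda>x. 1 / \<rho> x) (- (X x * (1 / \<rho> x))) x"
    using sderiv_divide[OF sderiv_const[of 1] 1 assms(2)] by (simp add: \<xi>_def power2_eq_square)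
  have 2: "has_sderiv \<iota> (sderiv \<iota> \<rho>) (1/45 * Q x * \<rho> x) x"
    using \<rho>_deriv[OF assms(1)] sdiffD by (metis eq_iff_diff_eq_0)
  show "has_sderiv \<iota> X (Q x / 45 - (X x)^2) x"
    using sderiv_divide[OF 2 1 assms(2)] assms(2)
    unfolding \<xi>_def by (simp add: field_simps power2_eq_square)
qed

lemma em_derivs:
  assumes "x \<in> I"
  shows "has_sderiv \<iota> em (- (P x / 3 * em x)) x"
    "has_sderiv \<iota> (\<lambda>x. 1 / em x) (P x / 3 * (1 / em x)) x"
proof -
  show 1: "has_sderiv \<iota> em (- (P x / 3 * em x)) x"
    using sderiv_chain[OF sderiv_cmult[OF A_deriv[OF assms], of "- (1/3)"] DERIV_exp]
    unfolding em_def by simp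
  show "has_sderiv \<iota> (\<lambda>x. 1 / em x) (P x / 3 * (1 / em x)) x"
    using sderiv_divide[OF sderiv_const[of 1] 1] by (simp add: power2_eq_square)
qed

text \<open>Generators of a differential ring: each derivative is a polynomial in them over the
  scalars. The reciprocals of \<open>\<rho>\<close> and \<open>em\<close> are listed separately
  because \<open>alg\<close> has no division by functions.\<close>

definition gens :: "('k \<Rightarrow> 'f) set" where
  "gens = {P, Q, R, \<rho>, \<lambda>x. 1 / \<rho> x, X, chi, em, \<lambda>x. 1 / em x}"

sublocale coefficient_algebra \<iota> U gens
  by unfold_locales

lemma gens_alg:
  "(\<lambda>v. P (v $ Xc)) \<in> alg" "(\<lambda>v. Q (v $ Xc)) \<in> alg" "(\<lambda>v. R (v $ Xc)) \<in> alg"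
  "(\<lambda>v. \<rho> (v $ Xc)) \<in> alg" "(\<lambda>v. 1 / \<rho> (v $ Xc)) \<in> alg" "(\<lambda>v. X (v $ Xc)) \<in> alg"
  "(\<lambda>v. chi (v $ Xc)) \<in> alg" "(\<lambda>v. em (v $ Xc)) \<in> alg" "(\<lambda>v. 1 / em (v $ Xc)) \<in> alg"
  using alg.gen by (auto simp: gens_def)

lemmas alg_rules = gens_alg alg_intros

sublocale differential_algebra \<iota> U gens
proof
  fix g assume "g \<in> gens"
  then consider "g = P" | "g = Q" | "g = R" | "g = \<rho>" | "g = (\<lambda>x. 1 / \<rho> x)" | "g = X" | "g = chi"
    | "g = em" | "g = (\<lambda>x. 1 / em x)" unfolding gens_def by blast
  then show "\<exists>g'. (\<lambda>v. g' (v $ Xc)) \<in> alg \<and> (\<forall>v\<in>U. has_sderiv \<iota> g (g' (v $ Xc)) (v $ Xc))"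
  proof cases
    case 1 then show ?thesis using U_dom P_deriv
      by (intro exI[of _ "\<lambda>x. ((P x)^2 - Q x) / 6"]) (auto intro!: alg_rules)
  next
    case 2 then show ?thesis using U_dom Q_deriv
      by (intro exI[of _ "\<lambda>x. 2/3 * (P x * Q x - R x)"]) (auto intro!: alg_rules)
  next
    case 3 then show ?thesis using U_dom R_deriv
      by (intro exI[of _ "\<lambda>x. P x * R x + (Q x)^2 / 15"]) (auto intro!: alg_rules)
  next
    case 4 then show ?thesis using U_dom \<rho>_derivs(1)
      by (intro exI[of _ "\<lambda>x. X x * \<rho> x"]) (auto intro!: alg_rules)
  next
    case 5 then show ?thesis using U_dom \<rho>_derivs(2)
      by (intro exI[of _ "\<lambda>x. - (X x * (1 / \<rho> x))"] conjI alg_rules) auto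
  next
    case 6 then show ?thesis using U_dom \<rho>_derivs(3)
      by (intro exI[of _ "\<lambda>x. Q x / 45 - (X x)^2"]) (auto intro!: alg_rules)
  next
    case 7 then show ?thesis using U_dom chi_deriv
      by (intro exI[of _ "\<lambda>x. (1 / \<rho> x)^2"] conjI alg_rules) (auto simp: power_one_over)
  next
    case 8 then show ?thesis using U_dom em_derivs(1)
      by (intro exI[of _ "\<lambda>x. - (P x / 3 * em x)"] conjI alg_rules) auto
  next
    case 9 then show ?thesis using U_dom em_derivs(2)
      by (intro exI[of _ "\<lambda>x. P x / 3 * (1 / em x)"] conjI alg_rules) auto
  qed
qed

lemma has_dird_cdivide: "has_dird u f D v \<Longrightarrow> has_dird u (\<lambda>w. f w / c) (D / c) v"
  using has_dird_cmult[of u f D v "1 / c"] by simp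

lemma has_dird_power3: "has_dird u f D v \<Longrightarrow> has_dird u (\<lambda>w. (f w)^3) (3 * (f v)^2 * D) v"
  using has_dird_mult[OF has_dird_power2, of u f D v f D] by (simp add: power2_eq_square power3_eq_cube algebra_simps)

lemma has_dird_gens:
  assumes "v \<in> U"
  shows "has_dird u (\<lambda>v. P (v $ Xc)) (u $ Xc * (((P (v $ Xc))^2 - Q (v $ Xc)) / 6)) v"
    "has_dird u (\<lambda>v. Q (v $ Xc)) (u $ Xc * (2/3 * (P (v $ Xc) * Q (v $ Xc) - R (v $ Xc)))) v"
    "has_dird u (\<lambda>v. R (v $ Xc)) (u $ Xc * (P (v $ Xc) * R (v $ Xc) + (Q (v $ Xc))^2 / 15)) v"
    "has_dird u (\<lambda>v. \<rho> (v $ Xc)) (u $ Xc * (X (v $ Xc) * \<rho> (v $ Xc))) v"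
    "has_dird u (\<lambda>v. 1 / \<rho> (v $ Xc)) (u $ Xc * (- (X (v $ Xc) * (1 / \<rho> (v $ Xc))))) v"
    "has_dird u (\<lambda>v. X (v $ Xc)) (u $ Xc * (Q (v $ Xc) / 45 - (X (v $ Xc))^2)) v"
    "has_dird u (\<lambda>v. chi (v $ Xc)) (u $ Xc * (1 / (\<rho> (v $ Xc))^2)) v"
    "has_dird u (\<lambda>v. em (v $ Xc)) (u $ Xc * (- (P (v $ Xc) / 3 * em (v $ Xc)))) v"
proof -
  have v: "v $ Xc \<in> I" "\<rho> (v $ Xc) \<noteq> 0" using U_dom[OF assms] by auto
  note has_dird_x[OF P_deriv[OF v(1)]] has_dird_x[OF Q_deriv[OF v(1)]] has_dird_x[OF R_deriv[OF v(1)]]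
    has_dird_x[OF \<rho>_derivs(1)[OF v]] has_dird_x[OF \<rho>_derivs(2)[OF v]] has_dird_x[OF \<rho>_derivs(3)[OF v]]
    has_dird_x[OF chi_deriv[OF v]] has_dird_x[OF em_derivs(1)[OF v(1)]]
  then show "has_dird u (\<lambda>v. P (v $ Xc)) (u $ Xc * (((P (v $ Xc))^2 - Q (v $ Xc)) / 6)) v"
    "has_dird u (\<lambda>v. Q (v $ Xc)) (u $ Xc * (2/3 * (P (v $ Xc) * Q (v $ Xc) - R (v $ Xc)))) v"
    "has_dird u (\<lambda>v. R (v $ Xc)) (u $ Xc * (P (v $ Xc) * R (v $ Xc) + (Q (v $ Xc))^2 / 15)) v"
    "has_dird u (\<lambda>v. \<rho> (v $ Xc)) (u $ Xc * (X (v $ Xc) * \<rho> (v $ Xc))) v"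
    "has_dird u (\<lambda>v. 1 / \<rho> (v $ Xc)) (u $ Xc * (- (X (v $ Xc) * (1 / \<rho> (v $ Xc))))) v"
    "has_dird u (\<lambda>v. X (v $ Xc)) (u $ Xc * (Q (v $ Xc) / 45 - (X (v $ Xc))^2)) v"
    "has_dird u (\<lambda>v. chi (v $ Xc)) (u $ Xc * (1 / (\<rho> (v $ Xc))^2)) v"
    "has_dird u (\<lambda>v. em (v $ Xc)) (u $ Xc * (- (P (v $ Xc) / 3 * em (v $ Xc)))) v" .
qed

lemmas has_dird_rules = has_dird_intros has_dird_power3 has_dird_cdivide has_dird_coord

text \<open>Let \<open>t = fa\<close>, \<open>s = fd\<close>, \<open>w = ff / 6\<close>. Along the
  distribution \<open>s' = - fc\<close>, \<open>s'' = fb\<close> and \<open>w' = (s'')^2\<close>,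
  where the prime is the derivative in \<open>t\<close>: this is the Hilbert-Cartan equation, the
  flat model. Thus \<open>fd\<close> is \<open>y\<close> rescaled, \<open>fc\<close> and
  \<open>fb\<close> arise from it by differentiation in \<open>chi\<close>, and the quadratic part
  of \<open>ff\<close> corrects \<open>z\<close> accordingly. The functions \<open>c1\<close>,
  \<open>c2\<close>, \<open>c3\<close> are polynomials in these five.\<close>

definition fa :: "'k point \<Rightarrow> 'f" where "fa v = chi (v $ Xc)"

definition fb :: "'k point \<Rightarrow> 'f" where
  "fb v = 2/3 * \<rho> (v $ Xc) * em (v $ Xc) *
     (9 * \<iota> (v $ Yc) * (X (v $ Xc))^2 + 2 * (P (v $ Xc) * \<iota> (v $ Yc) - 3 * \<iota> (v $ Pc)) * X (v $ Xc)
      - (Q (v $ Xc) / 60 - (P (v $ Xc))^2 / 12) * \<iota> (v $ Yc) - P (v $ Xc) * \<iota> (v $ Pc) + 3/2 * \<iota> (v $ Qc))"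

definition fc :: "'k point \<Rightarrow> 'f" where
  "fc v = (1 / \<rho> (v $ Xc)) * em (v $ Xc) *
     (3 * \<iota> (v $ Yc) * X (v $ Xc) + P (v $ Xc) / 3 * \<iota> (v $ Yc) - \<iota> (v $ Pc))"

definition fd :: "'k point \<Rightarrow> 'f" where
  "fd v = (1 / \<rho> (v $ Xc))^3 * em (v $ Xc) * \<iota> (v $ Yc)"

definition ff :: "'k point \<Rightarrow> 'f" where
  "ff v = 6 * \<iota> (v $ Zc) + (em (v $ Xc))^2 *
     (- 4 * (6 * X (v $ Xc) + P (v $ Xc)) * (\<iota> (v $ Pc))^2
      + (72 * (X (v $ Xc))^2 + 16 * P (v $ Xc) * X (v $ Xc) - 2/15 * Q (v $ Xc) + 2/3 * (P (v $ Xc))^2)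
        * \<iota> (v $ Yc) * \<iota> (v $ Pc)
      - (72 * (X (v $ Xc))^3 + 24 * P (v $ Xc) * (X (v $ Xc))^2 + 8/3 * (P (v $ Xc))^2 * X (v $ Xc)
         + 1/9 * ((P (v $ Xc))^3 + 1/5 * P (v $ Xc) * Q (v $ Xc) + 2/5 * R (v $ Xc))) * (\<iota> (v $ Yc))^2)"

lemma fs_alg: "fa \<in> alg" "fb \<in> alg" "fc \<in> alg" "fd \<in> alg" "ff \<in> alg"
  unfolding fa_def fb_def fc_def fd_def ff_def by (rule alg_rules)+

lemma has_dird_fa: "v \<in> U \<Longrightarrow> has_dird u fa (u $ Xc / (\<rho> (v $ Xc))^2) v"
  unfolding fa_def using has_dird_gens(7) by simp

text \<open>A general direction \<open>u\<close> is kept because the formula is specialised to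
  \<open>S1\<close>, \<open>S2\<close> and \<open>Y\<close> and, for the immersion property of the
  chart, read as a linear equation for \<open>u\<close>.\<close>

lemma has_dird_fb:
  assumes "v \<in> U"
  shows "has_dird u fb (2/3 * \<rho> (v $ Xc) * em (v $ Xc) * (
     u $ Xc * ((X (v $ Xc) - P (v $ Xc) / 3) *
     (9 * \<iota> (v $ Yc) * (X (v $ Xc))^2 + 2 * (P (v $ Xc) * \<iota> (v $ Yc) - 3 * \<iota> (v $ Pc)) * X (v $ Xc)
      - (Q (v $ Xc) / 60 - (P (v $ Xc))^2 / 12) * \<iota> (v $ Yc) - P (v $ Xc) * \<iota> (v $ Pc) + 3/2 * \<iota> (v $ Qc))
      + (18 * \<iota> (v $ Yc) * X (v $ Xc) + 2 * (P (v $ Xc) * \<iota> (v $ Yc) - 3 * \<iota> (v $ Pc))) *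
          (Q (v $ Xc) / 45 - (X (v $ Xc))^2)
      + (2 * \<iota> (v $ Yc) * X (v $ Xc) + P (v $ Xc) / 6 * \<iota> (v $ Yc) - \<iota> (v $ Pc)) *
          (((P (v $ Xc))^2 - Q (v $ Xc)) / 6)
      - (P (v $ Xc) * Q (v $ Xc) - R (v $ Xc)) / 90 * \<iota> (v $ Yc))
     + u $ Yc * (9 * (X (v $ Xc))^2 + 2 * P (v $ Xc) * X (v $ Xc) - (Q (v $ Xc) / 60 - (P (v $ Xc))^2 / 12))
     - u $ Pc * (6 * X (v $ Xc) + P (v $ Xc)) + u $ Qc * (3/2))) v"
  unfolding fb_def
  by (rule has_dird_eq, (rule has_dird_const | rule has_dird_gens[OF assms] | rule has_dird_rules)+)
    (simp add: field_simps power2_eq_square)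

lemma has_dird_fc:
  assumes "v \<in> U"
  shows "has_dird u fc ((1 / \<rho> (v $ Xc)) * em (v $ Xc) * (
     u $ Xc * (- (X (v $ Xc) + P (v $ Xc) / 3) *
        (3 * \<iota> (v $ Yc) * X (v $ Xc) + P (v $ Xc) / 3 * \<iota> (v $ Yc) - \<iota> (v $ Pc))
       + 3 * \<iota> (v $ Yc) * (Q (v $ Xc) / 45 - (X (v $ Xc))^2) + ((P (v $ Xc))^2 - Q (v $ Xc)) / 18 * \<iota> (v $ Yc))
     + u $ Yc * (3 * X (v $ Xc) + P (v $ Xc) / 3) - u $ Pc)) v"
  unfolding fc_def
  by (rule has_dird_eq, (rule has_dird_const | rule has_dird_gens[OF assms] | rule has_dird_rules)+)
    (use U_dom[OF assms] in \<open>simp add: field_simps power2_eq_square\<close>)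

lemma has_dird_fd:
  assumes "v \<in> U"
  shows "has_dird u fd ((1 / \<rho> (v $ Xc))^3 * em (v $ Xc) *
     (u $ Yc - u $ Xc * \<iota> (v $ Yc) * (3 * X (v $ Xc) + P (v $ Xc) / 3))) v"
  unfolding fd_def
  by (rule has_dird_eq, (rule has_dird_const | rule has_dird_gens[OF assms] | rule has_dird_rules)+)
    (use U_dom[OF assms] in \<open>simp add: field_simps power2_eq_square power3_eq_cube\<close>)

lemma has_dird_ff:
  fixes v u
  defines "x \<equiv> v $ Xc" and "y \<equiv> \<iota> (v $ Yc)" and "p \<equiv> \<iota> (v $ Pc)"
  defines "P' \<equiv> ((P x)^2 - Q x) / 6" and "Q' \<equiv> 2/3 * (P x * Q x - R x)"
    and "R' \<equiv> P x * R x + (Q x)^2 / 15" and "X' \<equiv> Q x / 45 - (X x)^2"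
  defines "B \<equiv> 72 * (X x)^2 + 16 * P x * X x - 2/15 * Q x + 2/3 * (P x)^2"
    and "C \<equiv> 72 * (X x)^3 + 24 * P x * (X x)^2 + 8/3 * (P x)^2 * X x
         + 1/9 * ((P x)^3 + 1/5 * P x * Q x + 2/5 * R x)"
  assumes v: "v \<in> U"
  shows "has_dird u ff (6 * u $ Zc + (em x)^2 *
    (u $ Xc * (- 2/3 * P x * (- 4 * (6 * X x + P x) * p^2 + B * y * p - C * y^2)
       + (- 4 * (6 * X' + P') * p^2
          + (144 * X x * X' + 16 * (P' * X x + P x * X') - 2/15 * Q' + 4/3 * P x * P') * y * p
          - (216 * (X x)^2 * X' + 24 * (P' * (X x)^2 + 2 * P x * X x * X')
             + 8/3 * (2 * P x * P' * X x + (P x)^2 * X')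
             + 1/9 * (3 * (P x)^2 * P' + 1/5 * (P' * Q x + P x * Q') + 2/5 * R')) * y^2))
     + u $ Yc * (B * p - 2 * C * y) + u $ Pc * (B * y - 8 * (6 * X x + P x) * p))) v"
proof -
  note g = has_dird_gens[OF v, of u, folded x_def, folded P'_def Q'_def R'_def X'_def]
  show ?thesis
    unfolding ff_def
    by (rule has_dird_eq, (rule has_dird_const | rule g | rule has_dird_rules)+)
      (simp add: B_def C_def x_def[symmetric] y_def[symmetric] p_def[symmetric],
       simp add: field_simps power2_eq_square power3_eq_cube)
qed

section \<open>The three generators in the flat coordinates\<close>

abbreviation "vS1 \<equiv> vf \<iota> (S1 \<iota> P A \<rho>)"
abbreviation "vS2 \<equiv> vf \<iota> (S2 A \<rho>)"
abbreviation "vS3 \<equiv> vf \<iota> (S3 \<iota> P A \<rho> chi)"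

text \<open>The polynomial common to \<open>S1\<close> and \<open>l3\<close>. Since
  \<open>u $ Qc\<close> enters the derivative of \<open>fb\<close> with a nonzero factor, it is
  determined by the requirement that \<open>fb\<close> be constant along \<open>S1\<close>.\<close>

definition ell :: "'k point \<Rightarrow> 'f" where
  "ell v = 48 * \<iota> (v $ Yc) * (X (v $ Xc))^3 + 48 * (P (v $ Xc) / 3 * \<iota> (v $ Yc) - \<iota> (v $ Pc)) * (X (v $ Xc))^2
        - 16 * ((Q (v $ Xc) - 5 * (P (v $ Xc))^2) / 60 * \<iota> (v $ Yc) + \<iota> (v $ Pc) * P (v $ Xc) - 3/2 * \<iota> (v $ Qc)) * X (v $ Xc)
        - 4/3 * (2/45 * (P (v $ Xc) * Q (v $ Xc) + R (v $ Xc)) * \<iota> (v $ Yc)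
           + ((P (v $ Xc))^2 + Q (v $ Xc) / 15) * \<iota> (v $ Pc) - 6 * P (v $ Xc) * \<iota> (v $ Qc))"

lemma vS1_nth:
  "vS1 v $ Xc = - 8 * (\<rho> (v $ Xc))^2"
  "vS1 v $ Yc = - 8 * (\<rho> (v $ Xc))^2 * \<iota> (v $ Pc)"
  "vS1 v $ Zc = - 8 * (\<rho> (v $ Xc))^2 * ((\<iota> (v $ Qc))^2 * (em (v $ Xc))^2)"
  "vS1 v $ Pc = - 8 * (\<rho> (v $ Xc))^2 * \<iota> (v $ Qc)"
  "vS1 v $ Qc = - ((\<rho> (v $ Xc))^2 * ell v)"
  unfolding vf_def S1_def X1_def X2_def exp_em ell_def by (simp_all add: axis_def)

lemma vS2_nth:
  "vS2 v $ Xc = 0" "vS2 v $ Yc = 0" "vS2 v $ Zc = 0" "vS2 v $ Pc = 0"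
  "vS2 v $ Qc = 1 / (4 * \<rho> (v $ Xc) * em (v $ Xc))"
  unfolding vf_def S2_def X1_def exp_em by (simp_all add: axis_def)

lemma S1_derivs:
  assumes "v \<in> U"
  shows "has_dird (vS1 v) fa (- 8) v" "has_dird (vS1 v) fb 0 v" "has_dird (vS1 v) fc (8 * fb v) v"
    "has_dird (vS1 v) fd (8 * fc v) v" "has_dird (vS1 v) ff (- 48 * (fb v)^2) v"
proof -
  have nz: "\<rho> (v $ Xc) \<noteq> 0" using U_dom[OF assms] by simp
  show "has_dird (vS1 v) fa (- 8) v"
    by (rule has_dird_eq[OF has_dird_fa[OF assms]]) (simp add: vS1_nth nz)
  show "has_dird (vS1 v) fb 0 v"
    by (rule has_dird_eq[OF has_dird_fb[OF assms]])
      (simp add: vS1_nth ell_def, simp add: field_simps power2_eq_square power3_eq_cube)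
  show "has_dird (vS1 v) fc (8 * fb v) v"
    by (rule has_dird_eq[OF has_dird_fc[OF assms]])
      (simp add: vS1_nth fb_def nz, simp add: nz field_simps power2_eq_square power3_eq_cube)
  show "has_dird (vS1 v) fd (8 * fc v) v"
    by (rule has_dird_eq[OF has_dird_fd[OF assms]])
      (simp add: vS1_nth fc_def nz, simp add: nz field_simps power2_eq_square power3_eq_cube)
  show "has_dird (vS1 v) ff (- 48 * (fb v)^2) v"
    by (rule has_dird_eq[OF has_dird_ff[OF assms]])
      (simp add: vS1_nth fb_def nz, simp add: nz field_simps power2_eq_square power3_eq_cube)
qed

lemma S2_derivs:
  assumes "v \<in> U"
  shows "has_dird (vS2 v) fa 0 v" "has_dird (vS2 v) fb (1 / 4) v" "has_dird (vS2 v) fc 0 v"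
    "has_dird (vS2 v) fd 0 v" "has_dird (vS2 v) ff 0 v"
proof -
  have nz: "\<rho> (v $ Xc) \<noteq> 0" using U_dom[OF assms] by simp
  show "has_dird (vS2 v) fa 0 v"
    by (rule has_dird_eq[OF has_dird_fa[OF assms]]) (simp add: vS2_nth)
  show "has_dird (vS2 v) fb (1 / 4) v"
    by (rule has_dird_eq[OF has_dird_fb[OF assms]]) (simp add: vS2_nth nz)
  show "has_dird (vS2 v) fc 0 v"
    by (rule has_dird_eq[OF has_dird_fc[OF assms]]) (simp add: vS2_nth)
  show "has_dird (vS2 v) fd 0 v"
    by (rule has_dird_eq[OF has_dird_fd[OF assms]]) (simp add: vS2_nth)
  show "has_dird (vS2 v) ff 0 v"
    by (rule has_dird_eq[OF has_dird_ff[OF assms]]) (simp add: vS2_nth)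
qed

text \<open>The subtracted multiple of \<open>\<partial> Qc\<close> is the factor of
  \<open>c3^2\<close> in \<open>l3\<close>. Once it is moved from there into \<open>X3\<close>, the
  field annihilates \<open>fb\<close> and is polynomial in the flat coordinates.\<close>

definition vY :: "('k, 'f) vfield" where
  "vY v = vf \<iota> (X3 \<iota> P A \<rho> chi) v - (\<rho> (v $ Xc) * (1 / em (v $ Xc)) / 6 *
     ((36 * (X (v $ Xc))^2 + 12 * P (v $ Xc) * X (v $ Xc) + (P (v $ Xc))^2 + Q (v $ Xc) / 15)
        * (\<rho> (v $ Xc))^2 * chi (v $ Xc)
      - 4 * P (v $ Xc) - 24 * X (v $ Xc))) *s \<partial> Qc"

lemma vY_nth:
  "vY v $ Xc = 0"
  "vY v $ Yc = - ((\<rho> (v $ Xc))^3 * chi (v $ Xc) / em (v $ Xc))"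
  "vY v $ Pc = - ((\<rho> (v $ Xc))^3 * chi (v $ Xc) / em (v $ Xc)) * (1/3 * (P (v $ Xc) + 9 * X (v $ Xc)))
     + \<rho> (v $ Xc) / em (v $ Xc)"
  "vY v $ Zc = 4 * (\<rho> (v $ Xc))^3 * chi (v $ Xc) * em (v $ Xc) *
       (3 * \<iota> (v $ Yc) * (X (v $ Xc))^3 + 3 * (P (v $ Xc) / 3 * \<iota> (v $ Yc) - \<iota> (v $ Pc)) * (X (v $ Xc))^2
        - ((Q (v $ Xc) / 60 - (P (v $ Xc))^2 / 12) * \<iota> (v $ Yc) + P (v $ Xc) * \<iota> (v $ Pc)) * X (v $ Xc)
        - 1/270 * (P (v $ Xc) * Q (v $ Xc) + R (v $ Xc)) * \<iota> (v $ Yc)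
        - 1/12 * ((P (v $ Xc))^2 + Q (v $ Xc) / 15) * \<iota> (v $ Pc))
     + 4 * \<rho> (v $ Xc) * em (v $ Xc) *
       (3 * \<iota> (v $ Yc) * (X (v $ Xc))^2 + 2 * (P (v $ Xc) / 3 * \<iota> (v $ Yc) - \<iota> (v $ Pc)) * X (v $ Xc)
        - 1/3 * ((Q (v $ Xc) / 60 - (P (v $ Xc))^2 / 12) * \<iota> (v $ Yc) + \<iota> (v $ Pc) * P (v $ Xc)
           - 3 * \<iota> (v $ Qc)))"
  "vY v $ Qc = - (\<rho> (v $ Xc) * (1 / em (v $ Xc)) / 6 *
     ((36 * (X (v $ Xc))^2 + 12 * P (v $ Xc) * X (v $ Xc) + (P (v $ Xc))^2 + Q (v $ Xc) / 15)
        * (\<rho> (v $ Xc))^2 * chi (v $ Xc)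
      - 4 * P (v $ Xc) - 24 * X (v $ Xc)))"
  unfolding vY_def vf_def X3_def exp_em by (simp_all add: axis_def)

lemma Y_derivs:
  assumes "v \<in> U"
  shows "has_dird (vY v) fa 0 v" "has_dird (vY v) fb 0 v" "has_dird (vY v) fc (- 1) v"
    "has_dird (vY v) fd (- fa v) v" "has_dird (vY v) ff (24 * fb v) v"
proof -
  have nz: "\<rho> (v $ Xc) \<noteq> 0" using U_dom[OF assms] by simp
  show "has_dird (vY v) fa 0 v"
    by (rule has_dird_eq[OF has_dird_fa[OF assms]]) (simp add: vY_nth)
  show "has_dird (vY v) fb 0 v"
    by (rule has_dird_eq[OF has_dird_fb[OF assms]])
      (simp add: vY_nth, simp add: nz field_simps power2_eq_square power3_eq_cube)
  show "has_dird (vY v) fc (- 1) v"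
    by (rule has_dird_eq[OF has_dird_fc[OF assms]])
      (simp add: vY_nth nz, simp add: nz field_simps power2_eq_square power3_eq_cube)
  show "has_dird (vY v) fd (- fa v) v"
    by (rule has_dird_eq[OF has_dird_fd[OF assms]])
      (simp add: vY_nth fa_def nz, simp add: nz field_simps power2_eq_square power3_eq_cube)
  show "has_dird (vY v) ff (24 * fb v) v"
    by (rule has_dird_eq[OF has_dird_ff[OF assms]])
      (simp add: vY_nth fb_def nz, simp add: nz field_simps power2_eq_square power3_eq_cube)
qed

definition C1 :: "'k point \<Rightarrow> 'f" where
  "C1 v = (fa v)^2 * fb v / 8 + fa v * fc v / 8 - 3/8 * fd v"

definition C2 :: "'k point \<Rightarrow> 'f" where
  "C2 v = ff v + 6 * fa v * (fb v)^2 + 16 * fb v * fc v"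

definition C3 :: "'k point \<Rightarrow> 'f" where
  "C3 v = - (fa v * fb v / 2) - fc v"

lemma Jf_eq: "Jf \<iota> P A \<rho> (v $ Xc) (\<iota> (v $ Yc)) (\<iota> (v $ Pc)) (\<iota> (v $ Qc)) = fb v"
  unfolding Jf_def fb_def exp_em ..

lemma c1_eq: "c1 \<iota> P A \<rho> chi (v $ Xc) (\<iota> (v $ Yc)) (\<iota> (v $ Pc)) (\<iota> (v $ Qc)) = C1 v"
  unfolding c1_def Jf_eq C1_def exp_em
  by (simp add: fa_def fc_def fd_def power_one_over ac_simps)

lemma c2_eq: "c2 \<iota> P A \<rho> chi (v $ Xc) (\<iota> (v $ Yc)) (\<iota> (v $ Zc)) (\<iota> (v $ Pc)) (\<iota> (v $ Qc)) = C2 v"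
  unfolding c2_def Jf_eq C2_def exp_em
  by (simp add: fa_def fc_def ff_def algebra_simps)

lemma c3_eq: "c3 \<iota> P A \<rho> chi (v $ Xc) (\<iota> (v $ Yc)) (\<iota> (v $ Pc)) (\<iota> (v $ Qc)) = C3 v"
  unfolding c3_def Jf_eq C3_def exp_em
  by (simp add: fa_def fc_def)

lemma vS3_eq:
  assumes "v \<in> U"
  shows "vS3 v = (- C1 v) *s vS1 v + C2 v *s vS2 v + (- ((C3 v)^2)) *s vY v"
proof -
  have nz: "\<rho> (v $ Xc) \<noteq> 0" using U_dom[OF assms] by simp
  define r a e b c d where "r = \<rho> (v $ Xc)" and "a = chi (v $ Xc)" and "e = em (v $ Xc)"
    and "b = fb v" and "c = fc v" and "d = fd v"
  \<comment> \<open>\<open>K\<close> and \<open>T\<close> are the brackets inside \<open>fb\<close>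
    and \<open>fc\<close>. Together with \<open>y\<close> they are eliminated in favour of
    \<open>b\<close>, \<open>c\<close>, \<open>d\<close>, after which the coefficient of
    \<open>X2\<close> and the square before \<open>X3\<close> are rational expressions in
    \<open>r\<close>, \<open>a\<close>, \<open>e\<close>, \<open>b\<close>, \<open>c\<close>,
    \<open>d\<close>.\<close>
  define K where "K = 9 * \<iota> (v $ Yc) * (X (v $ Xc))^2
      + 2 * (P (v $ Xc) * \<iota> (v $ Yc) - 3 * \<iota> (v $ Pc)) * X (v $ Xc)
      - (Q (v $ Xc) / 60 - (P (v $ Xc))^2 / 12) * \<iota> (v $ Yc) - P (v $ Xc) * \<iota> (v $ Pc) + 3/2 * \<iota> (v $ Qc)"
  define T where "T = 3 * \<iota> (v $ Yc) * X (v $ Xc) + P (v $ Xc) / 3 * \<iota> (v $ Yc) - \<iota> (v $ Pc)"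
  have nz': "r \<noteq> 0" "e \<noteq> 0" using nz by (simp_all add: r_def e_def)
  have K: "K = 3 * b / (2 * r * e)"
    using nz' unfolding b_def fb_def K_def[symmetric] r_def[symmetric] e_def[symmetric] by simp
  have T: "T = r * c / e"
    using nz' unfolding c_def fc_def T_def[symmetric] r_def[symmetric] e_def[symmetric] by simp
  have y: "\<iota> (v $ Yc) = r^3 * d / e"
    using nz' unfolding d_def fd_def r_def[symmetric] e_def[symmetric]
    by (simp add: power_one_over field_simps)
  \<comment> \<open>The coefficient of \<open>X2\<close> in \<open>S3\<close> thus is
    \<open>- C1\<close> times its coefficient \<open>- 8 * r^2\<close> in \<open>S1\<close>.\<close>
  have m: "2 * e / (3 * r) * (r^4 * a^2 * K + 3/2 * r^2 * a * T - 9/2 * \<iota> (v $ Yc)) = 8 * r^2 * C1 v"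
    using nz' unfolding K T y C1_def fa_def a_def[symmetric] b_def[symmetric] c_def[symmetric] d_def[symmetric]
    by (simp add: field_simps power2_eq_square power3_eq_cube power4_eq_xxxx)
  have T3: "9 * \<iota> (v $ Yc) * X (v $ Xc) + P (v $ Xc) * \<iota> (v $ Yc) - 3 * \<iota> (v $ Pc) = 3 * T"
    by (simp add: T_def algebra_simps)
  have n: "e^2 / (9 * r^2) * (r^2 * a * K + 9 * \<iota> (v $ Yc) * X (v $ Xc) + P (v $ Xc) * \<iota> (v $ Yc)
      - 3 * \<iota> (v $ Pc))^2 = (C3 v)^2"
  proof -
    have "r^2 * a * K + 9 * \<iota> (v $ Yc) * X (v $ Xc) + P (v $ Xc) * \<iota> (v $ Yc) - 3 * \<iota> (v $ Pc) =
        - (3 * r / e) * C3 v"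
    proof -
      have "r^2 * a * K + 9 * \<iota> (v $ Yc) * X (v $ Xc) + P (v $ Xc) * \<iota> (v $ Yc) - 3 * \<iota> (v $ Pc) =
          r^2 * a * K + 3 * T"
        unfolding T3[symmetric] by simp
      also have "\<dots> = - (3 * r / e) * C3 v"
        using nz' unfolding K T C3_def fa_def a_def[symmetric] b_def[symmetric] c_def[symmetric]
        by (simp add: field_simps power2_eq_square)
      finally show ?thesis .
    qed
    then show ?thesis
      using nz' by (simp only:) (simp add: power_divide power_mult_distrib)
  qed
  have l: "l3 \<iota> P A \<rho> chi (v $ Xc) (\<iota> (v $ Yc)) (\<iota> (v $ Zc)) (\<iota> (v $ Pc)) (\<iota> (v $ Qc)) =
      - (vY v $ Qc) * (C3 v)^2 + C2 v / (4 * r * e) + r^2 * ell v * C1 v"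
    unfolding l3_def c1_eq c2_eq c3_eq exp_em vY_nth ell_def by (simp add: r_def e_def ac_simps)
  have X3: "vf \<iota> (X3 \<iota> P A \<rho> chi) v = vY v - (vY v $ Qc) *s \<partial> Qc"
    unfolding vY_nth by (simp add: vY_def)
  have S1: "vS1 v = (- (r^2 * ell v)) *s \<partial> Qc - (8 * r^2) *s vf \<iota> (X2 A) v"
    unfolding vf_def S1_def X1_def ell_def r_def by simp
  have S2: "vS2 v = (1 / (4 * r * e)) *s \<partial> Qc"
    unfolding vf_def S2_def X1_def exp_em r_def e_def by simp
  have "vS3 v = l3 \<iota> P A \<rho> chi (v $ Xc) (\<iota> (v $ Yc)) (\<iota> (v $ Zc)) (\<iota> (v $ Pc)) (\<iota> (v $ Qc)) *s \<partial> Qc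
      + (8 * r^2 * C1 v) *s vf \<iota> (X2 A) v - (C3 v)^2 *s vf \<iota> (X3 \<iota> P A \<rho> chi) v"
    unfolding m[symmetric] n[symmetric]
    unfolding K_def T_def r_def a_def e_def
    unfolding vf_def S3_def X1_def exp_em by simp
  then show ?thesis
    unfolding l X3 S1 S2 by (simp add: vec_eq_iff algebra_simps)
qed

lemma S3_derivs:
  assumes "v \<in> U"
  shows "has_dird (vS3 v) fa (8 * C1 v) v" "has_dird (vS3 v) fb (C2 v / 4) v"
    "has_dird (vS3 v) fc (- 8 * C1 v * fb v + (C3 v)^2) v"
    "has_dird (vS3 v) fd (- 8 * C1 v * fc v + (C3 v)^2 * fa v) v"
    "has_dird (vS3 v) ff (48 * C1 v * (fb v)^2 - 24 * (C3 v)^2 * fb v) v"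
  unfolding vS3_eq[OF assms]
  by (rule has_dird_eq, (rule has_dird_add_left has_dird_scale_left S1_derivs[OF assms] S2_derivs[OF assms] Y_derivs[OF assms])+,
      simp)+

section \<open>The chart of null octonions\<close>

definition w4 :: "'k point \<Rightarrow> 'f" where "w4 v = C1 v + fa v * C3 v / 4"
definition w5 :: "'k point \<Rightarrow> 'f" where "w5 v = C2 v + 8 * fb v * C3 v"
definition w6 :: "'k point \<Rightarrow> 'f" where "w6 v = (C3 v)^2 - fa v * w5 v / 8 + 4 * fb v * w4 v"

text \<open>The norm \<open>a * b - dot3 u v\<close> of \<open>(a, u, v, b)\<close> vanishes on it,
  which determines \<open>w6\<close>. The entries \<open>4 * fb\<close> and \<open>fa / 8\<close>
  are scaled to have derivative 1 along \<open>S2\<close> and -1 along \<open>S1\<close>. The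
  corrections in \<open>w4\<close> and \<open>w5\<close> are those that make \<open>w4\<close>
  constant along \<open>S2\<close> and \<open>w5\<close> constant along \<open>S1\<close>, as the
  two derivations demand.\<close>

definition chart :: "'k point \<Rightarrow> 'f zorn" where
  "chart v = (C3 v, vector [1, w4 v, - w5 v], vector [- w6 v, 4 * fb v, fa v / 8], - C3 v)"

text \<open>The expected derivatives enter as equations, so that each generator costs only four
  polynomial identities; with \<open>refl\<close> for these equations the lemma also handles an
  unknown direction.\<close>

lemma has_dirz_chart:
  assumes a: "has_dird u fa A' v" and b: "has_dird u fb B' v" and c: "has_dird u fc C' v" and d: "has_dird u fd D' v"
    and f: "has_dird u ff F' v" and v: "v \<in> U"
    and C3': "- ((A' * fb v + fa v * B') / 2) - C' = C3'"
    and w4': "(2 * fa v * A' * fb v + (fa v)^2 * B') / 8 + (A' * fc v + fa v * C') / 8 - 3/8 * D'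
      + (A' * C3 v + fa v * C3') / 4 = w4'"
    and w5': "F' + 6 * (A' * (fb v)^2 + 2 * fa v * fb v * B') + 16 * (B' * fc v + fb v * C')
      + 8 * (B' * C3 v + fb v * C3') = w5'"
    and w6': "2 * C3 v * C3' - (A' * w5 v + fa v * w5') / 8 + 4 * (B' * w4 v + fb v * w4') = w6'"
  shows "has_dirz u chart (C3', vector [0, w4', - w5'], vector [- w6', 4 * B', A' / 8], - C3') v"
proof -
  have C3: "has_dird u C3 C3' v"
    unfolding C3_def
    by (rule has_dird_eq, (rule has_dird_const a b c | rule has_dird_rules)+) (simp add: C3'[symmetric])
  have w4: "has_dird u w4 w4' v"
    unfolding w4_def C1_def
    by (rule has_dird_eq, (rule has_dird_const a b c d C3 | rule has_dird_rules)+) (simp add: w4'[symmetric])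
  have w5: "has_dird u w5 w5' v"
    unfolding w5_def C2_def
    by (rule has_dird_eq, (rule has_dird_const a b c d f C3 | rule has_dird_rules)+) (simp add: w5'[symmetric] algebra_simps)
  have w6: "has_dird u w6 w6' v"
    unfolding w6_def
    by (rule has_dird_eq, (rule has_dird_const a b C3 w4 w5 | rule has_dird_rules)+) (simp add: w6'[symmetric] algebra_simps)
  show ?thesis
    unfolding has_dirz_def chart_def forall_3 fst_conv snd_conv vector_3
    by (intro conjI C3 w4 w5 w6 has_dird_const has_dird_uminus has_dird_cmult has_dird_cdivide a b)
qed

lemma C_alg: "C1 \<in> alg" "C2 \<in> alg" "C3 \<in> alg" "w4 \<in> alg" "w5 \<in> alg" "w6 \<in> alg"
proof -
  note r = fs_alg alg_rules
  show 1: "C1 \<in> alg" "C2 \<in> alg" "C3 \<in> alg"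
    unfolding C1_def C2_def C3_def by (rule r)+
  show 2: "w4 \<in> alg" "w5 \<in> alg" unfolding w4_def w5_def by (rule r 1)+
  show "w6 \<in> alg" unfolding w6_def by (rule r 1 2)+
qed

sublocale zorn_chart \<iota> U gens chart
proof
  fix i :: 3
  show "(\<lambda>v. fst (chart v)) \<in> alg" "(\<lambda>v. snd (snd (snd (chart v)))) \<in> alg"
    unfolding chart_def by (auto intro: C_alg alg_intros)
  show "(\<lambda>v. fst (snd (chart v)) $ i) \<in> alg" "(\<lambda>v. fst (snd (snd (chart v))) $ i) \<in> alg"
    unfolding chart_def using exhaust_3[of i]
    by (elim disjE; simp; intro C_alg fs_alg alg_intros)+
next
  fix v u assume v: "v \<in> U" and zero: "has_dirz u chart 0 v"
  have nz: "\<rho> (v $ Xc) \<noteq> 0" using U_dom[OF v] by simp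
  note hf = alg_hd[OF fs_alg(1) v, of u] alg_hd[OF fs_alg(2) v, of u] alg_hd[OF fs_alg(3) v, of u]
    alg_hd[OF fs_alg(4) v, of u] alg_hd[OF fs_alg(5) v, of u]
  \<comment> \<open>The system is triangular: the entries \<open>fa / 8\<close> and
    \<open>4 * fb\<close> yield \<open>fa\<close> and \<open>fb\<close>, then \<open>C3\<close>
    yields \<open>fc\<close>, then \<open>w4\<close> and \<open>w5\<close> yield \<open>fd\<close>
    and \<open>ff\<close>. These in turn determine the components of \<open>u\<close> in the order
    x, y, p, q, z.\<close>
  have 1: "dird u fa v = 0" "dird u fb v = 0"
    using has_dirz_unique[OF has_dirz_chart[OF hf v refl refl refl refl] zero] by (auto simp: vec_eq_iff forall_3 zero_prod_def)
  then have 2: "dird u fc v = 0"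
    using has_dirz_unique[OF has_dirz_chart[OF hf v refl refl refl refl] zero] by (auto simp: vec_eq_iff forall_3 zero_prod_def)
  have 3: "dird u fd v = 0" "dird u ff v = 0"
    using has_dirz_unique[OF has_dirz_chart[OF hf v refl refl refl refl] zero] by (simp_all add: 1 2 vec_eq_iff forall_3 zero_prod_def)
  have x: "u $ Xc = 0" using has_dird_dird[OF has_dird_fa[OF v, of u]] 1 nz by simp
  have y: "u $ Yc = 0" using has_dird_dird[OF has_dird_fd[OF v, of u]] 3 nz x by simp
  have p: "u $ Pc = 0" using has_dird_dird[OF has_dird_fc[OF v, of u]] 2 nz x y by simp
  have q: "u $ Qc = 0" using has_dird_dird[OF has_dird_fb[OF v, of u]] 1 nz x y p by simp
  have z: "u $ Zc = 0" using has_dird_dird[OF has_dird_ff[OF v, of u]] 3 nz x y p by simp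
  show "u = 0"
    using x y z p q by (auto simp: vec_eq_iff) (metis coord.exhaust)
qed

lemma alg_div_em: "f \<in> alg \<Longrightarrow> (\<lambda>v. f v / em (v $ Xc)) \<in> alg"
  using alg.mult[OF _ gens_alg(9)] by simp

lemma alg_fieldI:
  assumes "(\<lambda>v. V v $ Xc) \<in> alg" "(\<lambda>v. V v $ Yc) \<in> alg" "(\<lambda>v. V v $ Zc) \<in> alg"
    "(\<lambda>v. V v $ Pc) \<in> alg" "(\<lambda>v. V v $ Qc) \<in> alg"
  shows "alg_field V"
  unfolding alg_field_def by (metis assms coord.exhaust)

lemma vS_alg: "alg_field vS1" "alg_field vS2" "alg_field vS3"
proof -
  have "ell \<in> alg" unfolding ell_def by (rule alg_rules)+
  then show 1: "alg_field vS1"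
    by (intro alg_fieldI; unfold vS1_nth; intro alg_rules)
  have "(\<lambda>v. (1 / 4) * (1 / \<rho> (v $ Xc)) * (1 / em (v $ Xc))) \<in> alg"
    by (rule alg_rules)+
  then have q: "(\<lambda>v. 1 / (4 * \<rho> (v $ Xc) * em (v $ Xc))) \<in> alg" by simp
  show 2: "alg_field vS2"
    by (intro alg_fieldI; unfold vS2_nth; rule q alg.const)
  have 3: "alg_field vY"
    by (intro alg_fieldI; unfold vY_nth; (rule alg_div_em alg_rules)+)
  show "alg_field vS3"
    unfolding alg_field_def
  proof
    fix i
    have "(\<lambda>v. - C1 v * vS1 v $ i + C2 v * vS2 v $ i - (C3 v)^2 * vY v $ i) \<in> alg"
      using 1 2 3 by (intro C_alg alg_intros) (auto simp: alg_field_def)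
    then show "(\<lambda>v. vS3 v $ i) \<in> alg"
      by (rule alg.eq_on) (simp add: vS3_eq)
  qed
qed

lemma chart_action:
  "g2_k 2 (- 1) (chart v) = (4 * fb v, vector [0, - 2 * C3 v, 0], vector [w5 v, 0, 1], - 4 * fb v)"
  "g2_k 3 (- 1) (chart v) = (fa v / 8, vector [0, 0, - 2 * C3 v], vector [w4 v, - 1, 0], - fa v / 8)"
  "g2_k 1 (- 1) (chart v) = (- w6 v, vector [- 2 * C3 v, 0, 0], vector [0, - w5 v, - w4 v], w6 v)"
  by (simp_all add: g2_k_def g2_der_def chart_def vec3_simps axis_def)

text \<open>By \<open>chart_action\<close>, \<open>\<tau>\<close> of the image of the chart is 0 for
  the derivations of \<open>S1\<close> and \<open>S2\<close>, and \<open>- 2 * C3\<close> for that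
  of \<open>S3\<close>. So the first two act affinely on the chart, and the projective term appears
  only for \<open>S3\<close>.\<close>

lemma realizes_S:
  "realizes (on_dom U vS1) (g2_k 2 (- 1))"
  "realizes (on_dom U vS2) (g2_k 3 (- 1))"
  "realizes (on_dom U vS3) (g2_k 1 (- 1))"
proof -
  have 1: "has_dirz (vS1 v) chart (zorn_scale (\<tau> (g2_k 2 (- 1) (chart v))) (chart v) - g2_k 2 (- 1) (chart v)) v"
    if v: "v \<in> U" for v
  proof -
    have "has_dirz (vS1 v) chart (- 4 * fb v, vector [0, 2 * C3 v, - 0], vector [- w5 v, 4 * 0, - 8 / 8], - (- 4 * fb v)) v"
      by (rule has_dirz_chart[OF S1_derivs[OF v] v])
        (simp_all add: C3_def field_simps power2_eq_square)
    moreover have "(- 4 * fb v, vector [0, 2 * C3 v, - 0], vector [- w5 v, 4 * 0, - 8 / 8], - (- 4 * fb v)) =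
        zorn_scale (\<tau> (g2_k 2 (- 1) (chart v))) (chart v) - g2_k 2 (- 1) (chart v)"
      unfolding chart_action by (simp add: \<tau>_def chart_def vec_eq_iff forall_3)
    ultimately show ?thesis by simp
  qed
  have 2: "has_dirz (vS2 v) chart (zorn_scale (\<tau> (g2_k 3 (- 1) (chart v))) (chart v) - g2_k 3 (- 1) (chart v)) v"
    if v: "v \<in> U" for v
  proof -
    have "has_dirz (vS2 v) chart (- fa v / 8, vector [0, 0, - (- 2 * C3 v)], vector [- w4 v, 4 * (1 / 4), 0 / 8], - (- fa v / 8)) v"
      by (rule has_dirz_chart[OF S2_derivs[OF v] v])
        (simp_all add: C3_def field_simps power2_eq_square)
    moreover have "(- fa v / 8, vector [0, 0, - (- 2 * C3 v)], vector [- w4 v, 4 * (1 / 4), 0 / 8], - (- fa v / 8)) =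
        zorn_scale (\<tau> (g2_k 3 (- 1) (chart v))) (chart v) - g2_k 3 (- 1) (chart v)"
      unfolding chart_action by (simp add: \<tau>_def chart_def vec_eq_iff forall_3)
    ultimately show ?thesis by simp
  qed
  have 3: "has_dirz (vS3 v) chart (zorn_scale (\<tau> (g2_k 1 (- 1) (chart v))) (chart v) - g2_k 1 (- 1) (chart v)) v"
    if v: "v \<in> U" for v
  proof -
    \<comment> \<open>These are the entries of \<open>\<tau> (D W) W - D W\<close> for
      \<open>D = g2_k 1 (- 1)\<close>. In the last block \<open>w5 - 8 * fb * C3\<close> and
      \<open>w4 - fa * C3 / 4\<close> have been replaced by \<open>C2\<close> and \<open>C1\<close>,
      which are the derivatives of \<open>4 * fb\<close> and \<open>fa / 8\<close> along
      \<open>S3\<close>.\<close>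
    have "has_dirz (vS3 v) chart (w6 v - 2 * (C3 v)^2, vector [0, - 2 * C3 v * w4 v, - (- 2 * C3 v * w5 v)],
        vector [- (- 2 * C3 v * w6 v), 4 * (C2 v / 4), 8 * C1 v / 8], - (w6 v - 2 * (C3 v)^2)) v"
    proof (rule has_dirz_chart[OF S3_derivs[OF v] v])
      show "- ((8 * C1 v * fb v + fa v * (C2 v / 4)) / 2) - (- 8 * C1 v * fb v + (C3 v)^2) = w6 v - 2 * (C3 v)^2"
        by (simp add: w6_def w4_def w5_def field_simps power2_eq_square)
      \<comment> \<open>With \<open>fc\<close> eliminated, the identities are polynomial in
        \<open>fa\<close>, \<open>fb\<close>, \<open>C1\<close>, \<open>C2\<close>,
        \<open>C3\<close>; \<open>fd\<close> and \<open>ff\<close> occur only through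
        \<open>C1\<close> and \<open>C2\<close>.\<close>
      have fc: "fc v = - (fa v * fb v / 2) - C3 v" by (simp add: C3_def)
      show "(2 * fa v * (8 * C1 v) * fb v + (fa v)^2 * (C2 v / 4)) / 8 +
          (8 * C1 v * fc v + fa v * (- 8 * C1 v * fb v + (C3 v)^2)) / 8 -
          3/8 * (- 8 * C1 v * fc v + (C3 v)^2 * fa v) +
          (8 * C1 v * C3 v + fa v * (w6 v - 2 * (C3 v)^2)) / 4 = - 2 * C3 v * w4 v"
        unfolding fc by (simp add: w6_def w4_def w5_def field_simps power2_eq_square)
      show "48 * C1 v * (fb v)^2 - 24 * (C3 v)^2 * fb v +
          6 * (8 * C1 v * (fb v)^2 + 2 * fa v * fb v * (C2 v / 4)) +
          16 * (C2 v / 4 * fc v + fb v * (- 8 * C1 v * fb v + (C3 v)^2)) +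
          8 * (C2 v / 4 * C3 v + fb v * (w6 v - 2 * (C3 v)^2)) = - 2 * C3 v * w5 v"
        unfolding fc by (simp add: w6_def w4_def w5_def field_simps power2_eq_square)
      show "2 * C3 v * (w6 v - 2 * (C3 v)^2) - (8 * C1 v * w5 v + fa v * (- 2 * C3 v * w5 v)) / 8 +
          4 * (C2 v / 4 * w4 v + fb v * (- 2 * C3 v * w4 v)) = - 2 * C3 v * w6 v"
        by (simp add: w6_def w4_def w5_def field_simps power2_eq_square)
    qed
    moreover have "(w6 v - 2 * (C3 v)^2, vector [0, - 2 * C3 v * w4 v, - (- 2 * C3 v * w5 v)],
        vector [- (- 2 * C3 v * w6 v), 4 * (C2 v / 4), 8 * C1 v / 8], - (w6 v - 2 * (C3 v)^2)) =
        zorn_scale (\<tau> (g2_k 1 (- 1) (chart v))) (chart v) - g2_k 1 (- 1) (chart v)"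
      unfolding chart_action
      by (simp add: \<tau>_def chart_def vec_eq_iff forall_3 w4_def w5_def algebra_simps power2_eq_square)
    ultimately show ?thesis by simp
  qed
  show "realizes (on_dom U vS1) (g2_k 2 (- 1))"
    "realizes (on_dom U vS2) (g2_k 3 (- 1))"
    "realizes (on_dom U vS3) (g2_k 1 (- 1))"
    using 1 2 3 vS_alg by (simp_all add: realizes_def alg_field_on_dom) (simp_all add: on_dom_def)
qed

lemma pairwise_generation:
  assumes "U \<noteq> {}"
  shows "pairwise_bracket_generates_split_g2 \<iota> U vS1 vS2 vS3"
proof -
  note \<Phi>_S = realizes_S[THEN realizes_\<Phi>]
  have gen: "\<exists>V. realizes V (g2_k i (- 1))" for i
    using exhaust_3[of i] realizes_S by auto
  have nonzero: "\<Phi> (g2_k 2 (- 1)) \<noteq> 0"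
  proof
    assume "\<Phi> (g2_k 2 (- 1)) = 0"
    moreover obtain v where v: "v \<in> U" using assms by blast
    ultimately have "vS1 v $ Xc = 0"
      unfolding \<Phi>_S by (metis on_dom_def zero_fun_def zero_index)
    then show False using U_dom[OF v] by (simp add: vS1_nth)
  qed
  interpret rep: split_g2_representation vf_scale "lie_bracket \<iota> U" \<Phi>
    by (rule representation[OF gen nonzero])
  from rep.generation vS_alg[THEN alg_field_smooth] show ?thesis
    unfolding pairwise_bracket_generates_split_g2_def \<Phi>_S Let_def
    by (elim conjE, intro conjI; (assumption | blast))
qed

section \<open>The growth (2,3,5) of the distribution\<close>

abbreviation "vX1 \<equiv> vf \<iota> X1 :: ('k, 'f) vfield"
abbreviation "vX2 \<equiv> vf \<iota> (X2 A)"

text \<open>The value on \<open>U\<close> of the bracket of \<open>X1\<close> and \<open>X2\<close>,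
  as confirmed in \<open>vX_brackets\<close>.\<close>

definition vX12 :: "('k, 'f) vfield" where
  "vX12 v = \<partial> Pc + (2 * \<iota> (v $ Qc) * (em (v $ Xc))^2) *s \<partial> Zc"

lemma vX_nth:
  "vX1 v $ Xc = 0" "vX1 v $ Yc = 0" "vX1 v $ Zc = 0" "vX1 v $ Pc = 0" "vX1 v $ Qc = 1"
  "vX2 v $ Xc = 1" "vX2 v $ Yc = \<iota> (v $ Pc)" "vX2 v $ Zc = (\<iota> (v $ Qc))^2 * (em (v $ Xc))^2"
  "vX2 v $ Pc = \<iota> (v $ Qc)" "vX2 v $ Qc = 0"
  "vX12 v $ Xc = 0" "vX12 v $ Yc = 0" "vX12 v $ Zc = 2 * \<iota> (v $ Qc) * (em (v $ Xc))^2"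
  "vX12 v $ Pc = 1" "vX12 v $ Qc = 0"
  unfolding vf_def X1_def X2_def exp_em vX12_def by (simp_all add: axis_def)

lemma vX_alg: "alg_field vX1" "alg_field vX2" "alg_field vX12"
  by (intro alg_fieldI; unfold vX_nth; intro alg_rules)+

lemma coord_vec_eqI:
  fixes u w :: "'a ^ coord"
  assumes "u $ Xc = w $ Xc" "u $ Yc = w $ Yc" "u $ Zc = w $ Zc" "u $ Pc = w $ Pc" "u $ Qc = w $ Qc"
  shows "u = w"
proof -
  have "u $ i = w $ i" for i
    using assms by (cases i) simp_all
  then show ?thesis by (simp add: vec_eq_iff)
qed

abbreviation "D \<equiv> spanned_by vX1 vX2"

lemma D_iff: "u \<in> D v \<longleftrightarrow> u $ Yc = \<iota> (v $ Pc) * u $ Xc \<and> u $ Pc = \<iota> (v $ Qc) * u $ Xc \<and>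
    u $ Zc = (\<iota> (v $ Qc))^2 * (em (v $ Xc))^2 * u $ Xc" (is "_ \<longleftrightarrow> ?r")
proof
  have "vec.subspace {u :: 'f ^ coord. u $ Yc = \<iota> (v $ Pc) * u $ Xc \<and> u $ Pc = \<iota> (v $ Qc) * u $ Xc \<and>
    u $ Zc = (\<iota> (v $ Qc))^2 * (em (v $ Xc))^2 * u $ Xc}" (is "vec.subspace ?S")
    by (auto simp: vec.subspace_def algebra_simps)
  moreover have "{vX1 v, vX2 v} \<subseteq> ?S" by (simp add: vX_nth)
  ultimately have "D v \<subseteq> ?S" unfolding spanned_by_def by (intro vec.span_minimal)
  then show "u \<in> D v \<Longrightarrow> ?r" by blast
next
  assume ?r
  then have "u = u $ Qc *s vX1 v + u $ Xc *s vX2 v"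
    by (intro coord_vec_eqI) (simp_all add: vX_nth)
  then show "u \<in> D v"
    unfolding spanned_by_def by (metis insertI1 insertI2 vec.span_add vec.span_base vec.span_scale)
qed

lemma D_annihilator: "D v = annihilator \<iota> A v"
proof -
  have "(\<iota> (v $ Qc))^2 / exp (2/3 * A (v $ Xc)) = (\<iota> (v $ Qc))^2 * (em (v $ Xc))^2"
    unfolding exp_em by simp
  then show ?thesis
    unfolding annihilator_def set_eq_iff D_iff mem_Collect_eq by simp
qed

lemma smooth_hd:
  assumes "smooth_field \<iota> U V" "v \<in> U"
  shows "has_dird u (\<lambda>w. V w $ i) (dird u (\<lambda>w. V w $ i) v) v"
  using assms Ck.simps(2) unfolding smooth_field_def has_dird_def by blast

text \<open>On \<open>U\<close> the components \<open>Yc\<close>, \<open>Pc\<close>,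
  \<open>Zc\<close> of a section are explicit multiples of its \<open>Xc\<close> component, so the
  product rule gives their derivatives.\<close>

lemma section_dird:
  assumes V: "V \<in> sections \<iota> U D" and v: "v \<in> U"
  shows "dird u (\<lambda>w. V w $ Yc) v = u $ Pc * V v $ Xc + \<iota> (v $ Pc) * dird u (\<lambda>w. V w $ Xc) v"
    "dird u (\<lambda>w. V w $ Pc) v = u $ Qc * V v $ Xc + \<iota> (v $ Qc) * dird u (\<lambda>w. V w $ Xc) v"
    "dird u (\<lambda>w. V w $ Zc) v =
      (2 * \<iota> (v $ Qc) * u $ Qc - 2/3 * P (v $ Xc) * (\<iota> (v $ Qc))^2 * u $ Xc) * (em (v $ Xc))^2 * V v $ Xc
       + (\<iota> (v $ Qc))^2 * (em (v $ Xc))^2 * dird u (\<lambda>w. V w $ Xc) v"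
proof -
  have sm: "smooth_field \<iota> U V" and mem: "\<And>w. w \<in> U \<Longrightarrow> V w \<in> D w"
    using V by (auto simp: sections_def)
  note x = smooth_hd[OF sm v, of u Xc]
  note r = has_dird_dird[OF has_dird_cong[OF _ v]]
  show "dird u (\<lambda>w. V w $ Yc) v = u $ Pc * V v $ Xc + \<iota> (v $ Pc) * dird u (\<lambda>w. V w $ Xc) v"
    by (rule r[OF has_dird_mult[OF has_dird_coord x]]) (use mem in \<open>simp add: D_iff\<close>)
  show "dird u (\<lambda>w. V w $ Pc) v = u $ Qc * V v $ Xc + \<iota> (v $ Qc) * dird u (\<lambda>w. V w $ Xc) v"
    by (rule r[OF has_dird_mult[OF has_dird_coord x]]) (use mem in \<open>simp add: D_iff\<close>)
  show "dird u (\<lambda>w. V w $ Zc) v =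
      (2 * \<iota> (v $ Qc) * u $ Qc - 2/3 * P (v $ Xc) * (\<iota> (v $ Qc))^2 * u $ Xc) * (em (v $ Xc))^2 * V v $ Xc
       + (\<iota> (v $ Qc))^2 * (em (v $ Xc))^2 * dird u (\<lambda>w. V w $ Xc) v"
    by (rule trans[OF r[OF has_dird_mult[OF has_dird_mult[OF has_dird_power2[OF has_dird_coord[of u Qc v]] has_dird_power2[OF has_dird_gens(8)[OF v]]] x]]])
      (use mem in \<open>simp add: D_iff\<close>, simp add: algebra_simps power2_eq_square)
qed

text \<open>\<open>bracket_dist\<close> ranges over all sections and not over a frame, so the upper
  bound on the rank needs arbitrary ones. Derivatives of the sections enter only through the
  \<open>Xc\<close> and \<open>Qc\<close> components of the bracket, that is, through multiples of
  \<open>vX2\<close> and \<open>vX1\<close>; what remains is a derivative-free multiple of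
  \<open>vX12\<close>.\<close>

lemma section_bracket:
  assumes V: "V \<in> sections \<iota> U D" and W: "W \<in> sections \<iota> U D" and v: "v \<in> U"
  shows "lie_bracket \<iota> U V W v \<in> vec.span {vX12 v, vX1 v, vX2 v}"
proof -
  let ?L = "lie_bracket \<iota> U V W v"
  have mem: "V v \<in> D v" "W v \<in> D v" using V W v by (auto simp: sections_def)
  have "?L = (V v $ Qc * W v $ Xc - W v $ Qc * V v $ Xc) *s vX12 v + ?L $ Qc *s vX1 v + ?L $ Xc *s vX2 v"
    using mem unfolding D_iff
    by (intro coord_vec_eqI)
      (simp_all add: vX_nth lie_bracket_nth[OF v] section_dird[OF V v] section_dird[OF W v] algebra_simps)
  then show ?thesis
    by (metis (no_types, lifting) insertI1 insertI2 vec.span_add vec.span_base vec.span_scale)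
qed

lemma D_sections: "vX1 \<in> sections \<iota> U D" "vX2 \<in> sections \<iota> U D"
  using vX_alg by (auto simp: sections_def alg_field_smooth spanned_by_def vec.span_base)

lemma vX_brackets:
  assumes v: "v \<in> U"
  shows "lie_bracket \<iota> U vX1 vX2 v = vX12 v"
    "lie_bracket \<iota> U vX1 vX12 v = (2 * (em (v $ Xc))^2) *s \<partial> Zc"
    "lie_bracket \<iota> U vX2 vX12 v = - \<partial> Yc - (4/3 * P (v $ Xc) * \<iota> (v $ Qc) * (em (v $ Xc))^2) *s \<partial> Zc"
proof -
  note E = has_dird_power2[OF has_dird_gens(8)[OF v]]
  have d: "dird u (\<lambda>w. c) v = 0" "dird u (\<lambda>w. \<iota> (w $ i)) v = u $ i"
    "dird u (\<lambda>w. (\<iota> (w $ Qc))^2 * (em (w $ Xc))^2) v =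
      (2 * \<iota> (v $ Qc) * u $ Qc - 2/3 * P (v $ Xc) * (\<iota> (v $ Qc))^2 * u $ Xc) * (em (v $ Xc))^2"
    "dird u (\<lambda>w. 2 * \<iota> (w $ Qc) * (em (w $ Xc))^2) v =
      (2 * u $ Qc - 4/3 * P (v $ Xc) * \<iota> (v $ Qc) * u $ Xc) * (em (v $ Xc))^2" for u c i
    by (rule has_dird_dird[OF has_dird_const] has_dird_dird[OF has_dird_coord]
        trans[OF has_dird_dird[OF has_dird_mult[OF has_dird_power2[OF has_dird_coord] E]]]
        trans[OF has_dird_dird[OF has_dird_mult[OF has_dird_cmult[OF has_dird_coord] E]]];
        simp add: algebra_simps power2_eq_square)+
  show "lie_bracket \<iota> U vX1 vX2 v = vX12 v"
    "lie_bracket \<iota> U vX1 vX12 v = (2 * (em (v $ Xc))^2) *s \<partial> Zc"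
    "lie_bracket \<iota> U vX2 vX12 v = - \<partial> Yc - (4/3 * P (v $ Xc) * \<iota> (v $ Qc) * (em (v $ Xc))^2) *s \<partial> Zc"
    by (rule coord_vec_eqI; simp add: lie_bracket_nth[OF v] vX_nth d;
        simp add: axis_def algebra_simps power2_eq_square)+
qed

lemma bracket_D:
  assumes v: "v \<in> U"
  shows "bracket_dist \<iota> U D D v = vec.span {vX12 v, vX1 v, vX2 v}"
  unfolding bracket_dist_def
proof (rule antisym; rule vec.span_minimal)
  show "D v \<union> D v \<union> {lie_bracket \<iota> U V W v |V W. V \<in> sections \<iota> U D \<and> W \<in> sections \<iota> U D}
    \<subseteq> vec.span {vX12 v, vX1 v, vX2 v}"
    using section_bracket[OF _ _ v] vec.span_mono[of "{vX1 v, vX2 v}" "{vX12 v, vX1 v, vX2 v}"]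
    by (auto simp: spanned_by_def)
  have "vX12 v \<in> {lie_bracket \<iota> U V W v |V W. V \<in> sections \<iota> U D \<and> W \<in> sections \<iota> U D}"
    using vX_brackets(1)[OF v] D_sections by (metis (mono_tags, lifting) mem_Collect_eq)
  moreover have "{vX1 v, vX2 v} \<subseteq> D v" by (simp add: spanned_by_def vec.span_base)
  ultimately show "{vX12 v, vX1 v, vX2 v} \<subseteq> vec.span (D v \<union> D v \<union>
      {lie_bracket \<iota> U V W v |V W. V \<in> sections \<iota> U D \<and> W \<in> sections \<iota> U D})"
    by (auto intro: vec.span_base)
qed (rule vec.subspace_span)+

lemma distribution: "distribution_235 \<iota> U D"
  unfolding distribution_235_def
proof (intro ballI conjI)
  fix v assume v: "v \<in> U"
  have "vX1 v $ Qc \<noteq> 0 $ Qc" "vX1 v $ Qc \<noteq> vX2 v $ Qc" "vX2 v $ Xc \<noteq> 0 $ Xc"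
    by (simp_all add: vX_nth)
  then have ne: "vX1 v \<noteq> 0" "vX1 v \<noteq> vX2 v" "vX2 v \<noteq> 0"
    by metis+
  have "vX1 v \<notin> vec.span {vX2 v}"
  proof
    assume "vX1 v \<in> vec.span {vX2 v}"
    then obtain c where "vX1 v = c *s vX2 v" by (auto simp: vec.span_singleton)
    then have "vX1 v $ Xc = c * vX2 v $ Xc" "vX1 v $ Qc = c * vX2 v $ Qc" by simp_all
    then show False by (simp add: vX_nth)
  qed
  then have ind: "vec.independent {vX1 v, vX2 v}"
    using ne(3) by (simp add: vec.independent_insert)
  then show "vec.dim (D v) = 2"
    unfolding spanned_by_def using ne by (simp add: vec.dim_eq_card_independent)
  have n: "vX12 v \<notin> D v" by (simp add: D_iff vX_nth)
  then have "vX12 v \<notin> {vX1 v, vX2 v}" unfolding spanned_by_def by (metis vec.span_base)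
  then have "card {vX12 v, vX1 v, vX2 v} = 3" using ne by simp
  moreover have "vec.independent {vX12 v, vX1 v, vX2 v}"
    using n ind unfolding spanned_by_def by (rule vec.independent_insertI)
  ultimately show "vec.dim (bracket_dist \<iota> U D D v) = 3"
    unfolding bracket_D[OF v] by (simp add: vec.dim_eq_card_independent)
  let ?D' = "bracket_dist \<iota> U D D"
  have sec: "vX12 \<in> sections \<iota> U ?D'"
    using vX_alg by (simp add: sections_def alg_field_smooth bracket_D vec.span_base)
  let ?S = "D v \<union> ?D' v \<union> {lie_bracket \<iota> U V W v |V W. V \<in> sections \<iota> U D \<and> W \<in> sections \<iota> U ?D'}"
  have mem: "vX1 v \<in> ?S" "vX2 v \<in> ?S" "vX12 v \<in> ?S"
    "lie_bracket \<iota> U vX1 vX12 v \<in> ?S" "lie_bracket \<iota> U vX2 vX12 v \<in> ?S"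
    using sec D_sections by (auto simp: bracket_D[OF v] vec.span_base)
  have "u \<in> vec.span ?S" for u
  proof -
    \<comment> \<open>The other four fields fix all components but \<open>Zc\<close>;
      \<open>c\<close> is what is then missing there, and the bracket of \<open>vX1\<close> with
      \<open>vX12\<close>, a nonzero multiple of \<open>\<partial> Zc\<close>, supplies it. The
      direction of \<open>y\<close> comes from the bracket of \<open>vX2\<close> with
      \<open>vX12\<close>.\<close>
    define c where "c = u $ Zc - u $ Xc * vX2 v $ Zc - (u $ Pc - \<iota> (v $ Qc) * u $ Xc) * vX12 v $ Zc
      - (\<iota> (v $ Pc) * u $ Xc - u $ Yc) * (lie_bracket \<iota> U vX2 vX12 v $ Zc)"
    have "u = u $ Xc *s vX2 v + (\<iota> (v $ Pc) * u $ Xc - u $ Yc) *s lie_bracket \<iota> U vX2 vX12 v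
        + (u $ Pc - \<iota> (v $ Qc) * u $ Xc) *s vX12 v + u $ Qc *s vX1 v
        + (c / (2 * (em (v $ Xc))^2)) *s lie_bracket \<iota> U vX1 vX12 v"
      by (rule coord_vec_eqI; simp add: vX_brackets(2,3)[OF v] vX_nth c_def;
          simp add: axis_def algebra_simps)
    also have "\<dots> \<in> vec.span ?S"
      by (intro vec.span_add vec.span_scale vec.span_base mem)
    finally show ?thesis .
  qed
  then show "bracket_dist \<iota> U D ?D' v = UNIV"
    unfolding bracket_dist_def[of \<iota> U D ?D'] by blast
qed

end

theorem theorem4p1:
  fixes \<iota> :: "'k::real_normed_field \<Rightarrow> 'f::{real_normed_field,banach}"
    and P A \<rho> chi :: "'k \<Rightarrow> 'f"
    and I :: "'k set" and U :: "'k point set"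
  assumes "scalar_embedding \<iota>"
    and "open I"
    and "chazy_solution \<iota> (3/2) I P"
    and "\<forall>x\<in>I. has_sderiv \<iota> A (P x) x"
    and "\<forall>x\<in>I. sdiff \<iota> \<rho> x \<and> sdiff \<iota> (sderiv \<iota> \<rho>) x \<and>
           sderiv \<iota> (sderiv \<iota> \<rho>) x - 1/45 * Qf \<iota> P x * \<rho> x = 0"
    and "\<exists>x\<in>I. \<rho> x \<noteq> 0"
    and "\<forall>x\<in>I. \<rho> x \<noteq> 0 \<longrightarrow> has_sderiv \<iota> chi (1 / (\<rho> x)^2) x"
    and "open U" and "U \<noteq> {}"
    and "\<forall>v\<in>U. v $ Xc \<in> I \<and> \<rho> (v $ Xc) \<noteq> 0"
  shows "distribution_235 \<iota> U (spanned_by (vf \<iota> X1) (vf \<iota> (X2 A)))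
    \<and> (\<forall>v\<in>U. spanned_by (vf \<iota> X1) (vf \<iota> (X2 A)) v = annihilator \<iota> A v)
    \<and> pairwise_bracket_generates_split_g2 \<iota> U
        (vf \<iota> (S1 \<iota> P A \<rho>)) (vf \<iota> (S2 A \<rho>)) (vf \<iota> (S3 \<iota> P A \<rho> chi))"
proof -
  interpret chazy_setting \<iota> P A \<rho> chi I U
    using assms by unfold_locales auto
  show ?thesis
    using distribution D_annihilator pairwise_generation assms by blast
qed

end
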